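(* For any scaling function $\{a_n(t)\}_{n\in\mathbb{N},t>0}$ satisfying $\lim_{n\to+\infty}\frac{\log a_n(t)}{n}=0$ for every $t>0$, there exists a Lebesgue measure preserving transformation $T$ with good cyclic approximation and $\overline{\mathrm{ent}}_{a_n(t)}^{\mu}(T)=\infty$.
   Context: Scaling function: a family $\{a_n(t)\}_{n\in\mathbb{N},t>0}$ of positive sequences increasing to infinity and monotone in $t$, i.e. $a_n(t)\le a_{n+1}(t)$, $\lim_{n\to\infty}a_n(t)=+\infty$ for every $t>0$, and $a_n(t_1)\le a_n(t_2)$ for $t_2>t_1>0$. "Lebesgue measure preserving transformation" means an invertible transformation $T$ of $X$ preserving normalized Lebesgue measure $\mu$; the constructions can be viewed as taking place on $X=\mathbb{T}^2=\mathbb{R}^2/\mathbb{Z}^2$, the disc $\mathbb{D}$, or the annulus $\mathbb{A}=\mathbb{S}^1\times[0,1]$. Good cyclic approximation. A cyclic process of height $q$ on $(X,\mu)$ is a partition $\xi=\{c_1,\dots,c_q\}$ of $X$ into sets of equal measure (a single tower covering $X$) together with a cyclic measure-preserving permutation $\sigma$ with $\sigma(c_i)=c_{i+1}$, $c_{q+1}=c_1$. A sequence $(\xi_n,\sigma_n)$ of cyclic processes is exhaustive if $\xi_n$ converges to the decomposition into points as $n\to\infty$. An exhaustive sequence of cyclic processes, with heights $q_n$, is a cyclic approximation of $T$ if $\sum_{c\in\xi_n}\mu(Tc\,\triangle\,\sigma_nc)\to0$ as $n\to\infty$; it has speed $g(n)$ if $\sum_{c\in\xi_{n_k}}\mu(Tc\,\triangle\,\sigma_{n_k}c)<g(n_k)$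 for a certain subsequence $\{n_k\}$. $T$ has a good cyclic approximation if it admits a cyclic approximation with speed $o(1/q_n)$. Upper slow entropy. For a finite measurable partition $\mathcal{P}=\{P_1,\dots,P_m\}$, the $n$-name of $x$ is $w(x)=(w_k(x))_{k=0}^{n-1}\in\{1,\dots,m\}^n$ with $T^k(x)\in P_{w_k(x)}$. For words of length $n$, $d_n^H(w,w')=\frac1n\#\{0\le k\le n-1: w_k\ne w'_k\}$ (Hamming metric). Put $B_{\mathcal{P},n}(x,T,\epsilon)=\{y\in X: d_n^H(w(x),w(y))<\epsilon\}$ and let $S_{\mathcal{P}}(T,n,\epsilon)$ be the minimal cardinality of a family of such balls whose union has $\mu$-measure greater than $1-\epsilon$. Let $B(\epsilon,\mathcal{P})=\{t>0:\limsup_{n\to\infty}\frac{S_{\mathcal{P}}(T,n,\epsilon)}{a_n(t)}>0\}$, $A(\epsilon,\mathcal{P})=\sup B(\epsilon,\mathcal{P})$ if this set is nonempty and $A(\epsilon,\mathcal{P})=0$ otherwise. Then $\overline{\mathrm{ent}}_{a_n(t)}^{\mu}(T)=\sup_{\mathcal{P}}\lim_{\epsilon\to0}A(\epsilon,\mathcal{P})$, the supremum being over finite measurable partitions. *)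

theory Defs
  imports
    "HOL-Probability.Probability"
    "HOL-Library.Landau_Symbols"
begin

section \<open>Phase spaces\<close>

text \<open>
  Only the measure space underlying each phase space is relevant. The circle \<open>\<real>/\<int>\<close> is represented
  by its fundamental domain \<open>[0,1)\<close>, so the torus is \<open>[0,1) \<times> [0,1)\<close> and the annulus is
  \<open>[0,1) \<times> [0,1]\<close>. The norm on \<^typ>\<open>real \<times> real\<close> is Euclidean, so \<open>cball 0 1\<close> is the closed unit disc.
\<close>

definition torus :: "(real \<times> real) set" where
  "torus = {0..<1} \<times> {0..<1}"

definition disc :: "(real \<times> real) set" where
  "disc = cball 0 1"

definition annulus :: "(real \<times> real) set" where
  "annulus = {0..<1} \<times> {0..1}"

definition normalized_lebesgue :: "'a::euclidean_space set \<Rightarrow> 'a measure" where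
  "normalized_lebesgue X = uniform_measure (lebesgue_on X) X"

definition invertible_mpt :: "'a measure \<Rightarrow> ('a \<Rightarrow> 'a) \<Rightarrow> bool" where
  "invertible_mpt M T \<longleftrightarrow>
     bij_betw T (space M) (space M) \<and>
     T \<in> measurable M M \<and>
     inv_into (space M) T \<in> measurable M M \<and>
     distr M M T = M"


section \<open>Good cyclic approximation\<close>

text \<open>
  The permutation \<open>\<sigma>\<close> acts on the atoms of \<open>\<xi>\<close>; it preserves measure because all atoms have the same
  measure. The height of the process is \<open>card \<xi>\<close>.
\<close>

definition cyclic_process :: "'a measure \<Rightarrow> 'a set set \<Rightarrow> ('a set \<Rightarrow> 'a set) \<Rightarrow> bool" where
  "cyclic_process M \<xi> \<sigma> \<longleftrightarrow>
     finite \<xi> \<and> partition_on (space M) \<xi> \<and> \<xi> \<subseteq> sets M \<and>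
     (\<forall>A\<in>\<xi>. \<forall>B\<in>\<xi>. measure M A = measure M B) \<and>
     (\<exists>c. bij_betw c {1..card \<xi>} \<xi> \<and>
          (\<forall>i\<in>{1..<card \<xi>}. \<sigma> (c i) = c (Suc i)) \<and>
          \<sigma> (c (card \<xi>)) = c 1)"

text \<open>
  Convergence of partitions to the decomposition into points: every measurable set is approximated
  in measure by unions of atoms of \<open>\<xi> n\<close>.
\<close>

definition converges_to_points :: "'a measure \<Rightarrow> (nat \<Rightarrow> 'a set set) \<Rightarrow> bool" where
  "converges_to_points M \<xi> \<longleftrightarrow>
     (\<forall>A\<in>sets M. \<exists>\<beta>. (\<forall>n. \<beta> n \<subseteq> \<xi> n) \<and>
        (\<lambda>n. measure M (sym_diff A (\<Union>(\<beta> n)))) \<longlonglongrightarrow> 0)"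

definition exhaustive_cyclic_processes ::
  "'a measure \<Rightarrow> (nat \<Rightarrow> 'a set set) \<Rightarrow> (nat \<Rightarrow> 'a set \<Rightarrow> 'a set) \<Rightarrow> bool" where
  "exhaustive_cyclic_processes M \<xi> \<sigma> \<longleftrightarrow>
     (\<forall>n. cyclic_process M (\<xi> n) (\<sigma> n)) \<and> converges_to_points M \<xi>"

definition approximation_error ::
  "'a measure \<Rightarrow> ('a \<Rightarrow> 'a) \<Rightarrow> 'a set set \<Rightarrow> ('a set \<Rightarrow> 'a set) \<Rightarrow> real" where
  "approximation_error M T \<xi> \<sigma> = (\<Sum>c\<in>\<xi>. measure M (sym_diff (T ` c) (\<sigma> c)))"

definition cyclic_approximation ::
  "'a measure \<Rightarrow> ('a \<Rightarrow> 'a) \<Rightarrow> (nat \<Rightarrow> 'a set set) \<Rightarrow> (nat \<Rightarrow> 'a set \<Rightarrow> 'a set) \<Rightarrow> bool" where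
  "cyclic_approximation M T \<xi> \<sigma> \<longleftrightarrow>
     exhaustive_cyclic_processes M \<xi> \<sigma> \<and>
     (\<lambda>n. approximation_error M T (\<xi> n) (\<sigma> n)) \<longlonglongrightarrow> 0"

definition has_speed ::
  "'a measure \<Rightarrow> ('a \<Rightarrow> 'a) \<Rightarrow> (nat \<Rightarrow> 'a set set) \<Rightarrow> (nat \<Rightarrow> 'a set \<Rightarrow> 'a set) \<Rightarrow>
   (nat \<Rightarrow> real) \<Rightarrow> bool" where
  "has_speed M T \<xi> \<sigma> g \<longleftrightarrow>
     (\<exists>r :: nat \<Rightarrow> nat. strict_mono r \<and>
        (\<forall>k. approximation_error M T (\<xi> (r k)) (\<sigma> (r k)) < g (r k)))"

definition good_cyclic_approximation :: "'a measure \<Rightarrow> ('a \<Rightarrow> 'a) \<Rightarrow> bool" where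
  "good_cyclic_approximation M T \<longleftrightarrow>
     (\<exists>\<xi> \<sigma> g. cyclic_approximation M T \<xi> \<sigma> \<and>
        has_speed M T \<xi> \<sigma> g \<and> g \<in> o(\<lambda>n. 1 / real (card (\<xi> n))))"


section \<open>Upper slow entropy\<close>

definition scaling_function :: "(nat \<Rightarrow> real \<Rightarrow> real) \<Rightarrow> bool" where
  "scaling_function a \<longleftrightarrow>
     (\<forall>n. \<forall>t>0. a n t > 0) \<and>
     (\<forall>n. \<forall>t>0. a n t \<le> a (Suc n) t) \<and>
     (\<forall>t>0. filterlim (\<lambda>n. a n t) at_top sequentially) \<and>
     (\<forall>n s t. 0 < s \<and> s < t \<longrightarrow> a n s \<le> a n t)"

definition measurable_partition :: "'a measure \<Rightarrow> nat \<Rightarrow> (nat \<Rightarrow> 'a set) \<Rightarrow> bool" where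
  "measurable_partition M m P \<longleftrightarrow>
     (\<forall>i\<in>{1..m}. P i \<in> sets M) \<and>
     disjoint_family_on P {1..m} \<and>
     (\<Union>i\<in>{1..m}. P i) = space M"

definition name :: "nat \<Rightarrow> (nat \<Rightarrow> 'a set) \<Rightarrow> ('a \<Rightarrow> 'a) \<Rightarrow> nat \<Rightarrow> 'a \<Rightarrow> nat list" where
  "name m P T n x = map (\<lambda>k. THE i. i \<in> {1..m} \<and> (T ^^ k) x \<in> P i) [0..<n]"

definition hamming_dist :: "nat \<Rightarrow> nat list \<Rightarrow> nat list \<Rightarrow> real" where
  "hamming_dist n w w' = real (card {k. k < n \<and> w ! k \<noteq> w' ! k}) / real n"

definition hamming_ball ::
  "'a measure \<Rightarrow> nat \<Rightarrow> (nat \<Rightarrow> 'a set) \<Rightarrow> ('a \<Rightarrow> 'a) \<Rightarrow> nat \<Rightarrow> real \<Rightarrow> 'a \<Rightarrow> 'a set" where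
  "hamming_ball M m P T n \<epsilon> x =
     {y \<in> space M. hamming_dist n (name m P T n x) (name m P T n y) < \<epsilon>}"

definition covering_number ::
  "'a measure \<Rightarrow> nat \<Rightarrow> (nat \<Rightarrow> 'a set) \<Rightarrow> ('a \<Rightarrow> 'a) \<Rightarrow> nat \<Rightarrow> real \<Rightarrow> nat" where
  "covering_number M m P T n \<epsilon> =
     (LEAST N. \<exists>\<B>. \<B> \<subseteq> hamming_ball M m P T n \<epsilon> ` space M \<and>
        finite \<B> \<and> card \<B> = N \<and> measure M (\<Union>\<B>) > 1 - \<epsilon>)"

definition entropy_set ::
  "(nat \<Rightarrow> real \<Rightarrow> real) \<Rightarrow> 'a measure \<Rightarrow> ('a \<Rightarrow> 'a) \<Rightarrow> nat \<Rightarrow> (nat \<Rightarrow> 'a set) \<Rightarrow> real \<Rightarrow> real set" where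
  "entropy_set a M T m P \<epsilon> =
     {t. t > 0 \<and> limsup (\<lambda>n. ereal (real (covering_number M m P T n \<epsilon>) / a n t)) > 0}"

definition entropy_at ::
  "(nat \<Rightarrow> real \<Rightarrow> real) \<Rightarrow> 'a measure \<Rightarrow> ('a \<Rightarrow> 'a) \<Rightarrow> nat \<Rightarrow> (nat \<Rightarrow> 'a set) \<Rightarrow> real \<Rightarrow> ereal" where
  "entropy_at a M T m P \<epsilon> =
     (if entropy_set a M T m P \<epsilon> = {} then 0 else (SUP t\<in>entropy_set a M T m P \<epsilon>. ereal t))"

text \<open>The limit exists in \<^typ>\<open>ereal\<close>, since \<^const>\<open>entropy_at\<close> is nonincreasing in
  \<open>\<epsilon> > 0\<close> when \<open>T\<close> preserves the probability measure \<open>M\<close>.\<close>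

definition upper_slow_entropy ::
  "(nat \<Rightarrow> real \<Rightarrow> real) \<Rightarrow> 'a measure \<Rightarrow> ('a \<Rightarrow> 'a) \<Rightarrow> ereal" where
  "upper_slow_entropy a M T =
     (SUP (m, P)\<in>{(m, P). measurable_partition M m P}.
        Lim (at_right 0) (\<lambda>\<epsilon>. entropy_at a M T m P \<epsilon>))"

end

(*
  An invertible map T is built on [0,1) as an almost sure limit of cyclic interval exchanges T_k of
  q_k cells and is then carried over to X by an isomorphism modulo null sets. Stage k + 1 arranges
  q_{k+1} / q_k passes through the k-th tower. Passes come in long runs that start either at the
  bottom of the tower or at its middle, so leaving the k-th cycle is so rare that the cyclic
  approximation has error o(1/q_k). The two-set partition given by stage 0 is exchanged by the
  half-turn of every tower, hence the two kinds of runs produce names that differ everywhere. Letting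
  the pattern of runs exhaust all binary words of length L makes the number of Hamming balls at
  times n comparable to L * (run length) at least exp(c n), where c > 0 is fixed before n is chosen;
  as a_n(t) grows subexponentially, n can be taken so large that it is overtaken.
*)

theory Submission
  imports Defs "HOL-Real_Asymp.Real_Asymp"
begin

section \<open>Isomorphisms modulo null sets\<close>

text \<open>The two demands on the map pull in opposite directions: approximation at speed
  \<open>o(1/q k)\<close> wants tower \<open>k\<close> to be climbed cyclically, while many names
  need frequent changes of pattern. They are reconciled by time scales. A pattern changes at most
  once per run of \<open>k + 30\<close> passes, which makes the error of order
  \<open>1/(q k * (k + 30))\<close>. Names are counted at time
  \<open>n = 2 * L * (k + 30) * q k\<close>: two superblocks of \<open>L\<close> runs, hence a full
  word whatever the starting point, yet at most \<open>q (k + 1)\<close>, so that most orbits follow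
  tower \<open>k + 1\<close> without defect up to time \<open>n\<close>.

  The constants: with \<open>L = 8 * l\<close> there are \<open>256 ^ l\<close> words, and at most
  \<open>64 ^ l\<close> of them lie within Hamming distance \<open>l\<close> of a given one, so
  about \<open>4 ^ l\<close> balls are needed. Since \<open>(k + 30) * q k\<close> is known before
  \<open>l\<close> is chosen, this is exponential in \<open>n\<close>.

  The half-turn has to negate the colouring of every tower, since otherwise the next stage would not
  have two kinds of runs with opposite names. This is why the list of all words is followed by the
  list of their complements.\<close>

definition mod0_iso :: "'a measure \<Rightarrow> 'b measure \<Rightarrow> ('a \<Rightarrow> 'b) \<Rightarrow> ('b \<Rightarrow> 'a) \<Rightarrow> bool" where
  "mod0_iso M N f g \<longleftrightarrow>
     f \<in> M \<rightarrow>\<^sub>M N \<and> g \<in> N \<rightarrow>\<^sub>M M \<and> distr M N f = N \<and> distr N M g = M \<and>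
     (AE x in M. g (f x) = x) \<and> (AE y in N. f (g y) = y)"

lemma mod0_isoD:
  assumes "mod0_iso M N f g"
  shows "f \<in> M \<rightarrow>\<^sub>M N" "g \<in> N \<rightarrow>\<^sub>M M" "distr M N f = N" "distr N M g = M"
    "AE x in M. g (f x) = x" "AE y in N. f (g y) = y"
  using assms by (auto simp: mod0_iso_def)

lemma mod0_iso_sym: "mod0_iso M N f g \<Longrightarrow> mod0_iso N M g f"
  by (auto simp: mod0_iso_def)

lemma AE_mp_map:
  assumes "f \<in> M \<rightarrow>\<^sub>M N" "distr M N f = N" "AE y in N. P y"
  shows "AE x in M. P (f x)"
  by (rule AE_distrD[OF assms(1)]) (simp only: assms)

lemma mod0_iso_comp:
  assumes "mod0_iso M N f g" "mod0_iso N K f' g'"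
  shows "mod0_iso M K (\<lambda>x. f' (f x)) (\<lambda>y. g (g' y))"
proof -
  note 1 = mod0_isoD[OF assms(1)] and 2 = mod0_isoD[OF assms(2)]
  have m: "(\<lambda>x. f' (f x)) \<in> M \<rightarrow>\<^sub>M K" "(\<lambda>y. g (g' y)) \<in> K \<rightarrow>\<^sub>M M"
    using 1 2 by (auto intro: measurable_compose)
  have d1: "distr M K (\<lambda>x. f' (f x)) = K"
    using distr_distr[OF 2(1) 1(1)] 1(3) 2(3) by (simp add: o_def)
  have d2: "distr K M (\<lambda>x. g (g' x)) = M"
    using distr_distr[OF 1(2) 2(2)] 1(4) 2(4) by (simp add: o_def)
  have a1: "AE x in M. g (g' (f' (f x))) = x"
    using AE_mp_map[OF 1(1) 1(3) 2(5)] 1(5) by eventually_elim simp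
  have a2: "AE y in K. f' (f (g (g' y))) = y"
    using AE_mp_map[OF 2(2) 2(4) 1(6)] 2(6) by eventually_elim simp
  show ?thesis using m d1 d2 a1 a2 by (simp add: mod0_iso_def)
qed

lemma funpow_mp:
  assumes "f \<in> M \<rightarrow>\<^sub>M M" "distr M M f = M"
  shows "(f ^^ n) \<in> M \<rightarrow>\<^sub>M M \<and> distr M M (f ^^ n) = M"
proof (induction n)
  case 0 show ?case by (simp add: distr_id2 id_def)
next
  case (Suc n)
  then have "distr M M (f \<circ> f ^^ n) = M" using assms distr_distr[of f M M "f ^^ n" M] by simp
  then show ?case using Suc assms(1) by (auto intro: measurable_comp simp only: funpow.simps)
qed

text \<open>\<open>invertible_mpt\<close> asks for a bijection at every point, whereas
  \<open>U\<close> and \<open>V\<close> are mutually inverse only almost everywhere. The remedy is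
  the set \<open>C\<close> of points whose iterates under \<open>U\<close> and under
  \<open>V\<close> all stay where both inverse laws hold. It has full measure and both maps send it
  into itself, so \<open>U\<close> on \<open>C\<close> together with the identity off
  \<open>C\<close> is a genuine bijection.\<close>

lemma invertible_mpt_of_mod0_iso:
  assumes "mod0_iso M M U V"
  obtains T where "invertible_mpt M T" "AE x in M. T x = U x"
proof -
  note UV = mod0_isoD[OF assms]
  have "AE x in M. V (U x) = x \<and> U (V x) = x" using UV(5,6) by eventually_elim simp
  then obtain N where N: "N \<in> null_sets M"
    and "{x \<in> space M. \<not> (V (U x) = x \<and> U (V x) = x)} \<subseteq> N"
    unfolding eventually_ae_filter by blast
  define G where "G = space M - N"
  have G: "G \<in> sets M" using N by (auto simp: G_def)
  have GI: "V (U x) = x" "U (V x) = x" if "x \<in> G" for x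
    using that \<open>_ \<subseteq> N\<close> by (auto simp: G_def)
  have GA: "AE x in M. x \<in> G" using AE_not_in[OF N] AE_space by eventually_elim (auto simp: G_def)
  have Un: "(U ^^ n) \<in> M \<rightarrow>\<^sub>M M" "distr M M (U ^^ n) = M" for n
    using funpow_mp[OF UV(1,3)] by auto
  have Vn: "(V ^^ n) \<in> M \<rightarrow>\<^sub>M M" "distr M M (V ^^ n) = M" for n
    using funpow_mp[OF UV(2,4)] by auto
  note [measurable] = Un(1) Vn(1) G UV(1,2)
  define C where "C = {x \<in> space M. \<forall>n. (U ^^ n) x \<in> G \<and> (V ^^ n) x \<in> G}"
  have [measurable]: "C \<in> sets M" unfolding C_def by measurable
  have CA: "AE x in M. x \<in> C"
  proof -
    have "AE x in M. \<forall>n. (U ^^ n) x \<in> G \<and> (V ^^ n) x \<in> G"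
      unfolding AE_all_countable
    proof
      fix n
      show "AE x in M. (U ^^ n) x \<in> G \<and> (V ^^ n) x \<in> G"
        using AE_mp_map[OF Un GA] AE_mp_map[OF Vn GA] by eventually_elim simp
    qed
    then show ?thesis using AE_space by eventually_elim (auto simp: C_def)
  qed
  have CG: "x \<in> C \<Longrightarrow> x \<in> G" for x by (auto simp: C_def dest!: spec[of _ 0])
  have UC: "U x \<in> C" if "x \<in> C" for x
  proof -
    have "(U ^^ n) (U x) \<in> G" for n
      using that by (auto simp: C_def funpow_swap1 dest!: spec[of _ "Suc n"])
    moreover have "(V ^^ n) (U x) \<in> G" for n
    proof (cases n)
      case 0 then show ?thesis using that by (auto simp: C_def dest!: spec[of _ "Suc 0"])
    next
      case (Suc k)
      have "(V ^^ n) (U x) = (V ^^ k) (V (U x))" using Suc by (simp add: funpow_swap1)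
      then show ?thesis using that GI(1)[OF CG[OF that]] by (auto simp: C_def)
    qed
    ultimately show ?thesis using that measurable_space[OF UV(1)] by (auto simp: C_def)
  qed
  have VC: "V x \<in> C" if "x \<in> C" for x
  proof -
    have "(V ^^ n) (V x) \<in> G" for n
      using that by (auto simp: C_def funpow_swap1 dest!: spec[of _ "Suc n"])
    moreover have "(U ^^ n) (V x) \<in> G" for n
    proof (cases n)
      case 0 then show ?thesis using that by (auto simp: C_def dest!: spec[of _ "Suc 0"])
    next
      case (Suc k)
      have "(U ^^ n) (V x) = (U ^^ k) (U (V x))" using Suc by (simp add: funpow_swap1)
      then show ?thesis using that GI(2)[OF CG[OF that]] by (auto simp: C_def)
    qed
    ultimately show ?thesis using that measurable_space[OF UV(2)] by (auto simp: C_def)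
  qed
  define T where "T x = (if x \<in> C then U x else x)" for x
  define S where "S x = (if x \<in> C then V x else x)" for x
  have Tsp: "x \<in> space M \<Longrightarrow> T x \<in> space M" "x \<in> space M \<Longrightarrow> S x \<in> space M" for x
    using measurable_space[OF UV(1)] measurable_space[OF UV(2)] by (auto simp: T_def S_def)
  have ST: "S (T x) = x" "T (S x) = x" for x
    using UC VC GI CG by (auto simp: T_def S_def)
  have bij: "bij_betw T (space M) (space M)"
    by (rule bij_betw_byWitness[where f' = S]) (use ST Tsp in auto)
  have T[measurable]: "T \<in> M \<rightarrow>\<^sub>M M" and S: "S \<in> M \<rightarrow>\<^sub>M M"
    unfolding T_def[abs_def] S_def[abs_def] by measurable
  have inv: "inv_into (space M) T x = S x" if "x \<in> space M" for x
    using bij that ST Tsp by (metis bij_betw_inv_into_left)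
  have "inv_into (space M) T \<in> M \<rightarrow>\<^sub>M M"
    using S by (subst measurable_cong[OF inv]) auto
  moreover have ae: "AE x in M. T x = U x" using CA by eventually_elim (auto simp: T_def)
  moreover have "distr M M T = M"
    using distr_cong_AE[OF refl refl ae T UV(1)] UV(3) by simp
  ultimately show ?thesis using bij T by (intro that[of T]) (simp_all add: invertible_mpt_def)
qed

section \<open>Planar Borel sets and the unit interval\<close>

text \<open>The space is the whole line, so that maps on the reals need no restriction of their
  domain; everything outside \<open>{0..<1}\<close> is null.\<close>

definition unit_lborel :: "real measure" where
  "unit_lborel = uniform_measure lborel {0..<1}"

text \<open>The Borel counterpart of \<open>normalized_lebesgue\<close>. The isomorphism with the
  interval is built for Borel sets; Lebesgue sets are reached later by enclosing them between Borel
  sets.\<close>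

definition borel_uniform :: "'a::euclidean_space set \<Rightarrow> 'a measure" where
  "borel_uniform X = uniform_measure (restrict_space lborel X) X"

lemma space_unit_lborel [simp]: "space unit_lborel = UNIV"
  and sets_unit_lborel [simp, measurable_cong]: "sets unit_lborel = sets borel"
  by (simp_all add: unit_lborel_def)

lemma prob_space_unit_lborel: "prob_space unit_lborel"
  unfolding unit_lborel_def by (rule prob_space_uniform_measure) simp_all

interpretation unit_lborel: prob_space unit_lborel
  by (rule prob_space_unit_lborel)

lemma emeasure_unit_lborel: "A \<in> sets borel \<Longrightarrow> emeasure unit_lborel A = emeasure lborel ({0..<1} \<inter> A)"
  by (simp add: unit_lborel_def divide_ennreal_def)

text \<open>Only the digits 0 and 1 occur in base 4, so the tail behind any digit is worth less than
  one unit of that digit and floors recover every bit. In base 2 the tails could carry.\<close>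

definition code :: "(nat \<Rightarrow> bool) \<Rightarrow> real" where
  "code b = (\<Sum>n. of_bool (b n) / 4 ^ Suc n)"

definition digit :: "nat \<Rightarrow> real \<Rightarrow> bool" where
  "digit n z \<longleftrightarrow> \<lfloor>4 ^ Suc n * z\<rfloor> mod 4 = 1"

lemma summable_code: "summable (\<lambda>n. of_bool (b n) / 4 ^ Suc n :: real)"
proof (rule summable_comparison_test'[where N=0])
  show "summable (\<lambda>n. (1/4::real) ^ n)" by (rule summable_geometric) simp
  show "norm (of_bool (b n) / 4 ^ Suc n :: real) \<le> (1/4) ^ n" for n
    by (auto simp: field_simps)
qed

lemma code_bounds: "0 \<le> code b" "code b < 1"
proof -
  show "0 \<le> code b" unfolding code_def by (intro suminf_nonneg summable_code) auto
  have g: "(\<lambda>n. (1/4) * (1/4::real) ^ n) sums ((1/4) * (1 / (1 - 1/4)))"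
    by (intro sums_mult geometric_sums) simp
  have "code b \<le> (\<Sum>n. (1/4) * (1/4::real) ^ n)" unfolding code_def
    by (intro suminf_le summable_code sums_summable[OF g]) (auto simp: field_simps)
  also have "\<dots> = 1/3" using sums_unique[OF g] by simp
  finally show "code b < 1" by simp
qed

lemma code_Suc: "4 * code b = of_bool (b 0) + code (\<lambda>n. b (Suc n))"
proof -
  have "code b = of_bool (b 0) / 4 + (\<Sum>n. of_bool (b (Suc n)) / 4 ^ Suc (Suc n))"
    unfolding code_def using suminf_split_head[OF summable_code[of b]] by simp
  also have "(\<Sum>n. of_bool (b (Suc n)) / 4 ^ Suc (Suc n) :: real)
      = (\<Sum>n. (1/4) * (of_bool (b (Suc n)) / 4 ^ Suc n))"
    by simp
  also have "\<dots> = (1/4) * code (\<lambda>n. b (Suc n))" unfolding code_def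
    by (rule suminf_mult[OF summable_code])
  finally show ?thesis by simp
qed

lemma digit_code: "digit n (code b) = b n"
proof (induction n arbitrary: b)
  case 0
  have "\<lfloor>4 * code b\<rfloor> = of_bool (b 0)"
    unfolding code_Suc using code_bounds[of "\<lambda>n. b (Suc n)"] by (auto simp: floor_eq_iff)
  then show ?case by (simp add: digit_def)
next
  case (Suc n)
  let ?c = "code (\<lambda>n. b (Suc n))"
  have "4 ^ Suc (Suc n) * code b = 4 ^ Suc n * (4 * code b)" by simp
  also have "\<dots> = of_int (4 * (4 ^ n * of_bool (b 0))) + 4 ^ Suc n * ?c"
    unfolding code_Suc by (simp add: algebra_simps)
  finally have "4 ^ Suc (Suc n) * code b = of_int (4 * (4 ^ n * of_bool (b 0))) + 4 ^ Suc n * ?c" .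
  moreover have "\<lfloor>of_int k + x\<rfloor> = k + \<lfloor>x\<rfloor>" for k :: int and x :: real by linarith
  ultimately have "\<lfloor>4 ^ Suc (Suc n) * code b\<rfloor> = 4 * (4 ^ n * of_bool (b 0)) + \<lfloor>4 ^ Suc n * ?c\<rfloor>"
    by metis
  then have "\<lfloor>4 ^ Suc (Suc n) * code b\<rfloor> mod 4 = \<lfloor>4 ^ Suc n * ?c\<rfloor> mod 4"
    by (simp only: mod_mult_self4)
  then show ?case using Suc.IH[of "\<lambda>n. b (Suc n)"] by (simp only: digit_def)
qed

text \<open>Recovers a real number from its lower Dedekind cut by a countable supremum, which makes
  decoding Borel measurable. Rationals outside the cut contribute \<open>-\<infinity>\<close>, hence
  the extended reals.\<close>

lemma ereal_SUP_rat_less: "(SUP n. if real_of_rat (from_nat n) < x then ereal (of_rat (from_nat n)) else -\<infinity>) = ereal x"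
proof (rule antisym)
  show "(SUP n. if real_of_rat (from_nat n) < x then ereal (of_rat (from_nat n)) else -\<infinity>) \<le> ereal x"
    by (rule SUP_least) auto
  show "ereal x \<le> (SUP n. if real_of_rat (from_nat n) < x then ereal (of_rat (from_nat n)) else -\<infinity>)"
  proof (rule dense_le)
    fix z assume z: "z < ereal x"
    obtain z' where z': "z < ereal z'" "z' < x"
      using ereal_dense2[OF z] by auto
    obtain r where r: "z' < of_rat r" "of_rat r < x" using of_rat_dense[OF z'(2)] by auto
    have "ereal (of_rat r) \<le> (SUP n. if real_of_rat (from_nat n) < x then ereal (of_rat (from_nat n)) else -\<infinity>)"
      by (rule SUP_upper2[of "to_nat r"]) (auto simp: r)
    then show "z \<le> (SUP n. if real_of_rat (from_nat n) < x then ereal (of_rat (from_nat n)) else -\<infinity>)"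
      using z' r by (meson ereal_less_le less_imp_le order_trans less_ereal.simps(1) order.strict_trans1)
  qed
qed

text \<open>Interleaving the Dedekind cuts of both coordinates.\<close>

lemma borel_embedding_plane:
  obtains g :: "real \<times> real \<Rightarrow> real" and h :: "real \<Rightarrow> real \<times> real"
  where "g \<in> borel_measurable borel" "h \<in> borel_measurable borel" "\<And>p. h (g p) = p"
proof -
  define bit :: "real \<times> real \<Rightarrow> nat \<Rightarrow> bool" where
    "bit p n = (of_rat (from_nat (n div 2)) < (if even n then fst p else snd p))" for p n
  define g where "g p = code (bit p)" for p
  define dec where "dec i z = real_of_ereal (SUP n. if digit (2 * n + i) z
    then ereal (of_rat (from_nat n)) else -\<infinity>)" for i :: nat and z
  have [measurable]: "Measurable.pred borel (\<lambda>z. digit n z)" for n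
    unfolding digit_def by measurable
  have "(\<lambda>p. bit p n) \<in> borel \<rightarrow>\<^sub>M count_space UNIV" for n
    unfolding bit_def by (cases "even n") (simp_all add: borel_prod[symmetric])
  then have [measurable]: "Measurable.pred borel (\<lambda>p. bit p n)" for n by simp
  have "g \<in> borel_measurable borel" unfolding g_def[abs_def] code_def by measurable
  moreover have "(\<lambda>z. (dec 0 z, dec 1 z)) \<in> borel_measurable borel"
    unfolding dec_def by measurable
  moreover have "(dec 0 (g p), dec 1 (g p)) = p" for p
  proof -
    have b: "bit p (2 * n + 0) \<longleftrightarrow> of_rat (from_nat n) < fst p"
      "bit p (2 * n + 1) \<longleftrightarrow> of_rat (from_nat n) < snd p" for n
      by (simp_all add: bit_def)
    show ?thesis
      unfolding dec_def g_def digit_code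
      by (simp only: b ereal_SUP_rat_less real_of_ereal.simps prod.collapse)
  qed
  ultimately show ?thesis using that by blast
qed

text \<open>To the left of the quantile the distribution function is at most \<open>u\<close>, and
  without atoms it is continuous, so the bound survives at the quantile itself. With an atom there,
  it could jump over \<open>u\<close>.\<close>

lemma (in cdf_distribution) cdf_quantile:
  assumes "\<And>x. measure M {x} = 0" "0 < u" "u < 1"
  shows "cdf M (Inf {x. u \<le> cdf M x}) = u"
proof (rule antisym)
  let ?q = "Inf {x. u \<le> cdf M x}"
  show "u \<le> cdf M ?q" using pseudoinverse[OF assms(2,3), of ?q] by simp
  have "isCont (cdf M) ?q" using assms(1) isCont_cdf by blast
  then have "(cdf M \<longlongrightarrow> cdf M ?q) (at_left ?q)"
    by (simp add: isCont_def filterlim_at_split)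
  moreover have "\<forall>\<^sub>F y in at_left ?q. cdf M y \<le> u"
  proof (rule eventually_at_leftI[of "?q - 1"])
    fix y assume "y \<in> {?q - 1<..<?q}"
    then show "cdf M y \<le> u" using pseudoinverse[OF assms(2,3), of y] by auto
  qed simp
  ultimately show "cdf M ?q \<le> u" by (rule tendsto_upperbound) simp
qed

text \<open>The embedding \<open>g\<close> carries the uniform law on \<open>X\<close> to an
  atomless law \<open>\<nu>\<close> on the line. The distribution function of \<open>\<nu>\<close>
  carries that to the uniform law on the interval, and the quantile function followed by
  \<open>h\<close> leads back almost everywhere.\<close>

lemma mod0_iso_borel_uniform:
  fixes X :: "(real \<times> real) set"
  assumes X: "X \<in> sets borel" "emeasure lborel X \<noteq> 0" "emeasure lborel X \<noteq> \<infinity>"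
  obtains u v where "mod0_iso (borel_uniform X) unit_lborel u v"
proof -
  have Xs: "emeasure (restrict_space lborel X) X = emeasure lborel X"
    using X by (subst emeasure_restrict_space) auto
  interpret M: prob_space "borel_uniform X"
    unfolding borel_uniform_def by (rule prob_space_uniform_measure) (use X Xs in auto)
  have [simp]: "space (borel_uniform X) = X" by (simp add: borel_uniform_def space_restrict_space)
  have sM [measurable_cong]: "sets (borel_uniform X) = sets (restrict_space borel X)"
    by (simp add: borel_uniform_def sets_restrict_space)
  have sI: "A \<in> sets (borel_uniform X) \<longleftrightarrow> A \<subseteq> X \<and> A \<in> sets borel" for A
    unfolding sM using X(1) by (subst sets_restrict_space_iff) auto
  have "X \<noteq> {}" using X(2) by auto
  then obtain p0 where p0: "p0 \<in> X" by blast
  obtain g :: "real \<times> real \<Rightarrow> real" and h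
    where gh [measurable]: "g \<in> borel_measurable borel" "h \<in> borel_measurable borel" and hg: "\<And>p. h (g p) = p"
    using borel_embedding_plane by metis
  have gM [measurable]: "g \<in> borel_uniform X \<rightarrow>\<^sub>M borel"
    unfolding measurable_cong_sets[OF sM refl] by (rule measurable_restrict_space1) measurable
  define \<nu> where "\<nu> = distr (borel_uniform X) borel g"
  interpret nu: cdf_distribution \<nu>
    unfolding cdf_distribution_def real_distribution_def real_distribution_axioms_def \<nu>_def
    by (intro conjI M.prob_space_distr gM) simp_all
  \<comment> \<open>Since \<open>h\<close> is a left inverse of \<open>g\<close>, the fibre of
    \<open>g\<close> over \<open>z\<close> is contained in the null set
    \<open>{h z}\<close>.\<close>
  have sing: "measure \<nu> {z} = 0" for z
  proof -
    have "emeasure \<nu> {z} = emeasure (borel_uniform X) (g -` {z} \<inter> X)"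
      unfolding \<nu>_def by (subst emeasure_distr[OF gM]) simp_all
    also have "\<dots> \<le> emeasure (borel_uniform X) ({h z} \<inter> X)"
    proof (rule emeasure_mono)
      show "g -` {z} \<inter> X \<subseteq> {h z} \<inter> X"
      proof
        fix p assume "p \<in> g -` {z} \<inter> X"
        then show "p \<in> {h z} \<inter> X" using hg[of p] by simp
      qed
    qed (simp add: sI X(1) sets.Int)
    also have "\<dots> = emeasure (restrict_space lborel X) (X \<inter> ({h z} \<inter> X)) / emeasure (restrict_space lborel X) X"
      unfolding borel_uniform_def
      by (rule emeasure_uniform_measure) (simp_all add: sets_restrict_space_iff X(1) sets.Int)
    also have "emeasure (restrict_space lborel X) (X \<inter> ({h z} \<inter> X)) = 0"
    proof -
      have "emeasure (restrict_space lborel X) (X \<inter> ({h z} \<inter> X)) = emeasure lborel (X \<inter> ({h z} \<inter> X))"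
        by (rule emeasure_restrict_space) (simp_all add: X(1))
      also have "\<dots> \<le> emeasure lborel {h z}" by (rule emeasure_mono) auto
      finally show ?thesis by simp
    qed
    finally show ?thesis by (simp add: measure_def)
  qed
  let ?q = "\<lambda>u. Inf {x. u \<le> cdf \<nu> x}"
  \<comment> \<open>Quantiles are meaningful for \<open>0 < u < 1\<close>; the default 0 is taken on
    a null set only.\<close>
  define Q where "Q u = (if 0 < u \<and> u < 1 then ?q u else 0)" for u :: real
  have Qm [measurable]: "Q \<in> borel_measurable borel"
  proof -
    have "(\<lambda>u. if u \<in> {0<..<1} then ?q u else 0) \<in> borel_measurable borel"
      using nu.measurable_CI by (subst measurable_If_restrict_space_iff) (simp_all del: greaterThanLessThan_iff)
    then show ?thesis unfolding Q_def[abs_def] by simp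
  qed
  have FQ: "cdf \<nu> (Q u) = u" if "0 < u" "u < 1" for u
    using nu.cdf_quantile[OF sing that] that by (simp add: Q_def)
  have ae01: "AE u in unit_lborel. 0 < u \<and> u < 1"
    unfolding unit_lborel_def
    by (rule AE_uniform_measureI) (use AE_lborel_singleton[of "0::real"] in \<open>auto elim: eventually_mono\<close>)
  have distQ: "distr unit_lborel borel Q = \<nu>"
  proof (rule measure_eqI)
    fix A assume "A \<in> sets (distr unit_lborel borel Q)"
    then have A [measurable]: "A \<in> sets borel" by simp
    have "emeasure (distr unit_lborel borel Q) A = emeasure lborel ({0..<1} \<inter> (Q -` A))"
      using measurable_sets[OF Qm A] by (subst emeasure_distr) (auto simp: emeasure_unit_lborel)
    also have "\<dots> = emeasure lborel ({0<..<1} \<inter> (Q -` A))"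
      using measurable_sets[OF Qm A] AE_lborel_singleton[of "0::real"]
      by (intro emeasure_eq_AE) (auto elim!: eventually_mono)
    also have "{0<..<1} \<inter> (Q -` A) = {0<..<1} \<inter> ?q -` A" by (auto simp: Q_def)
    also have "emeasure lborel ({0<..<1} \<inter> ?q -` A)
        = emeasure (distr (restrict_space lborel {0<..<1::real}) borel ?q) A"
    proof -
      have m: "?q \<in> restrict_space lborel {0<..<1} \<rightarrow>\<^sub>M borel"
        using nu.measurable_CI by (simp cong: measurable_cong_sets add: sets_restrict_space cong: sets_restrict_space_cong)
      show ?thesis using measurable_sets[OF m A]
        by (subst emeasure_distr[OF m A], subst emeasure_restrict_space)
          (auto simp: space_restrict_space intro!: arg_cong[where f="emeasure lborel"])
    qed
    finally show "emeasure (distr unit_lborel borel Q) A = emeasure \<nu> A"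
      by (simp only: nu.distr_I_eq_M)
  qed (simp add: \<nu>_def)
  define f where "f p = cdf \<nu> (g p)" for p
  \<comment> \<open>The point \<open>p0\<close> is a default that keeps \<open>k\<close> inside
    \<open>X\<close> everywhere; almost surely it is not taken.\<close>
  define k where "k u = (if h (Q u) \<in> X then h (Q u) else p0)" for u
  have [measurable]: "cdf \<nu> \<in> borel_measurable borel" by (rule nu.measurable_C)
  have fm: "f \<in> borel_uniform X \<rightarrow>\<^sub>M unit_lborel"
    unfolding f_def[abs_def] by measurable
  have km: "k \<in> unit_lborel \<rightarrow>\<^sub>M borel_uniform X"
    unfolding measurable_cong_sets[OF refl sM]
  proof (rule measurable_restrict_space2)
    show "k \<in> space unit_lborel \<rightarrow> X" using p0 by (auto simp: k_def)
    show "k \<in> unit_lborel \<rightarrow>\<^sub>M borel" unfolding k_def[abs_def] using X(1) by measurable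
  qed
  have nuF: "distr \<nu> unit_lborel (cdf \<nu>) = unit_lborel"
  proof -
    have "distr (distr unit_lborel borel Q) unit_lborel (cdf \<nu>) = distr unit_lborel unit_lborel (cdf \<nu> \<circ> Q)"
      by (rule distr_distr) measurable
    then have "distr \<nu> unit_lborel (cdf \<nu>) = distr unit_lborel unit_lborel (cdf \<nu> \<circ> Q)"
      by (simp only: distQ)
    also have "\<dots> = distr unit_lborel unit_lborel (\<lambda>x. x)"
      by (rule distr_cong_AE) (use ae01 FQ in \<open>auto elim: eventually_mono\<close>)
    finally show ?thesis by (simp add: distr_id2)
  qed
  have d1: "distr (borel_uniform X) unit_lborel f = unit_lborel"
  proof -
    have "distr (borel_uniform X) unit_lborel f = distr \<nu> unit_lborel (cdf \<nu>)"
      unfolding \<nu>_def by (subst distr_distr) (auto simp: f_def[abs_def] o_def \<nu>_def[symmetric])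
    then show ?thesis using nuF by simp
  qed
  \<comment> \<open>The law \<open>g (h z) = z\<close> holds on the range of \<open>g\<close>, and
    \<open>\<nu>\<close> lives there.\<close>
  have gnu: "AE z in \<nu>. g (h z) = z \<and> h z \<in> X"
  proof -
    have "AE p in borel_uniform X. g (h (g p)) = g p \<and> h (g p) \<in> X"
      by (rule AE_I2) (simp add: hg)
    then show ?thesis unfolding \<nu>_def using X(1) by (subst AE_distr_iff) auto
  qed
  have gQ: "AE u in unit_lborel. g (h (Q u)) = Q u \<and> h (Q u) \<in> X"
  proof -
    have "Q \<in> unit_lborel \<rightarrow>\<^sub>M borel" by measurable
    from AE_distrD[OF this, unfolded distQ, OF gnu] show ?thesis .
  qed
  have a2: "AE u in unit_lborel. f (k u) = u"
    using gQ ae01 by eventually_elim (auto simp: f_def k_def FQ)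
  \<comment> \<open>The identity \<open>FQ\<close> is turned around: as \<open>\<nu>\<close> is the
    law of \<open>Q\<close>, a property of almost all \<open>Q u\<close> is one of
    \<open>\<nu>\<close>-almost all \<open>z\<close>.\<close>
  have "AE u in unit_lborel. Q (cdf \<nu> (Q u)) = Q u"
    using ae01 by eventually_elim (simp add: FQ)
  then have "AE z in distr unit_lborel borel Q. Q (cdf \<nu> z) = z"
    by (subst AE_distr_iff) measurable
  then have "AE z in \<nu>. Q (cdf \<nu> z) = z" by (simp only: distQ)
  then have "AE z in distr (borel_uniform X) borel g. Q (cdf \<nu> z) = z" by (simp only: \<nu>_def)
  then have "AE p in borel_uniform X. Q (cdf \<nu> (g p)) = g p"
    by (rule AE_distrD[OF gM])
  then have a1: "AE p in borel_uniform X. k (f p) = p"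
    using AE_space by eventually_elim (auto simp: f_def k_def hg)
  have d2: "distr unit_lborel (borel_uniform X) k = borel_uniform X"
  proof -
    have "distr unit_lborel (borel_uniform X) k
        = distr (distr (borel_uniform X) unit_lborel f) (borel_uniform X) k" by (simp add: d1)
    also have "\<dots> = distr (borel_uniform X) (borel_uniform X) (k \<circ> f)"
      by (rule distr_distr[OF km fm])
    also have "\<dots> = distr (borel_uniform X) (borel_uniform X) (\<lambda>x. x)"
      by (rule distr_cong_AE) (use a1 fm km in auto)
    finally show ?thesis by (simp add: distr_id2)
  qed
  show ?thesis using that[of f k] fm km d1 d2 a1 a2 by (simp add: mod0_iso_def)
qed

section \<open>Limits of eventually constant sequences of isomorphisms\<close>

lemma mod0_isoI:
  assumes f: "f \<in> M \<rightarrow>\<^sub>M N" and g: "g \<in> N \<rightarrow>\<^sub>M M" and d: "distr M N f = N"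
    and gf: "AE x in M. g (f x) = x" and fg: "AE y in N. f (g y) = y"
  shows "mod0_iso M N f g"
proof -
  have "distr N M g = distr (distr M N f) M g" by (simp add: d)
  also have "\<dots> = distr M M (g \<circ> f)" by (rule distr_distr[OF g f])
  also have "\<dots> = distr M M (\<lambda>x. x)" by (rule distr_cong_AE) (use gf f g in auto)
  finally show ?thesis using assms by (simp add: mod0_iso_def distr_id2)
qed

lemma eventually_stable_lim:
  fixes f :: "nat \<Rightarrow> real"
  assumes "eventually (\<lambda>n. f (Suc n) = f n) sequentially"
  shows "eventually (\<lambda>n. f n = lim f) sequentially"
proof -
  obtain K where K: "\<And>n. n \<ge> K \<Longrightarrow> f (Suc n) = f n"
    using assms by (auto simp: eventually_sequentially)
  have *: "f n = f K" if "n \<ge> K" for n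
    using that by (induction n rule: dec_induct) (auto simp: K)
  then have ev: "eventually (\<lambda>n. f n = f K) sequentially" unfolding eventually_sequentially by blast
  then have "lim f = f K" by (intro limI tendsto_eventually)
  then show ?thesis using ev by simp
qed

text \<open>By Borel-Cantelli almost every point sees only finitely many changes, so
  \<open>T k x\<close> is eventually constant, and likewise \<open>S k x\<close>. The limits inherit
  the inverse laws from any late stage, and the set where \<open>U\<close> differs from
  \<open>T k\<close> is covered, up to a null set, by the changes from stage \<open>k\<close>
  on.\<close>

lemma mod0_iso_limit:
  fixes M :: "real measure" and T S :: "nat \<Rightarrow> real \<Rightarrow> real"
  assumes "real_distribution M"
    and Tm: "\<And>k. T k \<in> borel_measurable borel" and Sm: "\<And>k. S k \<in> borel_measurable borel"
    and Td: "\<And>k. distr M M (T k) = M"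
    and ST: "\<And>k x. S k (T k x) = x" and TS: "\<And>k x. T k (S k x) = x"
    and sum: "summable (\<lambda>k. measure M {x. T (Suc k) x \<noteq> T k x})"
  obtains U V where "mod0_iso M M U V"
    "\<And>k. measure M {x. U x \<noteq> T k x} \<le> (\<Sum>j. measure M {x. T (Suc (j + k)) x \<noteq> T (j + k) x})"
proof -
  interpret M: real_distribution M by fact
  note [measurable] = Tm Sm
  define E where "E k = {x. T (Suc k) x \<noteq> T k x}" for k
  define F where "F k = {y. S (Suc k) y \<noteq> S k y}" for k
  have Em: "E k \<in> sets M" for k unfolding E_def by simp
  have Fm: "F k \<in> sets M" for k unfolding F_def by simp
  have T': "T k \<in> M \<rightarrow>\<^sub>M M" "S k \<in> M \<rightarrow>\<^sub>M M" for k by measurable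
  have iso: "mod0_iso M M (T k) (S k)" for k
    by (rule mod0_isoI[OF T' Td]) (simp_all add: ST TS)
  \<comment> \<open>If the inverses change at \<open>y\<close>, then the maps change at
    \<open>S k y\<close>, because \<open>T k (S k y) = y\<close> while
    \<open>T (Suc k) (S k y) \<noteq> y\<close>; and \<open>S k\<close> preserves the
    measure.\<close>
  have FE: "measure M (F k) \<le> measure M (E k)" for k
  proof -
    have "F k \<subseteq> S k -` E k"
    proof
      fix y assume "y \<in> F k"
      then have "S (Suc k) y \<noteq> S k y" by (simp add: F_def)
      then have "T (Suc k) (S k y) \<noteq> y" using ST[of "Suc k" "S k y"] by auto
      then show "y \<in> S k -` E k" by (simp add: E_def TS)
    qed
    then have "measure M (F k) \<le> measure M (S k -` E k \<inter> space M)"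
      using measurable_sets[OF T'(2) Em] by (intro M.finite_measure_mono) auto
    also have "\<dots> = measure (distr M M (S k)) (E k)"
      by (rule measure_distr[OF T'(2) Em, symmetric])
    finally show ?thesis using mod0_isoD(4)[OF iso] by simp
  qed
  have sE: "summable (\<lambda>k. measure M (E k))" using sum by (simp add: E_def)
  have sF: "summable (\<lambda>k. measure M (F k))"
    by (rule summable_comparison_test'[OF sE, of 0]) (use FE in auto)
  have fin: "emeasure M A < \<infinity>" for A by (simp add: M.emeasure_eq_measure)
  define U where "U x = lim (\<lambda>k. T k x)" for x
  define V where "V x = lim (\<lambda>k. S k x)" for x
  have Um: "U \<in> M \<rightarrow>\<^sub>M M" and Vm: "V \<in> M \<rightarrow>\<^sub>M M"
    unfolding U_def[abs_def] V_def[abs_def] by measurable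
  have aeU: "AE x in M. eventually (\<lambda>k. T k x = U x) sequentially"
    using borel_cantelli_AE1[OF Em fin sE]
    by eventually_elim (auto simp: E_def U_def elim!: eventually_mono intro!: eventually_stable_lim)
  have aeV: "AE x in M. eventually (\<lambda>k. S k x = V x) sequentially"
    using borel_cantelli_AE1[OF Fm fin sF]
    by eventually_elim (auto simp: F_def V_def elim!: eventually_mono intro!: eventually_stable_lim)
  have VU: "AE x in M. V (U x) = x"
    using aeU
  proof eventually_elim
    case (elim x)
    then have "eventually (\<lambda>k. S k (U x) = x) sequentially"
      by eventually_elim (metis ST)
    then show ?case unfolding V_def by (intro limI tendsto_eventually)
  qed
  have UV: "AE x in M. U (V x) = x"
    using aeV
  proof eventually_elim
    case (elim x)
    then have "eventually (\<lambda>k. T k (V x) = x) sequentially"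
      by eventually_elim (metis TS)
    then show ?case unfolding U_def by (intro limI tendsto_eventually)
  qed
  have [measurable]: "U \<in> borel_measurable borel" unfolding U_def[abs_def] by measurable
  have tail: "measure M {x. U x \<noteq> T k x} \<le> (\<Sum>j. measure M (E (j + k)))" for k
  proof -
    have "AE x in M. x \<in> {x. U x \<noteq> T k x} \<longrightarrow> x \<in> (\<Union>j. E (j + k))"
      using aeU
    proof eventually_elim
      case (elim x)
      show ?case
      proof (rule impI, rule ccontr)
        assume ne: "x \<in> {x. U x \<noteq> T k x}" and n: "x \<notin> (\<Union>j. E (j + k))"
        obtain K where K: "\<And>n. n \<ge> K \<Longrightarrow> T n x = U x" using elim by (auto simp: eventually_sequentially)
        have "T (n + k) x = T k x" for n
          using n by (induction n) (auto simp: E_def)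
        then have "U x = T k x" using K[of "K + k"] by simp
        then show False using ne by simp
      qed
    qed
    then have "measure M {x. U x \<noteq> T k x} \<le> measure M (\<Union>j. E (j + k))"
      using Em by (intro M.finite_measure_mono_AE) auto
    also have "\<dots> \<le> (\<Sum>j. measure M (E (j + k)))"
      using Em summable_ignore_initial_segment[OF sE, of k]
      by (intro M.finite_measure_subadditive_countably) auto
    finally show ?thesis .
  qed
  \<comment> \<open>Preimages under \<open>U\<close> and under the measure preserving
    \<open>T k\<close> differ at most by the tail of the series, which tends to 0 as
    \<open>k\<close> grows.\<close>
  have Ud: "distr M M U = M"
  proof (rule measure_eqI)
    fix A assume "A \<in> sets (distr M M U)"
    then have A [measurable]: "A \<in> sets borel" by simp
    let ?t = "\<lambda>k. \<Sum>j. measure M (E (j + k))"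
    have pre: "U -` A \<in> sets M" "T k -` A \<in> sets M" "{x. U x \<noteq> T k x} \<in> sets M" for k
      using measurable_sets[OF Um, of A] measurable_sets[OF T'(1), of A] by simp_all
    have mT: "measure M (T k -` A) = measure M A" for k
      using measure_distr[OF T'(1), of A k] unfolding Td by simp
    have "measure M (U -` A) \<le> measure M (T k -` A \<union> {x. U x \<noteq> T k x})" for k
      using pre by (intro M.finite_measure_mono) auto
    also have "measure M (T k -` A \<union> {x. U x \<noteq> T k x}) \<le> measure M A + ?t k" for k
      using measure_Un_le[OF pre(2)[of k] pre(3)[of k]] tail[of k] mT[of k] pre by simp
    finally have le: "measure M (U -` A) \<le> measure M A + ?t k" for k .
    have "measure M (T k -` A) \<le> measure M (U -` A \<union> {x. U x \<noteq> T k x})" for k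
      using pre by (intro M.finite_measure_mono) auto
    also have "measure M (U -` A \<union> {x. U x \<noteq> T k x}) \<le> measure M (U -` A) + ?t k" for k
      using measure_Un_le[OF pre(1) pre(3)[of k]] tail[of k] pre by simp
    finally have ge: "measure M A \<le> measure M (U -` A) + ?t k" for k by (simp add: mT)
    have "?t \<longlonglongrightarrow> 0" by (rule suminf_exist_split2[OF sE])
    then have lim: "(\<lambda>k. c + ?t k) \<longlonglongrightarrow> c" for c :: real
      using tendsto_add[OF tendsto_const] by force
    have "measure M (U -` A) = measure M A"
    proof (rule antisym)
      show "measure M (U -` A) \<le> measure M A"
        by (rule LIMSEQ_le_const[OF lim]) (use le in blast)
      show "measure M A \<le> measure M (U -` A)"
        by (rule LIMSEQ_le_const[OF lim]) (use ge in blast)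
    qed
    then show "emeasure (distr M M U) A = emeasure M A"
      using Um A by (simp add: emeasure_distr M.emeasure_eq_measure)
  qed simp
  have "mod0_iso M M U V" by (rule mod0_isoI[OF Um Vm Ud VU UV])
  moreover note tail[unfolded E_def]
  ultimately show ?thesis by (rule that)
qed

section \<open>Interval exchanges\<close>

text \<open>Taking \<open>frac\<close> repeats the cells periodically. An exchange given by a
  permutation of the cells is then a bijection of the whole line, the space of
  \<open>unit_lborel\<close>, and fixes integer parts.\<close>

definition cell :: "nat \<Rightarrow> real \<Rightarrow> nat" where
  "cell q x = nat \<lfloor>real q * frac x\<rfloor>"

definition exchange :: "nat \<Rightarrow> (nat \<Rightarrow> nat) \<Rightarrow> real \<Rightarrow> real" where
  "exchange q \<tau> x = x + (real (\<tau> (cell q x)) - real (cell q x)) / real q"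

lemma cell_less: "0 < q \<Longrightarrow> cell q x < q"
  using frac_lt_1[of x] frac_ge_0[of x]
  by (simp add: cell_def nat_less_iff floor_less_iff mult_less_cancel_left1)

lemma cell_eq_iff: "0 < q \<Longrightarrow> cell q x = i \<longleftrightarrow> real i / q \<le> frac x \<and> frac x < real (Suc i) / q"
  using frac_ge_0[of x]
  by (auto simp: cell_def nat_eq_iff floor_eq_iff field_simps)

lemma cell_refine:
  assumes "0 < m"
  shows "cell q x = cell (q * m) x div m"
proof -
  have "real q * frac x = (real (q * m) * frac x) / real_of_int (int m)" using assms by simp
  then have "\<lfloor>real q * frac x\<rfloor> = \<lfloor>real (q * m) * frac x\<rfloor> div int m"
    by (simp only: floor_divide_real_eq_div of_nat_0_le_iff)
  then show ?thesis by (simp add: cell_def nat_div_distrib')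
qed

lemma frac_exchange:
  assumes "0 < q" "\<And>i. i < q \<Longrightarrow> \<tau> i < q"
  shows "frac (exchange q \<tau> x) = frac x + (real (\<tau> (cell q x)) - real (cell q x)) / real q"
proof -
  let ?i = "cell q x"
  have i: "real ?i / q \<le> frac x" "frac x < real (Suc ?i) / q"
    using cell_eq_iff[OF assms(1), of x ?i] by auto
  have t: "real (Suc (\<tau> ?i)) \<le> real q"
    using assms(2)[OF cell_less[OF assms(1)], of x] by (simp only: of_nat_le_iff)
  have "frac x + (real (\<tau> ?i) - real ?i) / q < real (Suc (\<tau> ?i)) / q"
    using i(2) by (simp add: diff_divide_distrib add_divide_distrib)
  also have "\<dots> \<le> 1" using t assms(1) by simp
  finally have "frac x + (real (\<tau> ?i) - real ?i) / q < 1" .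
  moreover have "0 \<le> real (\<tau> ?i) / q" by simp
  then have "0 \<le> frac x + (real (\<tau> ?i) - real ?i) / q"
    using i(1) unfolding diff_divide_distrib by linarith
  ultimately show ?thesis
    by (subst frac_unique_iff) (simp add: exchange_def frac_def)
qed

lemma cell_exchange:
  assumes "0 < q" "\<And>i. i < q \<Longrightarrow> \<tau> i < q"
  shows "cell q (exchange q \<tau> x) = \<tau> (cell q x)"
proof -
  have "real (cell q x) / q \<le> frac x" "frac x < real (Suc (cell q x)) / q"
    using cell_eq_iff[OF assms(1), of x "cell q x"] by auto
  moreover have "frac (exchange q \<tau> x) = frac x + (real (\<tau> (cell q x)) - real (cell q x)) / real q"
    by (rule frac_exchange[OF assms])
  ultimately show ?thesis
    unfolding cell_eq_iff[OF assms(1)] by (simp add: diff_divide_distrib add_divide_distrib)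
qed

lemma exchange_inverse:
  assumes "0 < q" "\<And>i. i < q \<Longrightarrow> \<tau> i < q" "\<And>i. i < q \<Longrightarrow> \<sigma> (\<tau> i) = i"
  shows "exchange q \<sigma> (exchange q \<tau> x) = x"
proof -
  have "exchange q \<sigma> (exchange q \<tau> x) = exchange q \<tau> x
      + (real (\<sigma> (\<tau> (cell q x))) - real (\<tau> (cell q x))) / q"
    by (simp only: exchange_def[of q \<sigma>] cell_exchange[OF assms(1,2)])
  also have "\<dots> = x" using assms(3)[OF cell_less[OF assms(1)], of x]
    by (simp add: exchange_def diff_divide_distrib)
  finally show ?thesis .
qed

lemma measurable_cell [measurable]: "cell q \<in> borel \<rightarrow>\<^sub>M count_space UNIV"
  unfolding cell_def[abs_def] frac_def by measurable

lemma measurable_exchange [measurable]: "exchange q \<tau> \<in> borel_measurable borel"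
  unfolding exchange_def[abs_def] by measurable

lemma cell_on_interval:
  assumes "0 < q" "i < q"
  shows "{0..<1} \<inter> {x. cell q x = i} = {real i / q..<real (Suc i) / q}"
proof -
  have 1: "real (Suc i) / q \<le> 1" and 0: "0 \<le> real i / q" using assms by simp_all
  have frac: "frac x = x" if "0 \<le> x" "x < 1" for x :: real
    using that by (simp add: frac_eq)
  show ?thesis
  proof (intro set_eqI iffI)
    fix x assume "x \<in> {0..<1} \<inter> {x. cell q x = i}"
    then show "x \<in> {real i / q..<real (Suc i) / q}"
      using frac[of x] by (auto simp add: cell_eq_iff[OF assms(1)] simp del: of_nat_Suc)
  next
    fix x assume "x \<in> {real i / q..<real (Suc i) / q}"
    then have "real i / q \<le> x" "x < real (Suc i) / q" by auto
    moreover from this have "0 \<le> x" "x < 1" using 0 1 by linarith+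
    ultimately show "x \<in> {0..<1} \<inter> {x. cell q x = i}"
      using frac[of x] by (auto simp add: cell_eq_iff[OF assms(1)] simp del: of_nat_Suc)
  qed
qed

lemma emeasure_unit_cells:
  assumes "0 < q" "B \<in> sets borel"
  shows "emeasure unit_lborel B = (\<Sum>i<q. emeasure lborel ({real i / q..<real (Suc i) / q} \<inter> B))"
proof -
  have m: "{real i / q..<real (Suc i) / q} \<inter> B = {0..<1} \<inter> {x. cell q x = i} \<inter> B" if "i < q" for i
    using cell_on_interval[OF assms(1) that] by simp
  have "{0..<1} \<inter> B = (\<Union>i<q. {0..<1} \<inter> {x. cell q x = i} \<inter> B)"
    using cell_less[OF assms(1)] by auto
  then have "emeasure unit_lborel B = emeasure lborel (\<Union>i<q. {0..<1} \<inter> {x. cell q x = i} \<inter> B)"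
    using assms by (simp add: emeasure_unit_lborel)
  also have "\<dots> = (\<Sum>i<q. emeasure lborel ({0..<1} \<inter> {x. cell q x = i} \<inter> B))"
    using assms(2) by (intro sum_emeasure[symmetric]) (auto simp: disjoint_family_on_def)
  also have "\<dots> = (\<Sum>i<q. emeasure lborel ({real i / q..<real (Suc i) / q} \<inter> B))"
    by (intro sum.cong refl) (simp only: lessThan_iff m)
  finally show ?thesis .
qed

lemma distr_exchange:
  assumes "0 < q" "bij_betw \<tau> {..<q} {..<q}"
  shows "distr unit_lborel unit_lborel (exchange q \<tau>) = unit_lborel"
proof (rule measure_eqI)
  let ?C = "\<lambda>i. {real i / q..<real (Suc i) / q}"
  fix A assume "A \<in> sets (distr unit_lborel unit_lborel (exchange q \<tau>))"
  then have A [measurable]: "A \<in> sets borel" by simp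
  have m: "exchange q \<tau> \<in> unit_lborel \<rightarrow>\<^sub>M unit_lborel" by measurable
  have pre: "exchange q \<tau> -` A \<in> sets borel"
    using measurable_sets[OF m, of A] by simp
  have "emeasure (distr unit_lborel unit_lborel (exchange q \<tau>)) A
      = (\<Sum>i<q. emeasure lborel (?C i \<inter> exchange q \<tau> -` A))"
    using emeasure_unit_cells[OF assms(1) pre] by (simp add: emeasure_distr[OF m])
  also have "\<dots> = (\<Sum>i<q. emeasure lborel (?C (\<tau> i) \<inter> A))"
  proof (rule sum.cong)
    fix i assume "i \<in> {..<q}"
    then have i: "i < q" by simp
    let ?c = "(real (\<tau> i) - real i) / q"
    have "?C i \<inter> exchange q \<tau> -` A = (+) ?c -` (?C (\<tau> i) \<inter> A)"
    proof -
      have c: "cell q x = i" if "x \<in> ?C i" for x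
        using that cell_on_interval[OF assms(1) i] by (auto simp del: atLeastLessThan_iff of_nat_Suc)
      have e: "exchange q \<tau> x = ?c + x" if "x \<in> ?C i" for x
        unfolding exchange_def c[OF that] by simp
      have "?C i = (+) ?c -` ?C (\<tau> i)"
        by (auto simp: diff_divide_distrib add_divide_distrib)
      moreover have "?C i \<inter> exchange q \<tau> -` A = ?C i \<inter> (+) ?c -` A"
        using e by (auto simp del: atLeastLessThan_iff of_nat_Suc)
      ultimately show ?thesis by blast
    qed
    also have "emeasure lborel \<dots> = emeasure (distr lborel borel ((+) ?c)) (?C (\<tau> i) \<inter> A)"
      by (subst emeasure_distr) auto
    finally show "emeasure lborel (?C i \<inter> exchange q \<tau> -` A) = emeasure lborel (?C (\<tau> i) \<inter> A)"
      by (simp only: lborel_distr_plus)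
  qed simp
  also have "\<dots> = (\<Sum>i<q. emeasure lborel (?C i \<inter> A))"
    by (rule sum.reindex_bij_betw[OF assms(2)])
  also have "\<dots> = emeasure unit_lborel A"
    by (rule emeasure_unit_cells[OF assms(1) A, symmetric])
  finally show "emeasure (distr unit_lborel unit_lborel (exchange q \<tau>)) A = emeasure unit_lborel A" .
qed simp

lemma measure_cell:
  assumes "0 < q"
  shows "measure unit_lborel {x. R (cell q x)} = card {i. i < q \<and> R i} / q"
proof -
  let ?C = "\<lambda>i. {real i / q..<real (Suc i) / q}"
  have "emeasure unit_lborel {x. R (cell q x)} = (\<Sum>i<q. emeasure lborel (?C i \<inter> {x. R (cell q x)}))"
    by (rule emeasure_unit_cells[OF assms]) measurable
  also have "\<dots> = (\<Sum>i<q. ennreal (of_bool (R i) / q))"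
  proof (rule sum.cong)
    fix i assume i: "i \<in> {..<q}"
    then have c: "cell q x = i" if "x \<in> ?C i" for x
      using that cell_on_interval[OF assms, of i] by (auto simp del: atLeastLessThan_iff of_nat_Suc)
    have eq: "?C i \<inter> {x. R (cell q x)} = (if R i then ?C i else {})"
      using c by (auto simp del: atLeastLessThan_iff of_nat_Suc)
    have "real i / q \<le> real (Suc i) / q" by (simp add: divide_right_mono)
    then have "emeasure lborel (?C i) = ennreal (real (Suc i) / q - real i / q)" by simp
    also have "real (Suc i) / q - real i / q = 1 / q" by (simp add: add_divide_distrib)
    finally have "emeasure lborel (?C i) = ennreal (1 / q)" .
    then show "emeasure lborel (?C i \<inter> {x. R (cell q x)}) = ennreal (of_bool (R i) / q)"
      unfolding eq by (cases "R i") (simp_all del: emeasure_lborel_Ico)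
  qed simp
  also have "\<dots> = ennreal (\<Sum>i<q. of_bool (R i) / q)" by (rule sum_ennreal) simp
  also have "(\<Sum>i<q. of_bool (R i) / q) = card {i. i < q \<and> R i} / real q"
    by (simp flip: sum_divide_distrib add: Int_def)
  finally show ?thesis by (simp add: measure_def)
qed

text \<open>Regularity encloses \<open>A\<close> between a closed \<open>T\<close> and an open
  \<open>O'\<close> of nearly equal measure. By compactness every sufficiently short cell that meets
  \<open>T\<close> inside \<open>[0,1)\<close> stays inside \<open>O'\<close> there, so the union of
  these cells differs little from \<open>A\<close>.\<close>

lemma borel_approx_by_cells:
  fixes q :: "nat \<Rightarrow> nat"
  assumes q: "filterlim q at_top sequentially" "\<And>k. 0 < q k" and A: "A \<in> sets borel"
  obtains \<beta> where "\<And>k. \<beta> k \<subseteq> {..<q k}"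
    "(\<lambda>k. measure unit_lborel (sym_diff A {x. cell (q k) x \<in> \<beta> k})) \<longlonglongrightarrow> 0"
proof -
  define m where "m k \<gamma> = measure unit_lborel (sym_diff A {x. cell (q k) x \<in> \<gamma>})" for k \<gamma>
  \<comment> \<open>Taking the best union of cells at every \<open>k\<close> gives one sequence that
    serves all tolerances \<open>e\<close> at once; it then suffices to exhibit some good union for
    each \<open>e\<close> and all large \<open>k\<close>.\<close>
  have "\<exists>\<gamma>\<in>Pow {..<q k}. \<forall>\<gamma>'\<in>Pow {..<q k}. m k \<gamma> \<le> m k \<gamma>'" for k
    using ex_min_if_finite[of "m k ` Pow {..<q k}"] by (force simp: not_less)
  then obtain \<beta> where \<beta>: "\<And>k. \<beta> k \<subseteq> {..<q k}" "\<And>k \<gamma>. \<gamma> \<subseteq> {..<q k} \<Longrightarrow> m k (\<beta> k) \<le> m k \<gamma>"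
    unfolding Bex_def Ball_def Pow_iff by metis
  have "(\<lambda>k. m k (\<beta> k)) \<longlonglongrightarrow> 0"
  proof (rule tendstoI)
    fix e :: real assume e: "e > 0"
    obtain O' where O: "open O'" "A \<subseteq> O'" "O' - A \<in> lmeasurable" "emeasure lebesgue (O' - A) < ennreal (e/2)"
      using sets_lebesgue_outer_open[of A "e/2"] A e by auto
    obtain T where T: "closed T" "T \<subseteq> A" "A - T \<in> lmeasurable" "emeasure lebesgue (A - T) < ennreal (e/2)"
      using sets_lebesgue_inner_closed[of A "e/2"] A e by auto
    have O_borel: "O' \<in> sets borel" "T \<in> sets borel" using O T by auto
    have "compact (T \<inter> {0..1})" using T by (intro closed_Int_compact) auto
    then obtain d where d: "d > 0" "(\<Union>x\<in>T \<inter> {0..1}. ball x d) \<subseteq> O'"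
      using compact_subset_open_imp_ball_epsilon_subset[of "T \<inter> {0..1}" O'] O T by blast
    have "eventually (\<lambda>k. q k \<ge> nat \<lceil>1/d\<rceil> + 1) sequentially"
      using q(1) by (simp add: filterlim_at_top)
    then show "eventually (\<lambda>k. dist (m k (\<beta> k)) 0 < e) sequentially"
    proof eventually_elim
      case (elim k)
      have qd: "1 / real (q k) < d"
      proof -
        have "1/d < real (q k)" using elim by linarith
        then show ?thesis using d(1) q(2)[of k] by (simp add: field_simps)
      qed
      define \<gamma> where "\<gamma> = cell (q k) ` (T \<inter> {0..<1})"
      let ?D = "{x. cell (q k) x \<in> \<gamma>}"
      have \<gamma>: "\<gamma> \<subseteq> {..<q k}" using cell_less[OF q(2)] by (auto simp: \<gamma>_def)
      have Db: "?D \<in> sets borel" by measurable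
      have "{0..<1} \<inter> ?D \<subseteq> O'"
      proof
        fix x assume "x \<in> {0..<1} \<inter> ?D"
        then obtain y where x: "x \<in> {0..<1}" and y: "y \<in> T" "y \<in> {0..<1}" "cell (q k) x = cell (q k) y"
          by (auto simp: \<gamma>_def)
        define i where "i = cell (q k) y"
        have "i < q k" using cell_less[OF q(2)] by (simp add: i_def)
        from cell_on_interval[OF q(2) this]
        have "x \<in> {real i / q k..<real (Suc i) / q k}" "y \<in> {real i / q k..<real (Suc i) / q k}"
          using x y by (auto simp: i_def simp del: atLeastLessThan_iff)
        then have "\<bar>x - y\<bar> < 1 / q k" by (auto simp: add_divide_distrib)
        then have "x \<in> ball y d" using qd by (simp add: dist_real_def)
        moreover have "y \<in> T \<inter> {0..1}" using y by simp
        ultimately show "x \<in> O'" using d(2) by blast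
      qed
      then have sub: "{0..<1} \<inter> sym_diff A ?D \<subseteq> (A - T) \<union> (O' - A)"
        by (auto simp: \<gamma>_def)
      have "emeasure unit_lborel (sym_diff A ?D) \<le> emeasure lborel ((A - T) \<union> (O' - A))"
        using sub A Db O_borel by (subst emeasure_unit_lborel) (auto intro!: emeasure_mono)
      also have "\<dots> \<le> emeasure lborel (A - T) + emeasure lborel (O' - A)"
        using A O_borel by (intro emeasure_subadditive) auto
      also have "\<dots> < ennreal (e/2) + ennreal (e/2)"
        using O(4) T(4) A O_borel by (intro add_strict_mono) auto
      also have "\<dots> = ennreal e" using e by (simp flip: ennreal_plus)
      finally have "m k \<gamma> < e"
        unfolding m_def unit_lborel.emeasure_eq_measure using e by (simp add: ennreal_less_iff)
      then have "m k (\<beta> k) < e" using \<beta>(2)[OF \<gamma>] by simp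
      then show ?case by (simp add: m_def)
    qed
  qed
  then show ?thesis using that[of \<beta>] \<beta>(1) by (simp add: m_def)
qed

section \<open>Towers of cyclic permutations\<close>

text \<open>Cutting and stacking without spacers, where each copy of the old tower may be rotated
  before it is stacked. The condition \<open>2 \<le> M k\<close> makes heights grow at least
  geometrically, so that the changes between stages are summable.\<close>

locale tower =
  fixes q M :: "nat \<Rightarrow> nat" and \<psi> :: "nat \<Rightarrow> nat \<Rightarrow> nat"
  assumes q_0: "0 < q 0" and q_Suc: "\<And>k. q (Suc k) = q k * M k"
    and M_ge_2: "\<And>k. 2 \<le> M k" and shift_less: "\<And>k j. \<psi> k j < q k"
begin

text \<open>The \<open>i\<close>-th of \<open>q k\<close> equal cells of \<open>[0,1)\<close> is the level \<open>pos k i\<close> of the \<open>k\<close>-th tower, and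
  \<open>lev k\<close> is the inverse of \<open>pos k\<close>. Level \<open>m * q k + s\<close> of the next tower is the \<open>m\<close>-th subcell of level
  \<open>s + \<psi> k m\<close>, taken modulo \<open>q k\<close>: its \<open>m\<close>-th pass through the old tower starts at level \<open>\<psi> k m\<close>.\<close>

definition down :: "nat \<Rightarrow> nat \<Rightarrow> nat" where
  "down k p = (p mod q k + \<psi> k (p div q k)) mod q k"

primrec pos :: "nat \<Rightarrow> nat \<Rightarrow> nat" where
  "pos 0 i = i"
| "pos (Suc k) i = (i mod M k) * q k + (pos k (i div M k) + (q k - \<psi> k (i mod M k))) mod q k"

primrec lev :: "nat \<Rightarrow> nat \<Rightarrow> nat" where
  "lev 0 p = p"
| "lev (Suc k) p = lev k (down k p) * M k + p div q k"

lemma q_pos [simp]: "0 < q k"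
proof (induction k)
  case (Suc k) then show ?case using M_ge_2[of k] by (simp add: q_Suc)
qed (rule q_0)

lemma M_pos [simp]: "0 < M k" using M_ge_2[of k] by simp

lemma q_growth: "2 ^ j * q k \<le> q (j + k)"
proof (induction j)
  case (Suc j)
  have "2 ^ Suc j * q k \<le> 2 * q (j + k)" using Suc by simp
  also have "\<dots> \<le> q (Suc j + k)" using mult_le_mono1[OF M_ge_2[of "j + k"], of "q (j + k)"]
    by (simp add: q_Suc mult.commute)
  finally show ?case .
qed simp

lemma filterlim_q: "filterlim q at_top sequentially"
proof (rule filterlim_at_top_mono[OF filterlim_ident])
  have "k \<le> q k" for k
  proof -
    have "k < 2 ^ k" by simp
    also have "2 ^ k \<le> 2 ^ k * q 0" using q_0 by (simp add: Suc_le_eq)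
    also have "\<dots> \<le> q k" using q_growth[of k 0] by simp
    finally show ?thesis by simp
  qed
  then show "\<forall>\<^sub>F k in sequentially. k \<le> q k" by simp
qed

lemma down_less: "down k p < q k" by (simp add: down_def)

text \<open>Subtracting the shift modulo \<open>q k\<close> is written as adding
  \<open>q k - \<psi> k m\<close>, which avoids truncated subtraction; this checks that the two
  rotations cancel.\<close>

lemma shift_back:
  assumes "s < q k"
  shows "(((s + \<psi> k m) mod q k) + (q k - \<psi> k m)) mod q k = s"
    and "((s + (q k - \<psi> k m)) mod q k + \<psi> k m) mod q k = s"
proof -
  have "(((s + \<psi> k m) mod q k) + (q k - \<psi> k m)) mod q k = (s + \<psi> k m + (q k - \<psi> k m)) mod q k"
    by (simp add: mod_add_left_eq)
  also have "s + \<psi> k m + (q k - \<psi> k m) = s + q k" using shift_less[of k m] by simp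
  finally show "(((s + \<psi> k m) mod q k) + (q k - \<psi> k m)) mod q k = s" using assms by simp
  have "((s + (q k - \<psi> k m)) mod q k + \<psi> k m) mod q k = (s + (q k - \<psi> k m) + \<psi> k m) mod q k"
    by (simp add: mod_add_left_eq)
  also have "s + (q k - \<psi> k m) + \<psi> k m = s + q k" using shift_less[of k m] by simp
  finally show "((s + (q k - \<psi> k m)) mod q k + \<psi> k m) mod q k = s" using assms by simp
qed

lemma pos_Suc_div_mod:
  shows "pos (Suc k) i div q k = i mod M k"
    and "pos (Suc k) i mod q k = (pos k (i div M k) + (q k - \<psi> k (i mod M k))) mod q k"
  by simp_all

lemma digits_less: "a < m \<Longrightarrow> b < n \<Longrightarrow> a * n + b < n * (m::nat)"
proof -
  assume "a < m" "b < n"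
  then have "a * n + b < Suc a * n" by simp
  also have "\<dots> \<le> m * n" using \<open>a < m\<close> by (intro mult_le_mono1) simp
  finally show ?thesis by (simp add: mult.commute)
qed

lemma pos_less: "i < q k \<Longrightarrow> pos k i < q k"
  by (cases k) (auto simp: q_Suc intro!: digits_less)

lemma lev_less: "p < q k \<Longrightarrow> lev k p < q k"
proof (induction k arbitrary: p)
  case (Suc k)
  then have "p div q k < M k" by (simp add: q_Suc less_mult_imp_div_less mult.commute)
  then show ?case using digits_less[OF Suc.IH[OF down_less[of k p]]] by (simp add: q_Suc mult.commute)
qed simp

lemma div_M_less: "i < q (Suc k) \<Longrightarrow> i div M k < q k"
  by (simp add: q_Suc less_mult_imp_div_less)

lemma down_pos:
  assumes "i < q (Suc k)"
  shows "down k (pos (Suc k) i) = pos k (i div M k)"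
  unfolding down_def pos_Suc_div_mod by (rule shift_back(2)[OF pos_less[OF div_M_less[OF assms]]])

lemma lev_pos: "i < q k \<Longrightarrow> lev k (pos k i) = i"
proof (induction k arbitrary: i)
  case (Suc k)
  show ?case
    unfolding lev.simps down_pos[OF Suc.prems] pos_Suc_div_mod Suc.IH[OF div_M_less[OF Suc.prems]]
    by simp
qed simp

lemma bij_pos: "bij_betw (pos k) {..<q k} {..<q k}"
proof -
  have "inj_on (pos k) {..<q k}" by (rule inj_on_inverseI[where g = "lev k"]) (simp add: lev_pos)
  moreover have "pos k ` {..<q k} \<subseteq> {..<q k}" using pos_less by auto
  ultimately show ?thesis by (simp add: bij_betw_def endo_inj_surj)
qed

lemma pos_lev:
  assumes "p < q k" shows "pos k (lev k p) = p"
proof -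
  obtain i where "i < q k" "p = pos k i" using assms bij_pos[of k] by (auto simp: bij_betw_def)
  then show ?thesis by (simp add: lev_pos)
qed

section \<open>The cyclic maps of the stages and the difference between consecutive ones\<close>

definition step :: "nat \<Rightarrow> nat \<Rightarrow> nat" where
  "step k i = lev k ((pos k i + 1) mod q k)"

definition unstep :: "nat \<Rightarrow> nat \<Rightarrow> nat" where
  "unstep k i = lev k ((pos k i + (q k - 1)) mod q k)"

lemma step_less: "step k i < q k" and unstep_less: "unstep k i < q k"
  by (simp_all add: step_def unstep_def lev_less)

lemma pos_step: "pos k (step k i) = (pos k i + 1) mod q k"
  by (simp add: step_def pos_lev)

lemma cyclic_pred_succ:
  fixes p n :: nat
  assumes "p < n"
  shows "((p + 1) mod n + (n - 1)) mod n = p" "((p + (n - 1)) mod n + 1) mod n = p"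
proof -
  have "((p + 1) mod n + (n - 1)) mod n = ((p + 1) + (n - 1)) mod n"
    "((p + (n - 1)) mod n + 1) mod n = (p + (n - 1) + 1) mod n"
    by (simp_all only: mod_add_left_eq)
  moreover have "(p + 1) + (n - 1) = p + n" "p + (n - 1) + 1 = p + n" using assms by simp_all
  ultimately show "((p + 1) mod n + (n - 1)) mod n = p" "((p + (n - 1)) mod n + 1) mod n = p"
    using assms by simp_all
qed

lemma unstep_step: "i < q k \<Longrightarrow> unstep k (step k i) = i"
  by (simp only: unstep_def pos_step cyclic_pred_succ pos_less lev_pos)

lemma step_unstep: "i < q k \<Longrightarrow> step k (unstep k i) = i"
  by (simp only: unstep_def step_def pos_lev mod_less_divisor q_pos cyclic_pred_succ pos_less lev_pos)

lemma bij_step: "bij_betw (step k) {..<q k} {..<q k}"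
  by (rule bij_betw_byWitness[where f' = "unstep k"]) (auto simp: unstep_step step_unstep step_less unstep_less)

definition position :: "nat \<Rightarrow> real \<Rightarrow> nat" where
  "position k x = pos k (cell (q k) x)"

abbreviation map_stage :: "nat \<Rightarrow> real \<Rightarrow> real" where
  "map_stage k \<equiv> exchange (q k) (step k)"

lemma position_less: "position k x < q k"
  by (simp add: position_def pos_less cell_less)

lemma measurable_position [measurable]: "position k \<in> borel \<rightarrow>\<^sub>M count_space UNIV"
  unfolding position_def[abs_def] by measurable

lemma position_map_stage: "position k (map_stage k x) = (position k x + 1) mod q k"
  unfolding position_def by (subst cell_exchange) (auto simp: step_less pos_step)

lemma position_down: "position k x = down k (position (Suc k) x)"
  unfolding position_def
  by (subst down_pos) (simp_all add: cell_less flip: cell_refine q_Suc, simp add: q_Suc flip: cell_refine)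

lemma measure_position: "measure unit_lborel {x. R (position k x)} = card {p. p < q k \<and> R p} / q k"
proof -
  have "card {i. i < q k \<and> R (pos k i)} = card {p. p < q k \<and> R p}"
  proof (rule bij_betw_same_card)
    show "bij_betw (pos k) {i. i < q k \<and> R (pos k i)} {p. p < q k \<and> R p}"
      by (rule bij_betw_byWitness[where f' = "lev k"]) (auto simp: lev_pos pos_lev pos_less lev_less)
  qed
  then show ?thesis unfolding position_def by (subst measure_cell) simp_all
qed

text \<open>Below the last level of a pass, climbing one level stays within that pass: the subcell
  number is kept and the enclosing cell moves as in the old tower.\<close>

lemma step_refine:
  assumes i: "i < q (Suc k)" and ne: "pos (Suc k) i mod q k \<noteq> q k - 1"
  shows "step (Suc k) i = step k (i div M k) * M k + i mod M k"
proof -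
  define p where "p = pos (Suc k) i"
  have p: "p < q (Suc k)" using pos_less[OF i] by (simp add: p_def)
  have s: "p mod q k + 1 < q k" using ne mod_less_divisor[OF q_pos[of k], of p] unfolding p_def by linarith
  have dm: "p + 1 = p div q k * q k + (p mod q k + 1)" by simp
  have div: "(p + 1) div q k = p div q k" and mod: "(p + 1) mod q k = p mod q k + 1"
  proof -
    have "(m * q k + t) div q k = m \<and> (m * q k + t) mod q k = t" if "t < q k" for m t
      using that by simp
    from this[OF s, of "p div q k"] show "(p + 1) div q k = p div q k" "(p + 1) mod q k = p mod q k + 1"
      unfolding dm[symmetric] by simp_all
  qed
  have "p + 1 < q (Suc k)"
  proof -
    have "p div q k < M k" using p by (simp add: q_Suc less_mult_imp_div_less mult.commute)
    then show ?thesis using digits_less[OF _ s, of "p div q k" "M k"] by (simp add: q_Suc flip: dm)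
  qed
  then have "step (Suc k) i = lev (Suc k) (p + 1)" by (simp add: step_def p_def)
  also have "\<dots> = lev k (down k (p + 1)) * M k + i mod M k"
    by (simp only: lev.simps div) (simp add: p_def)
  also have "down k (p + 1) = (down k p + 1) mod q k"
    unfolding down_def div mod by (simp add: mod_Suc_eq)
  also have "down k p = pos k (i div M k)" unfolding p_def by (rule down_pos[OF i])
  finally show ?thesis by (simp add: step_def)
qed

text \<open>By \<open>step_refine\<close> a subcell is translated by the same vector as the cell
  that contains it, so both exchanges agree there.\<close>

lemma map_stage_Suc_eq:
  assumes "position (Suc k) x mod q k \<noteq> q k - 1"
  shows "map_stage (Suc k) x = map_stage k x"
proof -
  define i where "i = cell (q (Suc k)) x"
  have c: "cell (q k) x = i div M k" using cell_refine[of "M k" "q k" x] by (simp add: i_def q_Suc)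
  have st: "step (Suc k) i = step k (i div M k) * M k + i mod M k"
    using assms by (intro step_refine) (simp_all add: position_def i_def cell_less)
  have "real (step (Suc k) i) - real i
      = (real (step k (i div M k)) - real (i div M k)) * real (M k)"
  proof -
    have "real i = real (i div M k) * real (M k) + real (i mod M k)"
      by (simp flip: of_nat_mult of_nat_add)
    then show ?thesis unfolding st by (simp add: algebra_simps)
  qed
  then have "(real (step (Suc k) i) - real i) / q (Suc k)
      = (real (step k (i div M k)) - real (i div M k)) / q k"
    using M_pos[of k] by (simp add: q_Suc)
  then show ?thesis by (simp add: exchange_def c flip: i_def)
qed

lemma card_top_positions: "card {p. p < q (Suc k) \<and> p mod q k = q k - 1} = M k"
proof -
  have "bij_betw (\<lambda>m. m * q k + (q k - 1)) {..<M k} {p. p < q (Suc k) \<and> p mod q k = q k - 1}"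
  proof (rule bij_betw_byWitness[where f' = "\<lambda>p. p div q k"])
    show "\<forall>p\<in>{p. p < q (Suc k) \<and> p mod q k = q k - 1}. p div q k * q k + (q k - 1) = p"
      by (auto simp flip: div_mult_mod_eq) (metis div_mult_mod_eq)
    show "(\<lambda>m. m * q k + (q k - 1)) ` {..<M k} \<subseteq> {p. p < q (Suc k) \<and> p mod q k = q k - 1}"
      using digits_less[of _ "M k" "q k - 1" "q k"] by (auto simp: q_Suc)
    show "(\<lambda>p. p div q k) ` {p. p < q (Suc k) \<and> p mod q k = q k - 1} \<subseteq> {..<M k}"
      by (auto simp: q_Suc less_mult_imp_div_less mult.commute)
  qed simp
  then show ?thesis by (auto dest: bij_betw_same_card)
qed

lemma measure_map_stage_change: "measure unit_lborel {x. map_stage (Suc k) x \<noteq> map_stage k x} \<le> 1 / q k"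
proof -
  have "measure unit_lborel {x. map_stage (Suc k) x \<noteq> map_stage k x}
      \<le> measure unit_lborel {x. position (Suc k) x mod q k = q k - 1}"
    using map_stage_Suc_eq by (intro unit_lborel.finite_measure_mono) auto
  also have "\<dots> = M k / q (Suc k)"
    by (subst measure_position[where R = "\<lambda>p. p mod q k = q k - 1"]) (simp only: card_top_positions)
  also have "\<dots> = 1 / q k" by (simp add: q_Suc)
  finally show ?thesis .
qed

lemma suminf_inverse_q: "summable (\<lambda>j. 1 / real (q (j + k)))" "(\<Sum>j. 1 / real (q (j + k))) \<le> 2 / q k"
proof -
  have le: "1 / real (q (j + k)) \<le> (1 / q k) * (1 / 2) ^ j" for j
  proof -
    have "real (2 ^ j * q k) \<le> real (q (j + k))" using q_growth[of j k] by (simp only: of_nat_le_iff)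
    then have "1 / real (q (j + k)) \<le> 1 / real (2 ^ j * q k)" by (intro divide_left_mono) simp_all
    then show ?thesis by (simp add: power_divide mult.commute)
  qed
  have g: "(\<lambda>j. (1 / q k) * (1 / 2 :: real) ^ j) sums ((1 / q k) * (1 / (1 - 1/2)))"
    by (intro sums_mult geometric_sums) simp
  show s: "summable (\<lambda>j. 1 / real (q (j + k)))"
    by (rule summable_comparison_test'[OF sums_summable[OF g], of 0]) (use le in simp)
  have "(\<Sum>j. 1 / real (q (j + k))) \<le> (\<Sum>j. (1 / q k) * (1 / 2 :: real) ^ j)"
    by (rule suminf_le[OF le s sums_summable[OF g]])
  then show "(\<Sum>j. 1 / real (q (j + k))) \<le> 2 / q k" using sums_unique[OF g] by simp
qed

text \<open>The next stage changes the map at the end of passes, but the level in the old tower goes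
  wrong less often. If the next pass has the same shift, it starts exactly at the level that the
  rotation of the old tower would reach; only the subcell is a new one. This is what makes long runs
  cheap.\<close>

lemma jump_position:
  assumes p: "p < q (Suc k)" and ne: "down k ((p + 1) mod q (Suc k)) \<noteq> (down k p + 1) mod q k"
  shows "p mod q k = q k - 1 \<and> \<psi> k (p div q k) \<noteq> \<psi> k ((p div q k + 1) mod M k)"
proof (rule conjI)
  show top: "p mod q k = q k - 1"
  proof (rule ccontr)
    assume "p mod q k \<noteq> q k - 1"
    then have "pos (Suc k) (lev (Suc k) p) mod q k \<noteq> q k - 1" by (simp only: pos_lev[OF p] not_False_eq_True)
    from step_refine[OF lev_less[OF p] this]
    have st: "step (Suc k) (lev (Suc k) p) div M k = step k (lev (Suc k) p div M k)" by simp
    have l: "lev (Suc k) p < q (Suc k)" by (rule lev_less[OF p])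
    have "down k ((p + 1) mod q (Suc k)) = down k (pos (Suc k) (step (Suc k) (lev (Suc k) p)))"
      by (simp only: pos_step pos_lev[OF p])
    also have "\<dots> = pos k (step (Suc k) (lev (Suc k) p) div M k)" by (rule down_pos[OF step_less])
    also have "\<dots> = (down k p + 1) mod q k"
      unfolding st pos_step using down_pos[OF l] by (simp only: pos_lev[OF p])
    finally show False using ne by simp
  qed
  show "\<psi> k (p div q k) \<noteq> \<psi> k ((p div q k + 1) mod M k)"
  proof
    assume eq: "\<psi> k (p div q k) = \<psi> k ((p div q k + 1) mod M k)"
    have "p = p div q k * q k + p mod q k" by simp
    \<comment> \<open>The level after the top of pass \<open>p div q k\<close> is level 0 of the
      next pass, counted cyclically.\<close>
    then have "p + 1 = p div q k * q k + q k" unfolding top using q_pos[of k] by linarith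
    then have "(p + 1) mod q (Suc k) = q k * ((p div q k + 1) mod M k)"
      unfolding q_Suc mult_mod_right by (simp add: algebra_simps)
    then have "down k ((p + 1) mod q (Suc k)) = \<psi> k (p div q k)"
      using eq shift_less by (simp add: down_def)
    also have "\<dots> = (down k p + 1) mod q k"
    proof -
      have "(down k p + 1) mod q k = (q k - 1 + \<psi> k (p div q k) + 1) mod q k"
        unfolding down_def top by (simp add: mod_Suc_eq)
      also have "q k - 1 + \<psi> k (p div q k) + 1 = \<psi> k (p div q k) + q k" using q_pos[of k] by linarith
      finally show ?thesis using shift_less by simp
    qed
    finally show False using ne by simp
  qed
qed

lemma card_jumps:
  "card {p. p < q (Suc k) \<and> down k ((p + 1) mod q (Suc k)) \<noteq> (down k p + 1) mod q k}
    \<le> card {j. j < M k \<and> \<psi> k j \<noteq> \<psi> k ((j + 1) mod M k)}"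
proof (rule card_inj_on_le[where f = "\<lambda>p. p div q k"])
  let ?A = "{p. p < q (Suc k) \<and> down k ((p + 1) mod q (Suc k)) \<noteq> (down k p + 1) mod q k}"
  show "inj_on (\<lambda>p. p div q k) ?A"
  proof (rule inj_onI)
    fix x y assume "x \<in> ?A" "y \<in> ?A" and d: "x div q k = y div q k"
    then have "x mod q k = y mod q k" using jump_position[of x k] jump_position[of y k] by simp
    then show "x = y" using d by (metis div_mult_mod_eq)
  qed
  show "(\<lambda>p. p div q k) ` ?A \<subseteq> {j. j < M k \<and> \<psi> k j \<noteq> \<psi> k ((j + 1) mod M k)}"
    using jump_position by (auto simp: q_Suc less_mult_imp_div_less mult.commute)
qed simp

text \<open>The limit is compared with stage \<open>k + 1\<close>, not with stage \<open>k\<close>.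
  It differs from stage \<open>k + 1\<close> on measure at most \<open>2 / q (Suc k)\<close>, and
  stage \<open>k + 1\<close> violates the rotation of tower \<open>k\<close> only at changes of the
  shift, each of measure \<open>1 / q (Suc k)\<close>. Direct comparison with stage \<open>k\<close>
  would give \<open>2 / q k\<close>, which is too weak.\<close>

lemma tower_limit:
  obtains U V where "mod0_iso unit_lborel unit_lborel U V"
    "\<And>k. measure unit_lborel {x. position k (U x) \<noteq> (position k x + 1) mod q k}
      \<le> (card {j. j < M k \<and> \<psi> k j \<noteq> \<psi> k ((j + 1) mod M k)} + 2) / q (Suc k)"
proof -
  have rd: "real_distribution unit_lborel"
    unfolding real_distribution_def real_distribution_axioms_def
    by (simp add: prob_space_unit_lborel)
  have ts: "exchange (q k) (unstep k) (map_stage k x) = x" "map_stage k (exchange (q k) (unstep k) x) = x" for k x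
    by (rule exchange_inverse; simp add: step_less unstep_less unstep_step step_unstep)+
  have nn: "norm (measure unit_lborel {x. map_stage (Suc k) x \<noteq> map_stage k x}) \<le> 1 / q k" for k
    using measure_map_stage_change[of k] by simp
  have sm: "summable (\<lambda>k. measure unit_lborel {x. map_stage (Suc k) x \<noteq> map_stage k x})"
    by (rule summable_comparison_test'[of "\<lambda>k. 1 / real (q k)" 0])
      (use suminf_inverse_q[of 0] nn in auto)
  have "\<exists>U V. mod0_iso unit_lborel unit_lborel U V \<and>
    (\<forall>k. measure unit_lborel {x. U x \<noteq> map_stage k x}
      \<le> (\<Sum>j. measure unit_lborel {x. map_stage (Suc (j + k)) x \<noteq> map_stage (j + k) x}))"
    by (rule mod0_iso_limit[OF rd, of map_stage "\<lambda>k. exchange (q k) (unstep k)",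
        OF measurable_exchange measurable_exchange distr_exchange[OF q_pos bij_step] ts sm]) blast
  then obtain U V where iso: "mod0_iso unit_lborel unit_lborel U V"
    and tail: "\<And>k. measure unit_lborel {x. U x \<noteq> map_stage k x}
      \<le> (\<Sum>j. measure unit_lborel {x. map_stage (Suc (j + k)) x \<noteq> map_stage (j + k) x})"
    by blast
  have [measurable]: "U \<in> borel_measurable borel" using mod0_isoD(1)[OF iso]
    by (simp only: measurable_cong_sets[OF sets_unit_lborel sets_unit_lborel])
  have tail2: "measure unit_lborel {x. U x \<noteq> map_stage k x} \<le> 2 / q k" for k
  proof -
    have "(\<Sum>j. measure unit_lborel {x. map_stage (Suc (j + k)) x \<noteq> map_stage (j + k) x})
        \<le> (\<Sum>j. 1 / real (q (j + k)))"
      by (rule suminf_le[OF measure_map_stage_change summable_ignore_initial_segment[OF sm] suminf_inverse_q(1)])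
    then show ?thesis using tail[of k] suminf_inverse_q(2)[of k] by simp
  qed
  have "measure unit_lborel {x. position k (U x) \<noteq> (position k x + 1) mod q k}
      \<le> (card {j. j < M k \<and> \<psi> k j \<noteq> \<psi> k ((j + 1) mod M k)} + 2) / q (Suc k)" for k
  proof -
    let ?R = "\<lambda>p. down k ((p + 1) mod q (Suc k)) \<noteq> (down k p + 1) mod q k"
    let ?J = "{x. ?R (position (Suc k) x)}" and ?D = "{x. U x \<noteq> map_stage (Suc k) x}"
    have J: "?J \<in> sets unit_lborel" and D: "?D \<in> sets unit_lborel" by simp_all
    have "{x. position k (U x) \<noteq> (position k x + 1) mod q k} \<subseteq> ?J \<union> ?D"
      by (auto simp: position_down[of k] position_map_stage)
    then have "measure unit_lborel {x. position k (U x) \<noteq> (position k x + 1) mod q k}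
        \<le> measure unit_lborel (?J \<union> ?D)"
      using J D by (intro unit_lborel.finite_measure_mono) auto
    also have "\<dots> \<le> measure unit_lborel ?J + measure unit_lborel ?D" by (rule measure_Un_le[OF J D])
    also have "measure unit_lborel ?J = card {p. p < q (Suc k) \<and> ?R p} / q (Suc k)"
      by (rule measure_position[where R = ?R])
    also have "\<dots> \<le> card {j. j < M k \<and> \<psi> k j \<noteq> \<psi> k ((j + 1) mod M k)} / q (Suc k)"
      using card_jumps[of k] by (intro divide_right_mono) simp_all
    finally show ?thesis using tail2[of "Suc k"] by (simp add: add_divide_distrib)
  qed
  with iso show ?thesis by (rule that)
qed

end

section \<open>Binary words and runs\<close>

definition subset_enum :: "nat \<Rightarrow> nat \<Rightarrow> nat set" where
  "subset_enum L = (SOME e. bij_betw e {..<2 ^ L} (Pow {..<L}))"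

text \<open>Indices from \<open>2 ^ L\<close> on repeat all words complemented, so that a half-turn of the tower negates the
  colouring.\<close>

definition word :: "nat \<Rightarrow> nat \<Rightarrow> nat set" where
  "word L u = (if u < 2 ^ L then subset_enum L u else {..<L} - subset_enum L (u - 2 ^ L))"

text \<open>Here \<open>b\<close> numbers the runs. Superblock \<open>b div L\<close> consists of
  \<open>L\<close> runs and spells one word, a letter per run; the letter decides between the two
  kinds of runs.\<close>

definition phase :: "nat \<Rightarrow> nat \<Rightarrow> bool" where
  "phase L b \<longleftrightarrow> b mod L \<in> word L (b div L)"

lemma bij_subset_enum: "bij_betw (subset_enum L) {..<2 ^ L} (Pow {..<L})"
proof -
  have "\<exists>e. bij_betw e {..<2 ^ L :: nat} (Pow {..<L})"
    using ex_bij_betw_nat_finite[of "Pow {..<L}"] by (simp add: card_Pow atLeast0LessThan)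
  then show ?thesis unfolding subset_enum_def by (rule someI_ex)
qed

lemma subset_enum_subset: "u < 2 ^ L \<Longrightarrow> subset_enum L u \<subseteq> {..<L}"
  using bij_subset_enum[of L] by (auto simp: bij_betw_def)

lemma word_subset: "u < 2 ^ Suc L \<Longrightarrow> word L u \<subseteq> {..<L}"
  using subset_enum_subset by (auto simp: word_def)

lemma word_antipodal:
  assumes "u < 2 ^ Suc L"
  shows "word L ((u + 2 ^ L) mod 2 ^ Suc L) = {..<L} - word L u"
proof (cases "u < 2 ^ L")
  case True
  then show ?thesis by (simp add: word_def)
next
  case False
  then have "(u + 2 ^ L) mod 2 ^ Suc L = u - 2 ^ L"
    using assms by (subst mod_if) auto
  moreover have "u - 2 ^ L < 2 ^ L" using assms False by auto
  ultimately show ?thesis using False subset_enum_subset[of "u - 2 ^ L" L] by (auto simp: word_def)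
qed

text \<open>Advancing by half of all runs advances the word index by \<open>2 ^ L\<close>, which
  complements the word, and keeps the place of the letter.\<close>

lemma phase_antipodal:
  assumes "0 < L" "b < L * 2 ^ Suc L"
  shows "phase L ((b + L * 2 ^ L) mod (L * 2 ^ Suc L)) \<longleftrightarrow> \<not> phase L b"
proof -
  have u: "b div L < 2 ^ Suc L" using assms by (simp add: less_mult_imp_div_less mult.commute)
  have "(b + L * 2 ^ L) mod (L * 2 ^ Suc L) = L * ((b div L + 2 ^ L) mod 2 ^ Suc L) + b mod L"
    using assms by (simp add: mod_mult2_eq add.commute del: power_Suc)
  then have d: "(b + L * 2 ^ L) mod (L * 2 ^ Suc L) div L = (b div L + 2 ^ L) mod 2 ^ Suc L"
    "(b + L * 2 ^ L) mod (L * 2 ^ Suc L) mod L = b mod L"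
    using assms by (simp_all del: power_Suc)
  show ?thesis unfolding phase_def d word_antipodal[OF u] using assms by simp
qed

text \<open>Symmetric difference with \<open>Y0\<close> permutes the subsets, which reduces the sum
  to \<open>Y0 = {}\<close>; there it factors over the elements.\<close>

lemma sum_weight_sym_diff:
  assumes "Y0 \<subseteq> {..<L::nat}"
  shows "(\<Sum>Y\<in>Pow {..<L}. (1/2::real) ^ card (sym_diff Y Y0)) = (3/2) ^ L"
proof -
  have "(\<Sum>Y\<in>Pow {..<L}. (1/2::real) ^ card (sym_diff Y Y0)) = (\<Sum>Y\<in>Pow {..<L}. (1/2::real) ^ card Y)"
    by (rule sum.reindex_bij_witness[where i = "\<lambda>Y. sym_diff Y Y0" and j = "\<lambda>Y. sym_diff Y Y0"])
      (use assms in auto)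
  also have "\<dots> = (\<Prod>x<L. (1/2::real) + 1)"
    by (subst prod_add) simp_all
  also have "\<dots> = (3/2) ^ L" by simp
  finally show ?thesis .
qed

text \<open>A Chernoff bound: weighting a set at distance \<open>j\<close> from \<open>Y0\<close> by \<open>2\<^sup>-\<^sup>j\<close> gives total mass
  \<open>(3/2)\<^sup>L\<close>.\<close>

lemma card_near_subsets:
  assumes "Y0 \<subseteq> {..<8 * l::nat}"
  shows "card {Y. Y \<subseteq> {..<8 * l} \<and> card (sym_diff Y Y0) \<le> l} \<le> 64 ^ l"
proof -
  let ?A = "{Y. Y \<subseteq> {..<8 * l} \<and> card (sym_diff Y Y0) \<le> l}"
  have "real (card ?A) * (1/2) ^ l = (\<Sum>Y\<in>?A. (1/2::real) ^ l)" by simp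
  also have "\<dots> \<le> (\<Sum>Y\<in>?A. (1/2::real) ^ card (sym_diff Y Y0))"
    by (rule sum_mono) (auto intro: power_decreasing)
  also have "\<dots> \<le> (\<Sum>Y\<in>Pow {..<8 * l}. (1/2::real) ^ card (sym_diff Y Y0))"
    by (rule sum_mono2) auto
  also have "\<dots> = ((3/2) ^ 8) ^ l" unfolding sum_weight_sym_diff[OF assms] by (simp add: power_mult)
  \<comment> \<open>\<open>(3/2) ^ 8\<close> is about 25.6. Undoing the weight
    \<open>(1/2) ^ l\<close> turns 32 into the 64 of the claim.\<close>
  also have "\<dots> \<le> 32 ^ l" by (rule power_mono) (simp_all add: power_divide)
  finally have "real (card ?A) * (1/2) ^ l * 2 ^ l \<le> 32 ^ l * 2 ^ l" by (rule mult_right_mono) simp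
  then have "real (card ?A) \<le> real (64 ^ l)"
    by (simp add: power_divide flip: power_mult_distrib)
  then show ?thesis by (simp only: of_nat_le_iff)
qed

text \<open>Each subset is listed twice, once in the first half of the indices and once as a
  complement in the second, hence the factor 2.\<close>

lemma card_near_words:
  assumes "Y0 \<subseteq> {..<8 * l::nat}"
  shows "card {u. u < 2 ^ Suc (8 * l) \<and> card (sym_diff (word (8 * l) u) Y0) \<le> l} \<le> 2 * 64 ^ l"
proof -
  let ?L = "8 * l"
  let ?S = "{Y. Y \<subseteq> {..<?L} \<and> card (sym_diff Y Y0) \<le> l}"
  let ?P = "\<lambda>u. card (sym_diff (word ?L u) Y0) \<le> l"
  have fin: "finite ?S" by simp
  have e: "inj_on (subset_enum ?L) {..<2 ^ ?L}" using bij_subset_enum by (simp add: bij_betw_def)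
  have "inj_on (word ?L) {u. u < 2 ^ ?L \<and> ?P u}"
    using e by (auto simp: inj_on_def word_def)
  moreover have "word ?L u \<subseteq> {..<?L}" if "u < 2 ^ ?L" for u
    by (rule word_subset) (use that in simp)
  ultimately have 1: "card {u. u < 2 ^ ?L \<and> ?P u} \<le> card ?S"
    by (intro card_inj_on_le[where f = "word ?L"] fin) blast+
  have "inj_on (word ?L) {u. 2 ^ ?L \<le> u \<and> u < 2 ^ Suc ?L \<and> ?P u}"
  proof (rule inj_onI)
    fix x y assume x: "x \<in> {u. 2 ^ ?L \<le> u \<and> u < 2 ^ Suc ?L \<and> ?P u}"
      and y: "y \<in> {u. 2 ^ ?L \<le> u \<and> u < 2 ^ Suc ?L \<and> ?P u}" and "word ?L x = word ?L y"
    then have "{..<?L} - subset_enum ?L (x - 2 ^ ?L) = {..<?L} - subset_enum ?L (y - 2 ^ ?L)"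
      by (simp add: word_def)
    moreover have b: "x - 2 ^ ?L < 2 ^ ?L" "y - 2 ^ ?L < 2 ^ ?L" using x y by auto
    moreover note subset_enum_subset[OF b(1)] subset_enum_subset[OF b(2)]
    ultimately have "subset_enum ?L (x - 2 ^ ?L) = subset_enum ?L (y - 2 ^ ?L)" by blast
    then have "x - 2 ^ ?L = y - 2 ^ ?L" using e b by (simp add: inj_on_def)
    moreover have "2 ^ ?L \<le> x" "2 ^ ?L \<le> y" using x y by auto
    ultimately show "x = y" by linarith
  qed
  then have 2: "card {u. 2 ^ ?L \<le> u \<and> u < 2 ^ Suc ?L \<and> ?P u} \<le> card ?S"
    by (rule card_inj_on_le[OF _ _ fin]) (use word_subset[of _ ?L] in blast)
  have "{u. u < 2 ^ Suc ?L \<and> ?P u} \<subseteq> {u. u < 2 ^ ?L \<and> ?P u} \<union> {u. 2 ^ ?L \<le> u \<and> u < 2 ^ Suc ?L \<and> ?P u}"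
    by auto
  then have "card {u. u < 2 ^ Suc ?L \<and> ?P u}
      \<le> card ({u. u < 2 ^ ?L \<and> ?P u} \<union> {u. 2 ^ ?L \<le> u \<and> u < 2 ^ Suc ?L \<and> ?P u})"
    by (intro card_mono) auto
  also have "\<dots> \<le> card {u. u < 2 ^ ?L \<and> ?P u} + card {u. 2 ^ ?L \<le> u \<and> u < 2 ^ Suc ?L \<and> ?P u}"
    by (rule card_Un_le)
  finally show ?thesis using 1 2 card_near_subsets[OF assms] by linarith
qed

text \<open>A window that starts at offset \<open>o'\<close> of superblock \<open>u\<close> enters
  superblock \<open>u + 1\<close> (cyclically) after \<open>L * b - o'\<close> steps and then reads
  it from its beginning; \<open>t\<close> is the offset in it.\<close>

lemma superblock_colour:
  fixes b L u o' i :: nat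
  assumes "0 < b" "0 < L" "u < 2 ^ Suc L" "o' < L * b" "L * b - o' \<le> i" "i < 2 * (L * b) - o'"
  defines "t \<equiv> i - (L * b - o')" and "x \<equiv> (u * (L * b) + o' + i) mod (b * (L * 2 ^ Suc L))"
  shows "t < L * b" "x mod b = t mod b" "phase L (x div b) \<longleftrightarrow> t div b \<in> word L ((u + 1) mod 2 ^ Suc L)"
proof -
  show t: "t < L * b" using assms(4-6) by (simp add: t_def)
  define u' where "u' = (u + 1) mod 2 ^ Suc L"
  have eq: "u * (L * b) + o' + i = (u + 1) * (L * b) + t" using assms(4-6) by (simp add: t_def)
  have "b * (L * 2 ^ Suc L) = (L * b) * 2 ^ Suc L" by simp
  then have "x = ((u + 1) * (L * b) + t) mod ((L * b) * 2 ^ Suc L)"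
    unfolding x_def eq by (simp only:)
  also have "\<dots> = (L * b) * (((u + 1) * (L * b) + t) div (L * b) mod 2 ^ Suc L) + ((u + 1) * (L * b) + t) mod (L * b)"
    by (rule mod_mult2_eq)
  also have "((u + 1) * (L * b) + t) div (L * b) = u + 1"
    by (subst div_mult_self3) (use t assms(1,2) in auto)
  also have "((u + 1) * (L * b) + t) mod (L * b) = t"
    by (subst mod_mult_self3) (use t in simp)
  finally have x: "x = (u' * L) * b + t" by (simp add: u'_def mult_ac)
  show "x mod b = t mod b" by (simp add: x)
  have "x div b = u' * L + t div b" using assms(1) by (simp add: x)
  moreover have "t div b < L" using t by (simp add: less_mult_imp_div_less)
  ultimately have "x div b div L = u'" "x div b mod L = t div b" by simp_all
  then show "phase L (x div b) \<longleftrightarrow> t div b \<in> word L ((u + 1) mod 2 ^ Suc L)"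
    by (simp add: phase_def u'_def)
qed

lemma card_div_preimage:
  assumes "0 < b" "D \<subseteq> {..<L::nat}"
  shows "card {t. t < L * b \<and> t div b \<in> D} = b * card D"
proof -
  have "bij_betw (\<lambda>(d, j). d * b + j) (D \<times> {..<b}) {t. t < L * b \<and> t div b \<in> D}"
  proof (rule bij_betw_byWitness[where f' = "\<lambda>t. (t div b, t mod b)"])
    show "(\<lambda>(d, j). d * b + j) ` (D \<times> {..<b}) \<subseteq> {t. t < L * b \<and> t div b \<in> D}"
    proof clarsimp
      fix d j assume d: "d \<in> D" and "j < b"
      then have "d * b + j < Suc d * b" by simp
      also have "\<dots> \<le> L * b" using d assms(2) by (intro mult_le_mono1) auto
      finally show "d * b + j < L * b" .
    qed
  qed (use assms in auto)
  then have "card (D \<times> {..<b}) = card {t. t < L * b \<and> t div b \<in> D}" by (rule bij_betw_same_card)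
  then show ?thesis by (simp add: card_cartesian_product mult.commute)
qed

text \<open>A window of two superblocks contains a full superblock at a location that only depends on the
  residue of its starting position modulo the superblock length.\<close>

lemma window_distance:
  fixes b L u u' o' :: nat and w :: "nat \<Rightarrow> bool"
  assumes "0 < b" "0 < L" "u < 2 ^ Suc L" "u' < 2 ^ Suc L" "o' < L * b"
    and w: "\<And>p. p < b * (L * 2 ^ Suc L) \<Longrightarrow> w p \<longleftrightarrow> g (p mod b) \<noteq> phase L (p div b)"
  defines "f \<equiv> \<lambda>p i. w ((p + i) mod (b * (L * 2 ^ Suc L)))"
  shows "b * card (sym_diff (word L ((u + 1) mod 2 ^ Suc L)) (word L ((u' + 1) mod 2 ^ Suc L)))
    \<le> card {i. i < 2 * L * b \<and> f (u * (L * b) + o') i \<noteq> f (u' * (L * b) + o') i}"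
proof -
  let ?D = "sym_diff (word L ((u + 1) mod 2 ^ Suc L)) (word L ((u' + 1) mod 2 ^ Suc L))"
  have D: "?D \<subseteq> {..<L}"
    using word_subset[of "(u + 1) mod 2 ^ Suc L" L] word_subset[of "(u' + 1) mod 2 ^ Suc L" L] by auto
  have "b * card ?D = card {t. t < L * b \<and> t div b \<in> ?D}"
    by (rule card_div_preimage[OF assms(1) D, symmetric])
  also have "\<dots> \<le> card {i. i < 2 * L * b \<and> f (u * (L * b) + o') i \<noteq> f (u' * (L * b) + o') i}"
  proof (rule card_inj_on_le[where f = "\<lambda>t. t + (L * b - o')"])
    show "(\<lambda>t. t + (L * b - o')) ` {t. t < L * b \<and> t div b \<in> ?D}
        \<subseteq> {i. i < 2 * L * b \<and> f (u * (L * b) + o') i \<noteq> f (u' * (L * b) + o') i}"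
    proof (rule image_subsetI)
      fix t assume "t \<in> {t. t < L * b \<and> t div b \<in> ?D}"
      then have t: "t < L * b" "t div b \<in> ?D" by simp_all
      define i where "i = t + (L * b - o')"
      have i: "L * b - o' \<le> i" "i < 2 * (L * b) - o'" "i - (L * b - o') = t"
        using t(1) assms(5) by (auto simp: i_def)
      note s = superblock_colour[OF assms(1,2,3,5) i(1,2), unfolded i(3)]
      note s' = superblock_colour[OF assms(1,2,4,5) i(1,2), unfolded i(3)]
      have Q: "0 < b * (L * 2 ^ Suc L)" using assms by simp
      \<comment> \<open>The factor \<open>g (t mod b)\<close> is common to both windows, since they
        are read at the same offset \<open>t\<close>. It cancels, and the colours differ exactly
        where the letters do.\<close>
      have "f (u * (L * b) + o') i \<longleftrightarrow> g (t mod b) \<noteq> (t div b \<in> word L ((u + 1) mod 2 ^ Suc L))"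
        unfolding f_def w[OF mod_less_divisor[OF Q]] s(2,3) ..
      moreover have "f (u' * (L * b) + o') i \<longleftrightarrow> g (t mod b) \<noteq> (t div b \<in> word L ((u' + 1) mod 2 ^ Suc L))"
        unfolding f_def w[OF mod_less_divisor[OF Q]] s'(2,3) ..
      ultimately have "f (u * (L * b) + o') i \<noteq> f (u' * (L * b) + o') i" using t(2) by blast
      moreover have "i < 2 * L * b" using i(2) by simp
      ultimately show "t + (L * b - o') \<in> {i. i < 2 * L * b \<and> f (u * (L * b) + o') i \<noteq> f (u' * (L * b) + o') i}"
        unfolding i_def by blast
    qed
  qed (auto simp: inj_on_def)
  finally show ?thesis .
qed

text \<open>Within one residue class modulo the superblock length, close positions read words in a
  common Hamming ball of radius \<open>l\<close>, and the superblock index determines the position.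
  Summing over all residues costs a factor \<open>L * b\<close>, which \<open>Q\<close> contains as
  well and which therefore disappears from the final ratio.\<close>

lemma card_close_positions:
  fixes b l :: nat and w :: "nat \<Rightarrow> bool"
  defines "L \<equiv> 8 * l"
  defines "Q \<equiv> b * (L * 2 ^ Suc L)"
  assumes "0 < b" "0 < l"
    and w: "\<And>p. p < Q \<Longrightarrow> w p \<longleftrightarrow> g (p mod b) \<noteq> phase L (p div b)"
    and S: "S \<subseteq> {..<Q}"
    and close: "\<And>p p'. p \<in> S \<Longrightarrow> p' \<in> S \<Longrightarrow>
      card {i. i < 2 * L * b \<and> w ((p + i) mod Q) \<noteq> w ((p' + i) mod Q)} < (l + 1) * b"
  shows "card S \<le> (L * b) * (2 * 64 ^ l)"
proof -
  have L: "0 < L" and Lb: "0 < L * b" using assms by simp_all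
  have QL: "Q = (L * b) * 2 ^ Suc L" by (simp add: Q_def)
  have "card {p \<in> S. p mod (L * b) = o'} \<le> 2 * 64 ^ l" if o': "o' < L * b" for o'
  proof (cases "{p \<in> S. p mod (L * b) = o'} = {}")
    case False
    then obtain p0 where p0: "p0 \<in> S" "p0 mod (L * b) = o'" by blast
    \<comment> \<open>The index of the following superblock, which is the one that fits completely
      into the window.\<close>
    define h where "h p = (p div (L * b) + 1) mod 2 ^ Suc L" for p
    have u: "p div (L * b) < 2 ^ Suc L" if "p \<in> S" for p
      using that S by (auto simp: QL less_mult_imp_div_less mult.commute)
    have near: "card (sym_diff (word L (h p)) (word L (h p0))) \<le> l" if p: "p \<in> S" "p mod (L * b) = o'" for p
    proof -
      have eq: "p = p div (L * b) * (L * b) + o'" "p0 = p0 div (L * b) * (L * b) + o'"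
        using p(2) p0(2) div_mult_mod_eq[of p "L * b"] div_mult_mod_eq[of p0 "L * b"] by simp_all
      have "b * card (sym_diff (word L (h p)) (word L (h p0)))
          \<le> card {i. i < 2 * L * b \<and> w ((p + i) mod Q) \<noteq> w ((p0 + i) mod Q)}"
        using window_distance[OF assms(3) L u[OF p(1)] u[OF p0(1)] o' w[unfolded Q_def]]
        unfolding h_def Q_def eq[symmetric] by simp
      also have "\<dots> < b * (l + 1)" using close[OF p(1) p0(1)] by (simp add: mult.commute)
      finally have "card (sym_diff (word L (h p)) (word L (h p0))) < l + 1"
        using assms(3) by (simp only: mult_less_cancel1)
      then show ?thesis by simp
    qed
    have "card {p \<in> S. p mod (L * b) = o'} \<le> card {u. u < 2 ^ Suc L \<and> card (sym_diff (word L u) (word L (h p0))) \<le> l}"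
    proof (rule card_inj_on_le[where f = h])
      show "inj_on h {p \<in> S. p mod (L * b) = o'}"
      proof (rule inj_onI)
        fix x y assume x: "x \<in> {p \<in> S. p mod (L * b) = o'}" and y: "y \<in> {p \<in> S. p mod (L * b) = o'}"
          and "h x = h y"
        have "x div (L * b) < 2 ^ Suc L" "y div (L * b) < 2 ^ Suc L" using u x y by auto
        then have "x div (L * b) = y div (L * b)"
          using \<open>h x = h y\<close> unfolding h_def by (auto simp: mod_Suc split: if_splits simp del: power_Suc)
        moreover have "x mod (L * b) = y mod (L * b)" using x y by simp
        ultimately show "x = y" by (metis div_mult_mod_eq)
      qed
      show "h ` {p \<in> S. p mod (L * b) = o'} \<subseteq> {u. u < 2 ^ Suc L \<and> card (sym_diff (word L u) (word L (h p0))) \<le> l}"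
        using near by (auto simp: h_def simp del: power_Suc)
    qed simp
    also have "\<dots> \<le> 2 * 64 ^ l"
      unfolding L_def by (rule card_near_words) (rule word_subset, simp add: h_def L_def)
    finally show ?thesis .
  next
    case True
    show ?thesis unfolding True by simp
  qed
  then have "(\<Sum>o'<L * b. card {p \<in> S. p mod (L * b) = o'}) \<le> (\<Sum>o'<L * b. 2 * 64 ^ l)"
    by (intro sum_mono) simp
  moreover have "card S \<le> (\<Sum>o'<L * b. card {p \<in> S. p mod (L * b) = o'})"
  proof -
    have "S = (\<Union>o'<L * b. {p \<in> S. p mod (L * b) = o'})" using Lb by auto
    then have "card S = card (\<Union>o'<L * b. {p \<in> S. p mod (L * b) = o'})" by simp
    also have "\<dots> \<le> (\<Sum>o'<L * b. card {p \<in> S. p mod (L * b) = o'})" by (rule card_UN_le) simp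
    finally show ?thesis .
  qed
  ultimately show ?thesis by simp
qed

section \<open>Covering numbers and cyclic approximation of maps that climb a tower\<close>

lemma hamming_dist_triangle: "hamming_dist n w w'' \<le> hamming_dist n w w' + hamming_dist n w' w''"
proof -
  have "card {k. k < n \<and> w ! k \<noteq> w'' ! k} \<le> card ({k. k < n \<and> w ! k \<noteq> w' ! k} \<union> {k. k < n \<and> w' ! k \<noteq> w'' ! k})"
    by (rule card_mono) auto
  also have "\<dots> \<le> card {k. k < n \<and> w ! k \<noteq> w' ! k} + card {k. k < n \<and> w' ! k \<noteq> w'' ! k}"
    by (rule card_Un_le)
  finally show ?thesis by (simp add: hamming_dist_def divide_right_mono flip: add_divide_distrib of_nat_add)
qed

lemma hamming_dist_commute: "hamming_dist n w w' = hamming_dist n w' w"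
  by (simp add: hamming_dist_def eq_commute)

text \<open>\<open>covering_number\<close> is a \<open>LEAST\<close>, so some admissible family has
  to exist before its minimality says anything. With finitely many names there are finitely many
  balls, and all of them together cover the space.\<close>

lemma covering_number_ge:
  assumes "prob_space M" "finite (name m P T n ` space M)" "0 < \<epsilon>"
    and "\<And>\<B>. \<B> \<subseteq> hamming_ball M m P T n \<epsilon> ` space M \<Longrightarrow> finite \<B> \<Longrightarrow> measure M (\<Union>\<B>) > 1 - \<epsilon> \<Longrightarrow> c \<le> card \<B>"
  shows "c \<le> covering_number M m P T n \<epsilon>"
proof -
  interpret prob_space M by fact
  let ?B = "hamming_ball M m P T n \<epsilon> ` space M"
  have "?B \<subseteq> (\<lambda>w. {y \<in> space M. hamming_dist n w (name m P T n y) < \<epsilon>}) ` (name m P T n ` space M)"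
    by (auto simp: hamming_ball_def)
  then have fin: "finite ?B" using assms(2) by (meson finite_imageI finite_subset)
  have "\<Union>?B = space M" using assms(3) by (auto simp: hamming_ball_def hamming_dist_def)
  then have "measure M (\<Union>?B) > 1 - \<epsilon>" using assms(3) by (simp add: prob_space)
  then have "\<exists>N \<B>. \<B> \<subseteq> ?B \<and> finite \<B> \<and> card \<B> = N \<and> measure M (\<Union>\<B>) > 1 - \<epsilon>"
    using fin by blast
  then have "\<exists>\<B>. \<B> \<subseteq> ?B \<and> finite \<B> \<and> card \<B> = covering_number M m P T n \<epsilon> \<and> measure M (\<Union>\<B>) > 1 - \<epsilon>"
    unfolding covering_number_def by (rule LeastI_ex)
  then show ?thesis using assms(4) by metis
qed

lemma sets_shift_defect:
  fixes P :: "'a \<Rightarrow> nat"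
  assumes P: "P \<in> M \<rightarrow>\<^sub>M count_space UNIV" and T: "T \<in> M \<rightarrow>\<^sub>M M"
  shows "{x \<in> space M. P (T x) \<noteq> (P x + 1) mod Q} \<in> sets M"
proof -
  have "Measurable.pred M (\<lambda>x. P (T x) \<noteq> (p + 1) mod Q)" for p
    using measurable_compose[OF T P] by measurable
  from measurable_compose_countable[OF this P] show ?thesis by simp
qed

text \<open>Most orbits climb the tower without defect during the whole time, so their names are
  windows of \<open>w\<close>. Points of one ball that have such orbits then occupy at most
  \<open>L * b * (2 * 64 ^ l)\<close> of the \<open>Q = L * b * (2 * 256 ^ l)\<close> positions,
  while the balls together must reach half of the positions.\<close>

lemma covering_number_lower_bound:
  fixes M :: "'a measure" and b l :: nat and w :: "nat \<Rightarrow> bool" and P :: "'a \<Rightarrow> nat"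
  defines "L \<equiv> 8 * l"
  defines "Q \<equiv> b * (L * 2 ^ Suc L)"
  assumes M: "prob_space M" and T: "T \<in> M \<rightarrow>\<^sub>M M" "distr M M T = M" and b: "0 < b" and l: "0 < l"
    and Pm: "P \<in> M \<rightarrow>\<^sub>M count_space UNIV" and P: "\<And>x. x \<in> space M \<Longrightarrow> P x < Q"
    and unif: "\<And>R. measure M {x \<in> space M. R (P x)} = card {p. p < Q \<and> R p} / Q"
    and bad: "real (2 * L * b) * measure M {x \<in> space M. P (T x) \<noteq> (P x + 1) mod Q} \<le> 1 / 10"
    and w: "\<And>p. p < Q \<Longrightarrow> w p \<longleftrightarrow> g (p mod b) \<noteq> phase L (p div b)"
    and part: "\<And>x. x \<in> space M \<Longrightarrow> x \<in> Pt 1 \<longleftrightarrow> w (P x)" "\<And>x. x \<in> space M \<Longrightarrow> x \<in> Pt 2 \<longleftrightarrow> \<not> w (P x)"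
    and \<epsilon>: "0 < \<epsilon>" "\<epsilon> \<le> 1 / 32"
  shows "4 ^ l / 2 \<le> real (covering_number M 2 Pt T (2 * L * b) \<epsilon>)"
proof -
  interpret prob_space M by fact
  define n where "n = 2 * L * b"
  have n: "0 < n" using b l by (simp add: n_def L_def)
  have Q: "0 < Q" using b l by (simp add: Q_def L_def)
  note [measurable] = T(1) Pm
  have Tn: "(T ^^ i) \<in> M \<rightarrow>\<^sub>M M" "distr M M (T ^^ i) = M" for i
    using funpow_mp[OF T] by auto
  have Tsp: "(T ^^ i) x \<in> space M" if "x \<in> space M" for i x
    using measurable_space[OF Tn(1) that] .
  define Bad where "Bad = {x \<in> space M. P (T x) \<noteq> (P x + 1) mod Q}"
  have Bad: "Bad \<in> sets M" unfolding Bad_def by (rule sets_shift_defect[OF Pm T(1)])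
  \<comment> \<open>Points whose orbit meets a defect before time \<open>n\<close>; its measure is
    at most \<open>n\<close> times that of \<open>Bad\<close>.\<close>
  define N where "N = (\<Union>i<n. (T ^^ i) -` Bad \<inter> space M)"
  have Tpre: "(T ^^ i) -` Bad \<inter> space M \<in> sets M" for i using measurable_sets[OF Tn(1) Bad] .
  have N: "N \<in> sets M" unfolding N_def using Tpre by blast
  have "measure M N \<le> (\<Sum>i<n. measure M ((T ^^ i) -` Bad \<inter> space M))"
    unfolding N_def using Tpre by (intro finite_measure_subadditive_finite) auto
  also have "\<dots> = (\<Sum>i<n. measure M Bad)"
    using measure_distr[OF Tn(1) Bad] by (simp only: Tn(2))
  also have "\<dots> \<le> 1 / 10" using bad by (simp add: Bad_def n_def)
  finally have N_small: "measure M N \<le> 1 / 10" .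
  have orbit: "P ((T ^^ i) x) = (P x + i) mod Q" if "x \<in> space M" "x \<notin> N" "i \<le> n" for x i
    using that(3)
  proof (induction i)
    case 0 then show ?case using P[OF that(1)] by simp
  next
    case (Suc i)
    have "(T ^^ i) x \<notin> Bad" using that Suc.prems by (auto simp: N_def)
    then have "P (T ((T ^^ i) x)) = (P ((T ^^ i) x) + 1) mod Q" using Tsp[OF that(1)] by (auto simp: Bad_def)
    then show ?case using Suc by (simp add: mod_Suc_eq)
  qed
  have name: "name 2 Pt T n x = map (\<lambda>i. if w (P ((T ^^ i) x)) then 1 else 2) [0..<n]"
    if "x \<in> space M" for x
    unfolding name_def
  proof (rule map_cong[OF refl])
    fix i
    note part' = part[OF Tsp[OF that, of i]]
    have "i' = (if w (P ((T ^^ i) x)) then 1 else 2)" if "i' \<in> {1..2} \<and> (T ^^ i) x \<in> Pt i'" for i' :: nat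
    proof -
      have "i' = 1 \<or> i' = 2" using that by auto
      then show ?thesis using that part' by auto
    qed
    then show "(THE i'. i' \<in> {1..2} \<and> (T ^^ i) x \<in> Pt i') = (if w (P ((T ^^ i) x)) then 1 else 2)"
      using part' by (intro the_equality) auto
  qed
  have "name 2 Pt T n ` space M \<subseteq> {xs. set xs \<subseteq> {1, 2} \<and> length xs = n}"
    by (auto simp: name)
  then have fin: "finite (name 2 Pt T n ` space M)"
    using finite_lists_length_eq[of "{1, 2 :: nat}" n] finite_subset by blast
  have "nat \<lceil>4 ^ l / 2 :: real\<rceil> \<le> covering_number M 2 Pt T n \<epsilon>"
  proof (rule covering_number_ge[OF M fin \<epsilon>(1)])
    fix \<B> assume \<B>: "\<B> \<subseteq> hamming_ball M 2 Pt T n \<epsilon> ` space M" "finite \<B>" "measure M (\<Union>\<B>) > 1 - \<epsilon>"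
    define S where "S B = P ` (B - N)" for B
    have Bsp: "B \<subseteq> space M" if "B \<in> \<B>" for B using that \<B>(1) by (auto simp: hamming_ball_def)
    have SQ: "S B \<subseteq> {..<Q}" if "B \<in> \<B>" for B using Bsp[OF that] P by (auto simp: S_def)
    have card_S: "card (S B) \<le> (L * b) * (2 * 64 ^ l)" if B: "B \<in> \<B>" for B
      unfolding L_def
    proof (rule card_close_positions[OF b l w[unfolded Q_def L_def] SQ[OF B, unfolded Q_def L_def]])
      fix p p' assume "p \<in> S B" "p' \<in> S B"
      then obtain y y' where y: "y \<in> B" "y \<notin> N" "p = P y" and y': "y' \<in> B" "y' \<notin> N" "p' = P y'"
        by (auto simp: S_def)
      have ysp: "y \<in> space M" "y' \<in> space M" using Bsp[OF B] y y' by auto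
      obtain z where "B = hamming_ball M 2 Pt T n \<epsilon> z" using B \<B>(1) by auto
      then have "hamming_dist n (name 2 Pt T n z) (name 2 Pt T n y) < \<epsilon>"
        "hamming_dist n (name 2 Pt T n z) (name 2 Pt T n y') < \<epsilon>"
        using y y' by (auto simp: hamming_ball_def)
      then have "hamming_dist n (name 2 Pt T n y) (name 2 Pt T n y') < 2 * \<epsilon>"
        using hamming_dist_triangle[of n "name 2 Pt T n y" "name 2 Pt T n y'" "name 2 Pt T n z"]
        by (simp add: hamming_dist_commute)
      \<comment> \<open>The bound \<open>1 / 32\<close> on \<open>\<epsilon>\<close> is chosen for
        this: two points of a ball differ in fewer than \<open>n / 16 = l * b\<close>
        places.\<close>
      also have "\<dots> \<le> 1 / 16" using \<epsilon> by simp
      finally have "real (card {i. i < n \<and> name 2 Pt T n y ! i \<noteq> name 2 Pt T n y' ! i}) < real n / 16"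
        using n by (simp add: hamming_dist_def field_simps)
      also have "{i. i < n \<and> name 2 Pt T n y ! i \<noteq> name 2 Pt T n y' ! i}
          = {i. i < n \<and> w ((p + i) mod Q) \<noteq> w ((p' + i) mod Q)}"
        using orbit[OF ysp(1) y(2)] orbit[OF ysp(2) y'(2)] y(3) y'(3) by (auto simp: name ysp split: if_splits)
      also have "real n / 16 = real (l * b)" by (simp add: n_def L_def)
      finally have "card {i. i < n \<and> w ((p + i) mod Q) \<noteq> w ((p' + i) mod Q)} < l * b"
        by (simp only: of_nat_less_iff)
      also have "\<dots> \<le> (l + 1) * b" by simp
      finally show "card {i. i < 2 * (8 * l) * b \<and> w ((p + i) mod (b * (8 * l * 2 ^ Suc (8 * l))))
          \<noteq> w ((p' + i) mod (b * (8 * l * 2 ^ Suc (8 * l))))} < (l + 1) * b"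
        unfolding n_def Q_def L_def .
    qed
    let ?S = "\<Union>B\<in>\<B>. S B"
    have PS: "{x \<in> space M. P x \<in> ?S} \<in> sets M"
      using measurable_sets[OF Pm, of ?S] by (simp add: vimage_def Int_def conj_commute)
    have "\<Union>\<B> \<subseteq> {x \<in> space M. P x \<in> ?S} \<union> N" using Bsp by (auto simp: S_def)
    then have "measure M (\<Union>\<B>) \<le> measure M ({x \<in> space M. P x \<in> ?S} \<union> N)"
      by (intro finite_measure_mono sets.Un PS N)
    also have "\<dots> \<le> measure M {x \<in> space M. P x \<in> ?S} + measure M N"
      by (rule measure_Un_le[OF PS N])
    also have "measure M {x \<in> space M. P x \<in> ?S} = card {p. p < Q \<and> p \<in> ?S} / Q" by (rule unif)
    also have "{p. p < Q \<and> p \<in> ?S} = ?S" using SQ by auto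
    \<comment> \<open>The balls cover more than \<open>1 - 1/32\<close>, and \<open>N\<close> takes
      away at most \<open>1/10\<close>.\<close>
    finally have "1 / 2 \<le> card ?S / Q" using \<B>(3) \<epsilon>(2) N_small by linarith
    then have "real Q \<le> 2 * real (card ?S)" using Q by (simp add: field_simps)
    moreover have "card ?S \<le> (\<Sum>B\<in>\<B>. card (S B))" by (rule card_UN_le[OF \<B>(2)])
    moreover have "(\<Sum>B\<in>\<B>. card (S B)) \<le> card \<B> * ((L * b) * (2 * 64 ^ l))"
      using sum_mono[OF card_S] by simp
    ultimately have "real Q \<le> 2 * real (card \<B> * ((L * b) * (2 * 64 ^ l)))" by linarith
    also have "real Q = real (L * b) * (64 ^ l * (4 ^ l * 2))"
    proof -
      have "(2 :: real) ^ Suc L = 256 ^ l * 2" by (simp add: L_def power_mult)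
      also have "\<dots> = (64 * 4) ^ l * 2" by simp
      also have "\<dots> = 64 ^ l * (4 ^ l * 2)" unfolding power_mult_distrib by simp
      finally show ?thesis by (simp add: Q_def)
    qed
    finally have "(real (L * b) * 64 ^ l) * (4 ^ l * 2) \<le> (real (L * b) * 64 ^ l) * (4 * real (card \<B>))"
      by (simp add: mult_ac)
    moreover have "0 < real (L * b) * 64 ^ l" using b l by (simp add: L_def)
    ultimately have "4 ^ l * 2 \<le> 4 * real (card \<B>)" by (simp only: mult_le_cancel_left_pos)
    then show "nat \<lceil>4 ^ l / 2 :: real\<rceil> \<le> card \<B>" by (simp add: nat_le_iff ceiling_le_iff)
  qed
  then show ?thesis unfolding n_def by linarith
qed

text \<open>The atoms are the level sets of \<open>P k\<close>. Pulled back by \<open>T\<close>, the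
  error of an atom splits into points of the level that miss the next level and points of other
  levels that land in it. Over all levels each kind adds up to at most the measure of the defect
  set, so the error is at most \<open>2 * e k\<close>.\<close>

lemma good_cyclic_approximationI:
  fixes M :: "'a measure" and P :: "nat \<Rightarrow> 'a \<Rightarrow> nat" and q :: "nat \<Rightarrow> nat" and e :: "nat \<Rightarrow> real"
  assumes M: "prob_space M" and T: "invertible_mpt M T"
    and q: "\<And>k. 0 < q k" "filterlim q at_top sequentially"
    and Pm: "\<And>k. P k \<in> M \<rightarrow>\<^sub>M count_space UNIV" and P: "\<And>k x. x \<in> space M \<Longrightarrow> P k x < q k"
    and unif: "\<And>k R. measure M {x \<in> space M. R (P k x)} = card {p. p < q k \<and> R p} / q k"
    and bad: "\<And>k. measure M {x \<in> space M. P k (T x) \<noteq> (P k x + 1) mod q k} \<le> e k"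
    and e: "(\<lambda>k. q k * e k) \<longlonglongrightarrow> 0"
    and approx: "\<And>A. A \<in> sets M \<Longrightarrow> \<exists>\<beta>. (\<forall>k. \<beta> k \<subseteq> {..<q k}) \<and>
      (\<lambda>k. measure M (sym_diff A {x \<in> space M. P k x \<in> \<beta> k})) \<longlonglongrightarrow> 0"
  shows "good_cyclic_approximation M T"
proof -
  interpret prob_space M by fact
  note [measurable] = Pm
  have Tb: "bij_betw T (space M) (space M)" and Tm [measurable]: "T \<in> M \<rightarrow>\<^sub>M M"
    and Ti: "inv_into (space M) T \<in> M \<rightarrow>\<^sub>M M" and Td: "distr M M T = M"
    using T by (auto simp: invertible_mpt_def)
  define c where "c k i = {x \<in> space M. P k x = i}" for k i
  define \<xi> where "\<xi> k = c k ` {..<q k}" for k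
  define \<sigma> where "\<sigma> k A = c k ((the_inv_into {..<q k} (c k) A + 1) mod q k)" for k A
  have cm [measurable]: "c k i \<in> sets M" for k i unfolding c_def by measurable
  have mc: "measure M (c k i) = 1 / q k" if "i < q k" for k i
  proof -
    have "{p. p < q k \<and> p = i} = {i}" using that by auto
    then show ?thesis using unif[of "\<lambda>p. p = i" k] by (simp add: c_def)
  qed
  have cne: "c k i \<noteq> {}" if "i < q k" for k i using mc[OF that] q(1)[of k] by auto
  have inj: "inj_on (c k) {..<q k}" for k
  proof (rule inj_onI)
    fix i j assume "i \<in> {..<q k}" "j \<in> {..<q k}" "c k i = c k j"
    then show "i = j" using cne[of i k] by (auto simp: c_def)
  qed
  have \<sigma>c: "\<sigma> k (c k i) = c k ((i + 1) mod q k)" if "i < q k" for k i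
    using that by (simp add: \<sigma>_def the_inv_into_f_f[OF inj])
  have card_\<xi>: "card (\<xi> k) = q k" for k by (simp add: \<xi>_def card_image[OF inj])
  have process: "cyclic_process M (\<xi> k) (\<sigma> k)" for k
    unfolding cyclic_process_def
  proof (intro conjI)
    show "finite (\<xi> k)" "\<xi> k \<subseteq> sets M" by (auto simp: \<xi>_def)
    show "partition_on (space M) (\<xi> k)"
      unfolding partition_on_def disjoint_def
      using P[of _ k] cne[of _ k] by (auto simp: \<xi>_def c_def)
    show "\<forall>A\<in>\<xi> k. \<forall>B\<in>\<xi> k. prob A = prob B" by (auto simp: \<xi>_def mc)
    show "\<exists>c. bij_betw c {1..card (\<xi> k)} (\<xi> k) \<and>
        (\<forall>i\<in>{1..<card (\<xi> k)}. \<sigma> k (c i) = c (Suc i)) \<and> \<sigma> k (c (card (\<xi> k))) = c 1"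
    \<comment> \<open>Levels count from 0, whereas the enumeration required by
      \<open>cyclic_process\<close> counts from 1.\<close>
    proof (intro exI[of _ "\<lambda>i. c k (i - 1)"] conjI ballI)
      have "bij_betw (\<lambda>i. i - 1) {1..card (\<xi> k)} {..<q k}"
        by (rule bij_betw_byWitness[where f' = Suc]) (auto simp: card_\<xi>)
      moreover have "bij_betw (c k) {..<q k} (\<xi> k)" by (simp add: bij_betw_def inj \<xi>_def)
      ultimately show "bij_betw (\<lambda>i. c k (i - 1)) {1..card (\<xi> k)} (\<xi> k)"
        using bij_betw_trans by (fastforce simp: o_def)
    next
      fix i assume "i \<in> {1..<card (\<xi> k)}"
      then have i: "i - 1 < q k" "(i - 1 + 1) mod q k = i" by (auto simp: card_\<xi>)
      show "\<sigma> k (c k (i - 1)) = c k (Suc i - 1)" unfolding \<sigma>c[OF i(1)] i(2) by simp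
    next
      show "\<sigma> k (c k (card (\<xi> k) - 1)) = c k (1 - 1)" using q(1)[of k] by (simp add: \<sigma>c card_\<xi>)
    qed
  qed
  have conv: "converges_to_points M \<xi>"
    unfolding converges_to_points_def
  proof
    fix A assume "A \<in> sets M"
    then obtain \<beta> where \<beta>: "\<And>k. \<beta> k \<subseteq> {..<q k}"
      "(\<lambda>k. measure M (sym_diff A {x \<in> space M. P k x \<in> \<beta> k})) \<longlonglongrightarrow> 0"
      using approx by blast
    have "\<Union> (c k ` \<beta> k) = {x \<in> space M. P k x \<in> \<beta> k}" for k by (auto simp: c_def)
    then show "\<exists>\<beta>. (\<forall>n. \<beta> n \<subseteq> \<xi> n) \<and> (\<lambda>n. measure M (sym_diff A (\<Union> (\<beta> n)))) \<longlonglongrightarrow> 0"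
      using \<beta> by (intro exI[of _ "\<lambda>k. c k ` \<beta> k"]) (simp add: \<xi>_def image_mono)
  qed
  have err: "approximation_error M T (\<xi> k) (\<sigma> k) \<le> 2 * e k" for k
  proof -
    define Bad where "Bad = {x \<in> space M. P k (T x) \<noteq> (P k x + 1) mod q k}"
    have Bad: "Bad \<in> sets M" unfolding Bad_def by (rule sets_shift_defect[OF Pm Tm])
    let ?s = "\<lambda>i. (i + 1) mod q k"
    define A where "A i = {x \<in> space M. P k x = i \<and> P k (T x) \<noteq> ?s i}" for i
    define B where "B i = {x \<in> space M. P k x \<noteq> i \<and> P k (T x) = ?s i}" for i
    have AB: "A i \<in> sets M" "B i \<in> sets M" for i unfolding A_def B_def by measurable
    have sinj: "i = j" if "i < q k" "j < q k" "?s i = ?s j" for i j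
      using that by (auto simp: mod_Suc split: if_splits)
    have summand: "measure M (sym_diff (T ` c k i) (\<sigma> k (c k i))) = measure M (A i) + measure M (B i)" if i: "i < q k" for i
    proof -
      let ?D = "sym_diff (T ` c k i) (c k (?s i))"
      have "T ` c k i = inv_into (space M) T -` c k i \<inter> space M"
      proof (intro equalityI subsetI)
        fix y assume "y \<in> T ` c k i"
        then obtain x where x: "x \<in> c k i" "y = T x" by blast
        then have "x \<in> space M" by (simp add: c_def)
        then show "y \<in> inv_into (space M) T -` c k i \<inter> space M"
          using x Tb bij_betw_inv_into_left[OF Tb] by (auto simp: bij_betw_def)
      next
        fix y assume y: "y \<in> inv_into (space M) T -` c k i \<inter> space M"
        then have "T (inv_into (space M) T y) = y" using bij_betw_inv_into_right[OF Tb] by simp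
        then show "y \<in> T ` c k i" using y by (metis IntD1 imageI vimage_eq)
      qed
      then have "T ` c k i \<in> sets M" using measurable_sets[OF Ti cm] by simp
      then have D: "?D \<in> sets M" by simp
      have Tsp: "x \<in> space M \<Longrightarrow> T x \<in> space M" for x by (rule measurable_space[OF Tm])
      have Tc: "T x \<in> T ` c k i \<longleftrightarrow> x \<in> c k i" if "x \<in> space M" for x
        using Tb that by (auto simp: c_def bij_betw_def inj_on_def)
      have "T -` ?D \<inter> space M = A i \<union> B i"
        using Tc Tsp by (auto simp: A_def B_def) (auto simp: c_def)
      then have "measure M ?D = measure M (A i \<union> B i)"
        using measure_distr[OF Tm D] by (simp add: Td)
      also have "\<dots> = measure M (A i) + measure M (B i)"
        using AB by (intro finite_measure_Union) (auto simp: A_def B_def)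
      finally show ?thesis by (simp only: \<sigma>c[OF i])
    qed
    have "approximation_error M T (\<xi> k) (\<sigma> k) = (\<Sum>i<q k. measure M (sym_diff (T ` c k i) (\<sigma> k (c k i))))"
      unfolding approximation_error_def \<xi>_def by (subst sum.reindex[OF inj]) (simp add: o_def)
    also have "\<dots> = (\<Sum>i<q k. measure M (A i)) + (\<Sum>i<q k. measure M (B i))"
      by (simp add: summand sum.distrib)
    finally have split: "approximation_error M T (\<xi> k) (\<sigma> k)
      = (\<Sum>i<q k. measure M (A i)) + (\<Sum>i<q k. measure M (B i))" .
    have "(\<Sum>i<q k. measure M (A i)) = measure M (\<Union>i<q k. A i)"
    proof (rule finite_measure_finite_Union[symmetric])
      show "disjoint_family_on A {..<q k}" by (auto simp: disjoint_family_on_def A_def)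
    qed (use AB in auto)
    also have "\<dots> \<le> measure M Bad"
      using Bad by (rule finite_measure_mono[rotated]) (auto simp: A_def Bad_def)
    finally have A_le: "(\<Sum>i<q k. measure M (A i)) \<le> measure M Bad" .
    have "(\<Sum>i<q k. measure M (B i)) = measure M (\<Union>i<q k. B i)"
    proof (rule finite_measure_finite_Union[symmetric])
      show "disjoint_family_on B {..<q k}"
        unfolding disjoint_family_on_def
      proof (intro ballI impI)
        fix i j assume "i \<in> {..<q k}" "j \<in> {..<q k}" "i \<noteq> j"
        then have "?s i \<noteq> ?s j" using sinj[of i j] by blast
        then show "B i \<inter> B j = {}" unfolding B_def by fastforce
      qed
    qed (use AB in auto)
    also have "\<dots> \<le> measure M Bad"
    proof (rule finite_measure_mono)
      show "(\<Union>i<q k. B i) \<subseteq> Bad"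
      proof
        fix x assume "x \<in> (\<Union>i<q k. B i)"
        then obtain i where i: "i < q k" "x \<in> space M" "P k x \<noteq> i" "P k (T x) = ?s i"
          unfolding B_def by blast
        then have "?s i \<noteq> ?s (P k x)" using sinj[of i "P k x"] P[of x k] by blast
        then show "x \<in> Bad" using i unfolding Bad_def by simp
      qed
    qed (rule Bad)
    finally have B_le: "(\<Sum>i<q k. measure M (B i)) \<le> measure M Bad" .
    show ?thesis using split A_le B_le bad[of k] unfolding Bad_def by linarith
  qed
  \<comment> \<open>The additional term makes the inequality for the speed strict even when
    \<open>e k = 0\<close>, and it is still \<open>o(1/q k)\<close>.\<close>
  define g where "g k = 2 * e k + 1 / (real (q k) * real (Suc k))" for k
  have e0: "0 \<le> e k" for k using bad[of k] measure_nonneg order_trans by blast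
  have go: "g \<in> o(\<lambda>n. 1 / real (card (\<xi> n)))"
  proof (rule smalloI_tendsto)
    have "g k / (1 / real (card (\<xi> k))) = 2 * (q k * e k) + 1 / real (Suc k)" for k
    proof -
      have "1 / (real (q k) * real (Suc k)) * real (q k) = 1 / real (Suc k)" using q(1)[of k] by simp
      then show ?thesis unfolding g_def card_\<xi> by (simp only: divide_divide_eq_right distrib_right) simp
    qed
    moreover have "(\<lambda>k. 2 * (q k * e k) + 1 / real (Suc k)) \<longlonglongrightarrow> 2 * 0 + 0"
      by (intro tendsto_intros e LIMSEQ_Suc[OF lim_1_over_n])
    ultimately show "(\<lambda>k. g k / (1 / real (card (\<xi> k)))) \<longlonglongrightarrow> 0" by simp
  qed (use q(1) in \<open>simp add: card_\<xi>\<close>)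
  have err_g: "approximation_error M T (\<xi> k) (\<sigma> k) < g k" for k
    using err[of k] q(1)[of k] by (simp add: g_def add_pos_pos order.strict_trans1)
  have "(\<lambda>k. e k) \<longlonglongrightarrow> 0"
  proof (rule tendsto_sandwich[OF _ _ tendsto_const e])
    have "1 * e k \<le> real (q k) * e k" for k
      using q(1)[of k] e0[of k] by (intro mult_right_mono) (simp_all add: Suc_le_eq)
    then show "\<forall>\<^sub>F k in sequentially. e k \<le> q k * e k" by simp
  qed (simp add: e0)
  then have e2: "(\<lambda>k. 2 * e k) \<longlonglongrightarrow> 0" using tendsto_mult_right_zero by blast
  have "(\<lambda>k. approximation_error M T (\<xi> k) (\<sigma> k)) \<longlonglongrightarrow> 0"
  proof (rule tendsto_sandwich[OF _ _ tendsto_const e2])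
    show "\<forall>\<^sub>F k in sequentially. 0 \<le> approximation_error M T (\<xi> k) (\<sigma> k)"
      by (simp add: approximation_error_def sum_nonneg)
  qed (simp add: err)
  then have "cyclic_approximation M T \<xi> \<sigma>"
    using process conv by (simp add: cyclic_approximation_def exhaustive_cyclic_processes_def)
  moreover have "has_speed M T \<xi> \<sigma> g"
    unfolding has_speed_def using err_g by (intro exI[of _ id]) (simp add: strict_mono_id)
  ultimately show ?thesis using go unfolding good_cyclic_approximation_def by blast
qed

section \<open>The tower of runs\<close>

lemma (in tower) borel_approx_by_positions:
  assumes "A \<in> sets borel"
  obtains \<beta> where "\<And>k. \<beta> k \<subseteq> {..<q k}"
    "(\<lambda>k. measure unit_lborel (sym_diff A {x. position k x \<in> \<beta> k})) \<longlonglongrightarrow> 0"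
proof -
  obtain \<beta> where \<beta>: "\<And>k. \<beta> k \<subseteq> {..<q k}"
    "(\<lambda>k. measure unit_lborel (sym_diff A {x. cell (q k) x \<in> \<beta> k})) \<longlonglongrightarrow> 0"
    by (rule borel_approx_by_cells[OF filterlim_q q_pos assms]) blast
  have "position k x \<in> pos k ` \<beta> k \<longleftrightarrow> cell (q k) x \<in> \<beta> k" for k x
  proof -
    have "inj_on (pos k) {..<q k}" using bij_pos by (simp add: bij_betw_def)
    moreover have "cell (q k) x \<in> {..<q k}" by (simp add: cell_less)
    ultimately show ?thesis unfolding position_def by (rule inj_on_image_mem_iff[OF _ _ \<beta>(1)])
  qed
  then have "(\<lambda>k. measure unit_lborel (sym_diff A {x. position k x \<in> pos k ` \<beta> k})) \<longlonglongrightarrow> 0"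
    using \<beta>(2) by simp
  moreover have "pos k ` \<beta> k \<subseteq> {..<q k}" for k using \<beta>(1)[of k] pos_less[of _ k] by auto
  ultimately show ?thesis by (intro that)
qed

text \<open>Factors from left to right: passes per run, runs per superblock, number of superblocks.
  The height of tower \<open>k\<close> depends only on \<open>l\<close> below \<open>k\<close>, so
  \<open>l k\<close> can be chosen in view of it. The growth of \<open>k + 30\<close> yields the
  small-o; the offset 30 keeps \<open>3 / (k + 31)\<close> below \<open>1 / 10\<close>.\<close>

primrec height :: "(nat \<Rightarrow> nat) \<Rightarrow> nat \<Rightarrow> nat" where
  "height l 0 = 2"
| "height l (Suc k) = height l k * ((k + 30) * (8 * l k * 2 ^ Suc (8 * l k)))"

locale phase_tower =
  fixes l :: "nat \<Rightarrow> nat"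
  assumes l_pos: "\<And>k. 0 < l k"
begin

definition blocks :: "nat \<Rightarrow> nat" where
  "blocks k = 8 * l k * 2 ^ Suc (8 * l k)"

text \<open>\<open>m div (k + 30)\<close> is the run that contains pass \<open>m\<close>: all passes
  of a run start at the same level, bottom or middle.\<close>

definition shift :: "nat \<Rightarrow> nat \<Rightarrow> nat" where
  "shift k m = (if phase (8 * l k) (m div (k + 30)) then height l k div 2 else 0)"

lemma height_Suc: "height l (Suc k) = height l k * ((k + 30) * blocks k)"
  by (simp add: blocks_def)

lemma blocks_pos [simp]: "0 < blocks k" using l_pos[of k] by (simp add: blocks_def)

lemma height_pos [simp]: "0 < height l k"
proof (induction k)
  case (Suc k) then show ?case unfolding height_Suc by simp
qed simp

sublocale tower "height l" "\<lambda>k. (k + 30) * blocks k" shift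
proof
  show "2 \<le> (k + 30) * blocks k" for k
    using mult_le_mono[of 2 "k + 30" 1 "blocks k"] blocks_pos[of k] by simp
  show "height l (Suc k) = height l k * ((k + 30) * blocks k)" for k by (rule height_Suc)
  show "shift k j < height l k" for k j using height_pos[of k] by (auto simp: shift_def)
qed simp

text \<open>The two-set partition of tower 0 seen from the levels of tower \<open>k\<close>.\<close>

primrec colour :: "nat \<Rightarrow> nat \<Rightarrow> bool" where
  "colour 0 p \<longleftrightarrow> p = 1"
| "colour (Suc k) p \<longleftrightarrow> colour k (down k p)"

text \<open>A run started at the middle is a half-turn of the other kind, so its colours are negated
  and the letter enters as an exclusive or. Antipodality of stage \<open>k\<close> is a hypothesis
  here because its induction step uses this formula.\<close>

lemma colour_Suc_if:
  assumes "\<And>p. p < height l k \<Longrightarrow> colour k ((p + height l k div 2) mod height l k) \<longleftrightarrow> \<not> colour k p"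
  shows "colour (Suc k) p \<longleftrightarrow>
    colour k (p mod ((k + 30) * height l k) mod height l k) \<noteq> phase (8 * l k) (p div ((k + 30) * height l k))"
proof -
  have "p div height l k div (k + 30) = p div ((k + 30) * height l k)"
    by (simp add: div_mult2_eq mult.commute flip: div_mult2_eq)
  moreover have "p mod ((k + 30) * height l k) mod height l k = p mod height l k"
    by (simp add: mod_mod_cancel)
  ultimately show ?thesis
    using assms[of "p mod height l k"] by (simp add: down_def shift_def)
qed

text \<open>A half-turn of tower \<open>k + 1\<close> advances by half of all runs and keeps the
  place inside the run, so exactly the letter is negated.\<close>

lemma colour_antipodal:
  "p < height l k \<Longrightarrow> colour k ((p + height l k div 2) mod height l k) \<longleftrightarrow> \<not> colour k p"
proof (induction k arbitrary: p)
  case 0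
  then have "p = 0 \<or> p = 1" by auto
  then show ?case by auto
next
  case (Suc k)
  define b where "b = (k + 30) * height l k"
  define L where "L = 8 * l k"
  have b: "0 < b" and L: "0 < L" using l_pos[of k] by (simp_all add: b_def L_def)
  have Q: "height l (Suc k) = b * (L * 2 ^ Suc L)" by (simp add: b_def L_def)
  then have half: "height l (Suc k) div 2 = b * (L * 2 ^ L)" by simp
  have colour: "colour (Suc k) p \<longleftrightarrow> colour k (p mod b mod height l k) \<noteq> phase L (p div b)" for p
    unfolding b_def L_def by (rule colour_Suc_if[OF Suc.IH])
  have p: "p div b < L * 2 ^ Suc L" using Suc.prems unfolding Q by (simp add: less_mult_imp_div_less mult.commute)
  have "(p + b * (L * 2 ^ L)) mod (b * (L * 2 ^ Suc L))
      = b * ((p div b + L * 2 ^ L) mod (L * 2 ^ Suc L)) + p mod b"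
    using b by (simp add: mod_mult2_eq add.commute del: power_Suc)
  then have dm: "(p + b * (L * 2 ^ L)) mod (b * (L * 2 ^ Suc L)) mod b = p mod b"
    "(p + b * (L * 2 ^ L)) mod (b * (L * 2 ^ Suc L)) div b = (p div b + L * 2 ^ L) mod (L * 2 ^ Suc L)"
    using b by (simp_all del: power_Suc)
  show ?case unfolding half unfolding Q colour dm phase_antipodal[OF L p] by blast
qed

lemma colour_Suc:
  "colour (Suc k) p \<longleftrightarrow>
    colour k (p mod ((k + 30) * height l k) mod height l k) \<noteq> phase (8 * l k) (p div ((k + 30) * height l k))"
  by (rule colour_Suc_if[OF colour_antipodal])

lemma colour_position: "colour k (position k x) \<longleftrightarrow> colour 0 (position 0 x)"
proof (induction k)
  case (Suc k)
  then show ?case using position_down[of k x] by simp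
qed simp

text \<open>A change needs the last pass of a run, and each run has only one.\<close>

lemma card_shift_changes:
  "card {j. j < (k + 30) * blocks k \<and> shift k j \<noteq> shift k ((j + 1) mod ((k + 30) * blocks k))} \<le> blocks k"
proof -
  let ?r = "k + 30" and ?N = "blocks k"
  let ?A = "{j. j < ?r * ?N \<and> shift k j \<noteq> shift k ((j + 1) mod (?r * ?N))}"
  have top: "j mod ?r = ?r - 1" if j: "j \<in> ?A" for j
  proof (rule ccontr)
    assume "j mod ?r \<noteq> ?r - 1"
    then have s: "j mod ?r + 1 < ?r" using mod_less_divisor[of ?r j] by linarith
    have "Suc j mod ?r \<noteq> 0" using s by (simp add: mod_Suc)
    then have "j + 1 \<noteq> ?r * ?N" by auto
    then have "(j + 1) mod (?r * ?N) = j + 1" using j by auto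
    moreover have "(j + 1) div ?r = j div ?r" using s by (simp add: div_Suc mod_Suc)
    ultimately show False using j by (simp add: shift_def)
  qed
  have "card ?A \<le> card {..<?N}"
  proof (rule card_inj_on_le[where f = "\<lambda>j. j div ?r"])
    show "inj_on (\<lambda>j. j div ?r) ?A"
    proof (rule inj_onI)
      fix x y assume "x \<in> ?A" "y \<in> ?A" and d: "x div ?r = y div ?r"
      then have "x mod ?r = y mod ?r" using top[of x] top[of y] by presburger
      then show "x = y" using d by (metis div_mult_mod_eq)
    qed
    show "(\<lambda>j. j div ?r) ` ?A \<subseteq> {..<?N}"
    proof (rule image_subsetI)
      fix j assume "j \<in> ?A"
      then have "j < ?N * ?r" by (simp add: mult.commute)
      then show "j div ?r \<in> {..<?N}" by (simp add: less_mult_imp_div_less)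
    qed
  qed simp
  then show ?thesis by simp
qed

text \<open>At most one change per run, while a run consists of \<open>k + 30\<close> passes: after
  multiplication by \<open>height l k\<close> the bound still tends to 0.\<close>

lemma defect_bound:
  "real (card {j. j < (k + 30) * blocks k \<and> shift k j \<noteq> shift k ((j + 1) mod ((k + 30) * blocks k))} + 2)
    / height l (Suc k) \<le> 3 / (real (height l k) * (real k + 30))"
proof -
  have "real (card {j. j < (k + 30) * blocks k \<and> shift k j \<noteq> shift k ((j + 1) mod ((k + 30) * blocks k))} + 2)
      \<le> 3 * real (blocks k)"
    using card_shift_changes[of k] blocks_pos[of k] by linarith
  then have "real (card {j. j < (k + 30) * blocks k \<and> shift k j \<noteq> shift k ((j + 1) mod ((k + 30) * blocks k))} + 2)
      / height l (Suc k) \<le> 3 * real (blocks k) / height l (Suc k)"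
    by (rule divide_right_mono) simp
  also have "\<dots> = 3 / (real (height l k) * (real k + 30))"
  proof -
    have "3 * x / (h * (r * x)) = 3 / (h * r)" if "0 < x" for x h r :: real using that by simp
    from this[of "real (blocks k)"] show ?thesis unfolding height_Suc by simp
  qed
  finally show ?thesis .
qed

end

section \<open>From Borel to Lebesgue measurable sets\<close>

context
  fixes X :: "(real \<times> real) set"
  assumes X: "X \<in> sets borel" "emeasure lborel X \<noteq> 0" "emeasure lborel X \<noteq> \<infinity>"
begin

lemma borel_uniform_simps:
  shows "space (borel_uniform X) = X"
    and "A \<in> sets (borel_uniform X) \<longleftrightarrow> A \<subseteq> X \<and> A \<in> sets borel"
    and "A \<subseteq> X \<Longrightarrow> A \<in> sets borel \<Longrightarrow> emeasure (borel_uniform X) A = emeasure lborel A / emeasure lborel X"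
proof -
  show "space (borel_uniform X) = X" by (simp add: borel_uniform_def space_restrict_space)
  show "A \<in> sets (borel_uniform X) \<longleftrightarrow> A \<subseteq> X \<and> A \<in> sets borel"
    using X(1) by (simp add: borel_uniform_def) (subst sets_restrict_space_iff, auto)
  assume A: "A \<subseteq> X" "A \<in> sets borel"
  have s: "A \<in> sets (restrict_space lborel X)" "X \<in> sets (restrict_space lborel X)"
    using A X(1) by (auto simp: sets_restrict_space_iff)
  have "X \<inter> A = A" using A by auto
  then show "emeasure (borel_uniform X) A = emeasure lborel A / emeasure lborel X"
    unfolding borel_uniform_def using A X(1) s by (simp add: emeasure_restrict_space)
qed

lemma normalized_lebesgue_simps:
  shows "space (normalized_lebesgue X) = X"
    and "A \<in> sets (normalized_lebesgue X) \<longleftrightarrow> A \<subseteq> X \<and> A \<in> sets lebesgue"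
    and "A \<subseteq> X \<Longrightarrow> A \<in> sets lebesgue \<Longrightarrow> emeasure (normalized_lebesgue X) A = emeasure lebesgue A / emeasure lborel X"
proof -
  have XL: "X \<in> sets lebesgue" using X(1) by simp
  show "space (normalized_lebesgue X) = X" by (simp add: normalized_lebesgue_def space_restrict_space)
  show "A \<in> sets (normalized_lebesgue X) \<longleftrightarrow> A \<subseteq> X \<and> A \<in> sets lebesgue"
    using XL by (simp add: normalized_lebesgue_def) (subst sets_restrict_space_iff, auto)
  assume A: "A \<subseteq> X" "A \<in> sets lebesgue"
  have s: "A \<in> sets (lebesgue_on X)" "X \<in> sets (lebesgue_on X)"
    using A XL by (auto simp: sets_restrict_space_iff)
  have "X \<inter> A = A" using A by auto
  then show "emeasure (normalized_lebesgue X) A = emeasure lebesgue A / emeasure lborel X"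
    unfolding normalized_lebesgue_def using A XL s X(1) by (simp add: emeasure_restrict_space)
qed

lemma prob_space_borel_uniform: "prob_space (borel_uniform X)"
proof (rule prob_spaceI)
  have "emeasure lborel X / emeasure lborel X = 1"
    using X(2,3) by (intro ennreal_divide_self) (auto simp: less_top)
  then show "emeasure (borel_uniform X) (space (borel_uniform X)) = 1"
    by (simp add: borel_uniform_simps X(1))
qed

lemma borel_sets_normalized_lebesgue:
  assumes "A \<in> sets (borel_uniform X)"
  shows "A \<in> sets (normalized_lebesgue X)" "emeasure (normalized_lebesgue X) A = emeasure (borel_uniform X) A"
    "measure (normalized_lebesgue X) A = measure (borel_uniform X) A"
  using assms by (simp_all add: borel_uniform_simps normalized_lebesgue_simps measure_def)

lemma prob_space_normalized_lebesgue: "prob_space (normalized_lebesgue X)"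
proof -
  interpret prob_space "borel_uniform X" by (rule prob_space_borel_uniform)
  show ?thesis
    using emeasure_space_1 borel_sets_normalized_lebesgue(2)[of X] X(1)
    by (intro prob_spaceI) (simp add: borel_uniform_simps normalized_lebesgue_simps)
qed

lemma normalized_lebesgue_sandwich:
  assumes "A \<in> sets (normalized_lebesgue X)"
  obtains B Z where "B \<in> sets (borel_uniform X)" "Z \<in> null_sets (borel_uniform X)" "B \<subseteq> A" "A \<subseteq> B \<union> Z"
proof -
  have A: "A \<subseteq> X" "A \<in> sets lebesgue" using assms by (simp_all add: normalized_lebesgue_simps)
  obtain S N N' where S: "A = S \<union> N" "N \<subseteq> N'" "N' \<in> null_sets lborel" "S \<in> sets lborel"
    using A(2) by (rule sets_completionE)
  have "S \<in> sets (borel_uniform X)" using S A by (auto simp: borel_uniform_simps)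
  moreover have "N' \<inter> X \<in> null_sets (borel_uniform X)"
  proof -
    have "emeasure lborel (N' \<inter> X) = 0" "N' \<inter> X \<in> sets borel"
      using S(3) X(1) null_set_Int2[of N' lborel X] by (auto simp: null_sets_def)
    then show ?thesis by (simp add: null_sets_def borel_uniform_simps)
  qed
  moreover have "S \<subseteq> A" "A \<subseteq> S \<union> (N' \<inter> X)" using S A by auto
  ultimately show ?thesis by (rule that)
qed

text \<open>Converse of the preceding lemma; together they let statements about Lebesgue sets be
  checked on a Borel set and a Borel null set.\<close>

lemma sandwich_normalized_lebesgue:
  assumes "B \<in> sets (borel_uniform X)" "Z \<in> null_sets (borel_uniform X)" "B \<subseteq> A" "A \<subseteq> B \<union> Z"
  shows "A \<in> sets (normalized_lebesgue X)" "emeasure (normalized_lebesgue X) A = emeasure (borel_uniform X) B"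
proof -
  have BZ: "B \<union> Z \<in> sets (borel_uniform X)" using assms by auto
  have "Z \<subseteq> X" "Z \<in> sets borel" "emeasure (borel_uniform X) Z = 0"
    using assms(2) by (auto simp: null_sets_def borel_uniform_simps)
  then have "emeasure lborel Z / emeasure lborel X = 0" by (simp add: borel_uniform_simps)
  then have "emeasure lborel Z = 0" using X(3) by (simp add: ennreal_divide_eq_0_iff)
  then have "Z \<in> null_sets lborel" using \<open>Z \<in> sets borel\<close> by (simp add: null_sets_def)
  moreover have "A = B \<union> (A - B)" "A - B \<subseteq> Z" using assms by auto
  ultimately have "A \<in> sets lebesgue"
    using assms(1) by (intro sets_completionI[of A B "A - B" Z]) (auto simp: borel_uniform_simps)
  moreover have "A \<subseteq> X" using assms BZ by (auto simp: borel_uniform_simps)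
  ultimately show As: "A \<in> sets (normalized_lebesgue X)" by (simp add: normalized_lebesgue_simps)
  have "emeasure (normalized_lebesgue X) A \<le> emeasure (normalized_lebesgue X) (B \<union> Z)"
    using assms borel_sets_normalized_lebesgue(1)[OF BZ] by (intro emeasure_mono) auto
  also have "\<dots> = emeasure (borel_uniform X) (B \<union> Z)" by (rule borel_sets_normalized_lebesgue(2)[OF BZ])
  also have "\<dots> = emeasure (borel_uniform X) B" by (rule emeasure_Un_null_set[OF assms(1,2)])
  finally have "emeasure (normalized_lebesgue X) A \<le> emeasure (borel_uniform X) B" .
  moreover have "emeasure (borel_uniform X) B \<le> emeasure (normalized_lebesgue X) A"
    unfolding borel_sets_normalized_lebesgue(2)[OF assms(1), symmetric]
    using assms As by (intro emeasure_mono) auto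
  ultimately show "emeasure (normalized_lebesgue X) A = emeasure (borel_uniform X) B" by (rule antisym)
qed

text \<open>A Borel map need not be measurable for the Lebesgue sets. It is here because
  preservation of the measure makes preimages of null sets null, so a sandwich pulls back to a
  sandwich.\<close>

lemma mp_map_normalized_lebesgue:
  assumes f: "f \<in> borel_uniform X \<rightarrow>\<^sub>M borel_uniform X" "distr (borel_uniform X) (borel_uniform X) f = borel_uniform X"
  shows "f \<in> normalized_lebesgue X \<rightarrow>\<^sub>M normalized_lebesgue X"
    and "distr (normalized_lebesgue X) (normalized_lebesgue X) f = normalized_lebesgue X"
proof -
  let ?M = "borel_uniform X" and ?N = "normalized_lebesgue X"
  have sp: "space ?M = X" "space ?N = X" by (simp_all add: borel_uniform_simps normalized_lebesgue_simps)
  have pre: "f -` A \<inter> X \<in> sets ?N \<and> emeasure ?N (f -` A \<inter> X) = emeasure ?N A" if A: "A \<in> sets ?N" for A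
  proof -
    obtain B Z where BZ: "B \<in> sets ?M" "Z \<in> null_sets ?M" "B \<subseteq> A" "A \<subseteq> B \<union> Z"
      by (rule normalized_lebesgue_sandwich[OF A])
    have eq: "emeasure ?M (f -` C \<inter> X) = emeasure ?M C" if "C \<in> sets ?M" for C
      using emeasure_distr[OF f(1) that] by (simp add: f(2) sp)
    have m: "f -` C \<inter> X \<in> sets ?M" if "C \<in> sets ?M" for C
      using measurable_sets[OF f(1) that] by (simp add: sp)
    have fB: "f -` B \<inter> X \<in> sets ?M" "f -` Z \<inter> X \<in> null_sets ?M"
      using BZ m eq by (auto simp: null_sets_def)
    have "f -` B \<inter> X \<subseteq> f -` A \<inter> X" "f -` A \<inter> X \<subseteq> (f -` B \<inter> X) \<union> (f -` Z \<inter> X)" using BZ by auto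
    from sandwich_normalized_lebesgue[OF fB this] sandwich_normalized_lebesgue[OF BZ] eq[OF BZ(1)]
    show ?thesis by simp
  qed
  show fm: "f \<in> ?N \<rightarrow>\<^sub>M ?N"
    using measurable_space[OF f(1)] pre by (intro measurableI) (auto simp: sp)
  show "distr ?N ?N f = ?N"
    by (rule measure_eqI) (use pre in \<open>simp_all add: emeasure_distr[OF fm] sp\<close>)
qed

lemma invertible_mpt_normalized_lebesgue:
  assumes "invertible_mpt (borel_uniform X) T"
  shows "invertible_mpt (normalized_lebesgue X) T"
proof -
  let ?M = "borel_uniform X" and ?N = "normalized_lebesgue X"
  have sp: "space ?M = X" "space ?N = X" by (simp_all add: borel_uniform_simps normalized_lebesgue_simps)
  have T: "bij_betw T X X" "T \<in> ?M \<rightarrow>\<^sub>M ?M" "inv_into X T \<in> ?M \<rightarrow>\<^sub>M ?M" "distr ?M ?M T = ?M"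
    using assms by (simp_all add: invertible_mpt_def sp)
  have "mod0_iso ?M ?M T (inv_into X T)"
    using T bij_betw_inv_into_left[OF T(1)] bij_betw_inv_into_right[OF T(1)]
    by (intro mod0_isoI AE_I2) (simp_all add: sp)
  from mod0_isoD(4)[OF this] show ?thesis
    using T mp_map_normalized_lebesgue[OF T(2,4)] mp_map_normalized_lebesgue(1)[OF T(3)]
    by (simp add: invertible_mpt_def sp)
qed

end

section \<open>Realization of slow entropy\<close>

text \<open>With \<open>c\<close> fixed, the growth rate of \<open>a n t\<close> eventually drops
  below \<open>ln 2 / c\<close>, and then \<open>a (c * l) t < 2 ^ l\<close>.\<close>

lemma subexponential_scale:
  fixes a :: "nat \<Rightarrow> real \<Rightarrow> real" and c :: nat
  assumes "scaling_function a" "0 < t" "(\<lambda>n. ln (a n t) / real n) \<longlonglongrightarrow> 0" "0 < c"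
  obtains l where "0 < l" "a (c * l) t \<le> 4 ^ l / 2"
proof -
  have "0 < ln 2 / real c" using assms(4) by (intro divide_pos_pos) simp_all
  then have "eventually (\<lambda>n. ln (a n t) / real n < ln 2 / c) sequentially"
    by (rule order_tendstoD(2)[OF assms(3)])
  then obtain n0 where n0: "\<And>n. n \<ge> n0 \<Longrightarrow> ln (a n t) / real n < ln 2 / c"
    by (auto simp: eventually_sequentially)
  define l where "l = Suc n0"
  have l: "0 < l" "n0 \<le> c * l" using assms(4) mult_le_mono1[of 1 c l] by (simp_all add: l_def)
  have pos: "0 < a (c * l) t" using assms(1,2) by (simp add: scaling_function_def)
  have "ln (a (c * l) t) < ln 2 / c * real (c * l)"
    using n0[OF l(2)] l(1) assms(4) by (simp add: pos_divide_less_eq)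
  also have "\<dots> = ln (2 ^ l)" using assms(4) by (simp add: ln_realpow)
  finally have "a (c * l) t < 2 ^ l" using pos by simp
  also have "(2::real) ^ l \<le> 4 ^ l / 2"
  proof -
    have "(2::real) ^ 1 \<le> 2 ^ l" using l(1) by (intro power_increasing) simp_all
    then have "2 ^ l * 2 \<le> 2 ^ l * (2::real) ^ l" by (intro mult_left_mono) simp_all
    also have "\<dots> = 4 ^ l" by (simp flip: power_mult_distrib)
    finally show ?thesis by simp
  qed
  finally show ?thesis using that l(1) by simp
qed

text \<open>The choice of \<open>l k\<close> refers to the height of tower \<open>k\<close>, hence
  to the earlier choices; so the pairs of height and length are obtained by dependent choice. Using
  the parameter \<open>k + 1\<close> at stage \<open>k\<close> will cover every fixed
  \<open>t\<close>, by monotonicity in \<open>t\<close>.\<close>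

lemma block_lengths_exist:
  fixes a :: "nat \<Rightarrow> real \<Rightarrow> real"
  assumes "scaling_function a" "\<And>t. 0 < t \<Longrightarrow> (\<lambda>n. ln (a n t) / real n) \<longlonglongrightarrow> 0"
  obtains l where "\<And>k. 0 < l k"
    "\<And>k. a (2 * (8 * l k) * ((k + 30) * height l k)) (real (k + 1)) \<le> 4 ^ l k / 2"
proof -
  let ?P = "\<lambda>k (q, l). 0 < q \<and> 0 < l \<and> (k = 0 \<longrightarrow> q = 2) \<and>
    a (2 * (8 * l) * ((k + 30) * q)) (real (k + 1)) \<le> 4 ^ l / 2"
  let ?Q = "\<lambda>k (q :: nat, l :: nat) (q', l' :: nat). q' = q * ((k + 30) * (8 * l * 2 ^ Suc (8 * l)))"
  have ex: "\<exists>l>0. a (2 * (8 * l) * ((k + 30) * q)) (real (k + 1)) \<le> 4 ^ l / 2" if "0 < q" for q k :: nat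
  proof -
    have t: "0 < real (k + 1)" and c: "0 < 16 * ((k + 30) * q)" using that by simp_all
    obtain l where "0 < l" "a (16 * ((k + 30) * q) * l) (real (k + 1)) \<le> 4 ^ l / 2"
      using subexponential_scale[OF assms(1) t assms(2)[OF t] c] by blast
    then show ?thesis by (intro exI[of _ l]) (simp add: mult_ac)
  qed
  have "\<exists>f. \<forall>k. ?P k (f k) \<and> ?Q k (f k) (f (Suc k))"
  proof (rule dependent_nat_choice)
    obtain l where l: "0 < l" "a (2 * (8 * l) * ((0 + 30) * 2)) (real (0 + 1)) \<le> 4 ^ l / 2"
      using ex[of 2 0] by auto
    show "\<exists>x. ?P 0 x"
      by (rule exI[of _ "(2, l)"]) (simp only: split, use l in simp)
  next
    fix x k assume "?P k x"
    then obtain q l where x: "x = (q, l)" "0 < q" "0 < l" by (cases x) auto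
    define q' where "q' = q * ((k + 30) * (8 * l * 2 ^ Suc (8 * l)))"
    have "0 < q'" using x by (simp add: q'_def)
    from ex[OF this, of "Suc k"] obtain l' where l': "0 < l'"
      "a (2 * (8 * l') * ((Suc k + 30) * q')) (real (Suc k + 1)) \<le> 4 ^ l' / 2" by blast
    show "\<exists>y. ?P (Suc k) y \<and> ?Q k x y" unfolding x(1)
      by (rule exI[of _ "(q', l')"]) (use l' \<open>0 < q'\<close> in \<open>simp only: split q'_def[symmetric] nat.distinct simp_thms\<close>)
  qed
  then obtain f where "\<forall>k. ?P k (f k) \<and> ?Q k (f k) (f (Suc k))" ..
  then have f: "?P k (f k)" "?Q k (f k) (f (Suc k))" for k by (simp_all only:)
  define l where "l k = snd (f k)" for k
  have h: "height l k = fst (f k)" for k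
  proof (induction k)
    case 0 show ?case using f(1)[of 0] by (simp add: case_prod_beta)
  next
    case (Suc k) then show ?case using f(2)[of k] by (simp add: case_prod_beta l_def)
  qed
  show ?thesis
  proof (rule that[of l])
    show "0 < l k" for k using f(1)[of k] by (simp add: case_prod_beta l_def)
    show "a (2 * (8 * l k) * ((k + 30) * height l k)) (real (k + 1)) \<le> 4 ^ l k / 2" for k
      using f(1)[of k] by (simp only: case_prod_beta h) (simp only: l_def)
  qed
qed

text \<open>For fixed \<open>t\<close> all stages with \<open>t < k + 1\<close> have ratio at least
  1 at time \<open>n k\<close>, and these times are unbounded. Hence the limsup is positive for
  every \<open>t\<close>, and the supremum is infinite for all small
  \<open>\<epsilon>\<close>.\<close>

lemma upper_slow_entropy_infinite:
  assumes a: "scaling_function a" and P: "measurable_partition M m P" and "0 < \<epsilon>0"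
    and c: "\<And>\<epsilon> k. 0 < \<epsilon> \<Longrightarrow> \<epsilon> \<le> \<epsilon>0 \<Longrightarrow> a (n k) (real (k + 1)) \<le> real (covering_number M m P T (n k) \<epsilon>)"
    and n: "\<And>k. k \<le> n k"
  shows "upper_slow_entropy a M T = \<infinity>"
proof -
  have set: "entropy_set a M T m P \<epsilon> = {0<..}" if \<epsilon>: "0 < \<epsilon>" "\<epsilon> \<le> \<epsilon>0" for \<epsilon>
  proof -
    have "0 < limsup (\<lambda>n. ereal (real (covering_number M m P T n \<epsilon>) / a n t))" if t: "0 < t" for t
    proof -
      have "1 \<le> limsup (\<lambda>n. ereal (real (covering_number M m P T n \<epsilon>) / a n t))"
        unfolding limsup_INF_SUP
      proof (rule INF_greatest)
        fix n0 :: nat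
        define k where "k = max n0 (nat \<lceil>t\<rceil>)"
        have "t < real (k + 1)" unfolding k_def by linarith
        then have "a (n k) t \<le> a (n k) (real (k + 1))" using a t by (auto simp: scaling_function_def)
        also have "\<dots> \<le> real (covering_number M m P T (n k) \<epsilon>)" by (rule c[OF \<epsilon>])
        finally have "1 \<le> real (covering_number M m P T (n k) \<epsilon>) / a (n k) t"
          using a t by (simp add: scaling_function_def)
        moreover have "n0 \<le> n k" using n[of k] by (simp add: k_def)
        ultimately show "1 \<le> (SUP n\<in>{n0..}. ereal (real (covering_number M m P T n \<epsilon>) / a n t))"
          by (intro SUP_upper2[of "n k"]) (simp_all add: one_ereal_def)
      qed
      then show ?thesis using less_le_trans[of 0 "1::ereal"] by simp
    qed
    then show ?thesis by (auto simp: entropy_set_def)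
  qed
  have at: "entropy_at a M T m P \<epsilon> = \<infinity>" if \<epsilon>: "0 < \<epsilon>" "\<epsilon> \<le> \<epsilon>0" for \<epsilon>
  proof -
    have "(SUP t\<in>{0<..}. ereal t) = \<infinity>"
    proof (rule SUP_PInfty)
      fix k :: nat
      show "\<exists>t\<in>{0<..}. ereal (real k) \<le> ereal t" by (intro bexI[of _ "real k + 1"]) auto
    qed
    moreover have "{0<..} \<noteq> ({} :: real set)" by (auto intro: exI[of _ 1])
    ultimately show ?thesis by (simp add: entropy_at_def set[OF \<epsilon>])
  qed
  have "Lim (at_right 0) (\<lambda>\<epsilon>. entropy_at a M T m P \<epsilon>) = \<infinity>"
  proof (rule tendsto_Lim)
    have "eventually (\<lambda>\<epsilon>. entropy_at a M T m P \<epsilon> = \<infinity>) (at_right 0)"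
      unfolding eventually_at_right_field using \<open>0 < \<epsilon>0\<close> at by (intro exI[of _ \<epsilon>0]) auto
    then show "((\<lambda>\<epsilon>. entropy_at a M T m P \<epsilon>) \<longlongrightarrow> \<infinity>) (at_right 0)" by (rule tendsto_eventually)
  qed simp
  then have "\<infinity> \<le> upper_slow_entropy a M T"
    unfolding upper_slow_entropy_def using P by (intro SUP_upper2[of "(m, P)"]) auto
  then show ?thesis by simp
qed

lemma slow_entropy_realization:
  fixes a :: "nat \<Rightarrow> real \<Rightarrow> real" and X :: "(real \<times> real) set"
  assumes a: "scaling_function a" "\<And>t. 0 < t \<Longrightarrow> (\<lambda>n. ln (a n t) / real n) \<longlonglongrightarrow> 0"
    and X: "X \<in> sets borel" "emeasure lborel X \<noteq> 0" "emeasure lborel X \<noteq> \<infinity>"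
  obtains T where "invertible_mpt (normalized_lebesgue X) T"
    "good_cyclic_approximation (normalized_lebesgue X) T"
    "upper_slow_entropy a (normalized_lebesgue X) T = \<infinity>"
proof -
  obtain l where l: "\<And>k. 0 < l k"
    "\<And>k. a (2 * (8 * l k) * ((k + 30) * height l k)) (real (k + 1)) \<le> 4 ^ l k / 2"
    using block_lengths_exist[OF a] by blast
  interpret phase_tower l by unfold_locales (rule l(1))
  let ?M = "borel_uniform X" and ?N = "normalized_lebesgue X"
  define q where "q = height l"
  have q_pos': "0 < q k" for k by (simp add: q_def)
  have sp: "space ?M = X" "space ?N = X"
    by (rule borel_uniform_simps[OF X], rule normalized_lebesgue_simps[OF X])
  interpret M: prob_space ?M by (rule prob_space_borel_uniform[OF X])
  note MN = borel_sets_normalized_lebesgue[OF X]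
  obtain u v where uv: "mod0_iso ?M unit_lborel u v" by (rule mod0_iso_borel_uniform[OF X])
  define e where "e k = 3 / (real (q k) * (real k + 30))" for k
  have "\<exists>U V. mod0_iso unit_lborel unit_lborel U V \<and>
    (\<forall>k. measure unit_lborel {x. position k (U x) \<noteq> (position k x + 1) mod q k}
      \<le> (card {j. j < (k + 30) * blocks k \<and> shift k j \<noteq> shift k ((j + 1) mod ((k + 30) * blocks k))} + 2)
        / height l (Suc k))"
    unfolding q_def by (rule tower_limit) blast
  then obtain U V where UV: "mod0_iso unit_lborel unit_lborel U V"
    and U': "\<And>k. measure unit_lborel {x. position k (U x) \<noteq> (position k x + 1) mod q k}
      \<le> (card {j. j < (k + 30) * blocks k \<and> shift k j \<noteq> shift k ((j + 1) mod ((k + 30) * blocks k))} + 2)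
        / height l (Suc k)"
    by blast
  have U: "measure unit_lborel {x. position k (U x) \<noteq> (position k x + 1) mod q k} \<le> e k" for k
    using order_trans[OF U' defect_bound] by (simp only: e_def q_def)
  \<comment> \<open>The limit map of the interval, conjugated by the isomorphism.\<close>
  have W: "mod0_iso ?M ?M (\<lambda>x. v (U (u x))) (\<lambda>x. v (V (u x)))"
    by (rule mod0_iso_comp[OF mod0_iso_comp[OF uv UV] mod0_iso_sym[OF uv]])
  obtain T where T: "invertible_mpt ?M T" and TW: "AE x in ?M. T x = v (U (u x))"
    by (rule invertible_mpt_of_mod0_iso[OF W])
  have TN: "invertible_mpt ?N T" by (rule invertible_mpt_normalized_lebesgue[OF X T])
  have Tm [measurable]: "T \<in> ?M \<rightarrow>\<^sub>M ?M" using T by (simp add: invertible_mpt_def)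
  note um [measurable] = mod0_isoD(1)[OF uv] and Um [measurable] = mod0_isoD(1)[OF UV]
  define P where "P k x = position k (u x)" for k x
  have posm: "position k \<in> unit_lborel \<rightarrow>\<^sub>M count_space UNIV" for k by measurable
  have PM [measurable]: "P k \<in> ?M \<rightarrow>\<^sub>M count_space UNIV" for k
    unfolding P_def[abs_def] by (rule measurable_compose[OF um posm])
  have PN: "P k \<in> ?N \<rightarrow>\<^sub>M count_space UNIV" for k
  proof (rule measurableI)
    fix A :: "nat set"
    have "P k -` A \<inter> space ?M \<in> sets ?M" by (rule measurable_sets[OF PM]) simp
    then show "P k -` A \<inter> space ?N \<in> sets ?N" unfolding sp by (rule MN(1))
  qed simp
  have P_less: "P k x < q k" for k x by (simp add: P_def q_def position_less)
  have PS: "{x \<in> X. R (P k x)} \<in> sets ?M" for R k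
  proof -
    have "P k -` {p. R p} \<inter> space ?M \<in> sets ?M" by (rule measurable_sets[OF PM]) simp
    then show ?thesis by (simp add: sp vimage_def Int_def conj_commute)
  qed
  have pull: "measure ?M {x \<in> X. x' (u x)} = measure unit_lborel {y. x' y}"
    if "{y. x' y} \<in> sets borel" for x'
  proof -
    have "measure (distr ?M unit_lborel u) {y. x' y} = measure ?M (u -` {y. x' y} \<inter> space ?M)"
      by (rule measure_distr[OF um]) (use that in simp)
    then show ?thesis unfolding mod0_isoD(3)[OF uv] sp by (simp add: vimage_def Int_def conj_commute)
  qed
  have posS: "{y. R (position k y)} \<in> sets borel" for R k
  proof -
    have "position k -` {p. R p} \<inter> space unit_lborel \<in> sets unit_lborel"
      by (rule measurable_sets[OF posm]) simp
    then show ?thesis by (simp add: vimage_def)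
  qed
  have unif: "measure ?N {x \<in> space ?N. R (P k x)} = card {p. p < q k \<and> R p} / q k" for R k
    unfolding sp MN(3)[OF PS] unfolding P_def pull[OF posS] q_def by (rule measure_position)
  have bad: "measure ?N {x \<in> space ?N. P k (T x) \<noteq> (P k x + 1) mod q k} \<le> e k" for k
  proof -
    have Tu: "AE x in ?M. u (T x) = U (u x)"
    proof -
      have "AE y in unit_lborel. u (v (U y)) = U y"
        using AE_mp_map[OF mod0_isoD(1,3)[OF UV] mod0_isoD(6)[OF uv]] .
      then have "AE x in ?M. u (v (U (u x))) = U (u x)"
        by (rule AE_mp_map[OF mod0_isoD(1,3)[OF uv]])
      then show ?thesis using TW by eventually_elim simp
    qed
    have m1: "{x \<in> space ?M. P k (T x) \<noteq> (P k x + 1) mod q k} \<in> sets ?M"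
      by (rule sets_shift_defect[OF PM Tm])
    have m2: "{y \<in> space unit_lborel. position k (U y) \<noteq> (position k y + 1) mod q k} \<in> sets unit_lborel"
      by (rule sets_shift_defect[OF posm Um])
    then have m2': "{y. position k (U y) \<noteq> (position k y + 1) mod q k} \<in> sets borel" by simp
    have m3: "{x \<in> X. position k (U (u x)) \<noteq> (position k (u x) + 1) mod q k} \<in> sets ?M"
      using measurable_sets[OF um m2] by (simp add: sp vimage_def Int_def conj_commute)
    have "measure ?N {x \<in> space ?N. P k (T x) \<noteq> (P k x + 1) mod q k}
        = measure ?M {x \<in> X. P k (T x) \<noteq> (P k x + 1) mod q k}"
      using MN(3)[OF m1] by (simp add: sp)
    also have "\<dots> = measure ?M {x \<in> X. position k (U (u x)) \<noteq> (position k (u x) + 1) mod q k}"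
      using m1 m3 Tu by (intro M.finite_measure_eq_AE) (auto simp: sp P_def elim!: eventually_mono)
    also have "\<dots> = measure unit_lborel {y. position k (U y) \<noteq> (position k y + 1) mod q k}"
      by (rule pull[OF m2'])
    also have "\<dots> \<le> e k" by (rule U)
    finally show ?thesis .
  qed
  have qe: "real (q k) * e k = 3 / (real k + 30)" for k using q_pos'[of k] by (simp add: e_def)
  have "good_cyclic_approximation ?N T"
  proof (rule good_cyclic_approximationI[OF prob_space_normalized_lebesgue[OF X] TN q_pos' _ PN P_less unif bad])
    show "filterlim q at_top sequentially" unfolding q_def by (rule filterlim_q)
    have "(\<lambda>k. 3 / (real k + 30)) \<longlonglongrightarrow> 0" by real_asymp
    then show "(\<lambda>k. real (q k) * e k) \<longlonglongrightarrow> 0" by (simp only: qe)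
  next
    fix A assume "A \<in> sets ?N"
    then obtain B Z where BZ: "B \<in> sets ?M" "Z \<in> null_sets ?M" "B \<subseteq> A" "A \<subseteq> B \<union> Z"
      by (rule normalized_lebesgue_sandwich[OF X])
    have vm: "v \<in> unit_lborel \<rightarrow>\<^sub>M ?M" by (rule mod0_isoD(2)[OF uv])
    have vB: "v -` B \<in> sets borel" using measurable_sets[OF vm BZ(1)] by simp
    obtain \<beta> where \<beta>: "\<And>k. \<beta> k \<subseteq> {..<q k}"
      "(\<lambda>k. measure unit_lborel (sym_diff (v -` B) {x. position k x \<in> \<beta> k})) \<longlonglongrightarrow> 0"
      unfolding q_def by (rule borel_approx_by_positions[OF vB]) blast
    have eq: "measure ?N (sym_diff A {x \<in> space ?N. P k x \<in> \<beta> k})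
        = measure unit_lborel (sym_diff (v -` B) {x. position k x \<in> \<beta> k})" for k
    proof -
      let ?D = "{x \<in> X. P k x \<in> \<beta> k}" and ?E = "sym_diff (v -` B) {y. position k y \<in> \<beta> k}"
      have D: "?D \<in> sets ?M" by (rule PS)
      have E: "?E \<in> sets borel" using vB posS[of "\<lambda>p. p \<in> \<beta> k" k] by auto
      have "measure ?N (sym_diff A ?D) = measure ?M (sym_diff B ?D)"
      proof -
        have 1: "sym_diff B ?D - Z \<in> sets ?M" using BZ D by auto
        have "sym_diff B ?D - Z \<subseteq> sym_diff A ?D" "sym_diff A ?D \<subseteq> (sym_diff B ?D - Z) \<union> Z"
          using BZ by auto
        from sandwich_normalized_lebesgue(2)[OF X 1 BZ(2) this]
        have "measure ?N (sym_diff A ?D) = measure ?M (sym_diff B ?D - Z)" by (simp add: measure_def)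
        also have "\<dots> = measure ?M (sym_diff B ?D)"
          using BZ D by (intro measure_Diff_null_set) auto
        finally show ?thesis .
      qed
      also have "\<dots> = measure ?M {x \<in> X. u x \<in> ?E}"
      proof (rule M.finite_measure_eq_AE)
        show "AE x in ?M. x \<in> sym_diff B ?D \<longleftrightarrow> x \<in> {x \<in> X. u x \<in> ?E}"
          using mod0_isoD(5)[OF uv] AE_space by eventually_elim (auto simp: sp P_def)
        show "sym_diff B ?D \<in> sets ?M" using BZ D by auto
        show "{x \<in> X. u x \<in> ?E} \<in> sets ?M"
          using measurable_sets[OF um, of ?E] E by (simp add: sp vimage_def Int_def conj_commute)
      qed
      also have "\<dots> = measure unit_lborel {y. y \<in> ?E}"
        by (rule pull) (simp only: Collect_mem_eq E)
      finally show ?thesis by (simp only: sp Collect_mem_eq)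
    qed
    show "\<exists>\<beta>. (\<forall>k. \<beta> k \<subseteq> {..<q k}) \<and>
        (\<lambda>k. measure ?N (sym_diff A {x \<in> space ?N. P k x \<in> \<beta> k})) \<longlonglongrightarrow> 0"
      using \<beta> by (intro exI[of _ \<beta>]) (simp only: eq, blast)
  qed
  moreover have "upper_slow_entropy a ?N T = \<infinity>"
  proof -
    define Pt where "Pt i = (if i = 1 then {x \<in> X. colour 0 (P 0 x)} else {x \<in> X. \<not> colour 0 (P 0 x)})" for i :: nat
    have PtN: "Pt i \<in> sets ?N" for i
      unfolding Pt_def using MN(1)[OF PS] by simp
    have "{1..2::nat} = {1, 2}" by auto
    then have part: "measurable_partition ?N 2 Pt"
      using PtN by (auto simp: measurable_partition_def disjoint_family_on_def Pt_def sp)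
    have colour_P: "colour k (P k x) \<longleftrightarrow> colour 0 (P 0 x)" for k x unfolding P_def by (rule colour_position)
    show ?thesis
    proof (rule upper_slow_entropy_infinite[OF a(1) part])
      show "0 < (1 / 32 :: real)" by simp
      show "k \<le> 2 * (8 * l k) * ((k + 30) * q k)" for k
      proof -
        have "k * 1 \<le> (k + 30) * q k" using q_pos'[of k] by (intro mult_le_mono) (simp_all add: Suc_le_eq)
        also have "\<dots> \<le> 2 * (8 * l k) * ((k + 30) * q k)" using l(1)[of k] by simp
        finally show ?thesis by simp
      qed
      fix \<epsilon> :: real and k assume \<epsilon>: "0 < \<epsilon>" "\<epsilon> \<le> 1 / 32"
      have Q: "q (Suc k) = (k + 30) * q k * (8 * l k * 2 ^ Suc (8 * l k))" by (simp add: q_def)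
      have b: "0 < (k + 30) * q k" using q_pos'[of k] by simp
      have "a (2 * (8 * l k) * ((k + 30) * q k)) (real (k + 1)) \<le> 4 ^ l k / 2"
        unfolding q_def by (rule l(2))
      also have "\<dots> \<le> real (covering_number ?N 2 Pt T (2 * (8 * l k) * ((k + 30) * q k)) \<epsilon>)"
      proof (rule covering_number_lower_bound[OF prob_space_normalized_lebesgue[OF X] _ _ b l(1)[of k] PN[of "Suc k"],
            where w = "colour (Suc k)" and g = "\<lambda>j. colour k (j mod q k)", folded Q])
        show "T \<in> ?N \<rightarrow>\<^sub>M ?N" "distr ?N ?N T = ?N" using TN by (simp_all add: invertible_mpt_def)
        show "P (Suc k) x < q (Suc k)" for x by (rule P_less)
        show "measure ?N {x \<in> space ?N. R (P (Suc k) x)} = card {p. p < q (Suc k) \<and> R p} / q (Suc k)" for R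
          by (rule unif)
        show "colour (Suc k) p \<longleftrightarrow> colour k (p mod ((k + 30) * q k) mod q k)
            \<noteq> phase (8 * l k) (p div ((k + 30) * q k))" for p
          unfolding q_def by (rule colour_Suc)
        show "x \<in> Pt 1 \<longleftrightarrow> colour (Suc k) (P (Suc k) x)" "x \<in> Pt 2 \<longleftrightarrow> \<not> colour (Suc k) (P (Suc k) x)"
          if "x \<in> space ?N" for x
          using that by (simp_all add: Pt_def sp colour_P[of "Suc k"] del: colour.simps)
        \<comment> \<open>The observation time is two superblocks, and the tower contains at least
          two.\<close>
        have n_le: "2 * (8 * l k) * ((k + 30) * q k) \<le> q (Suc k)"
        proof -
          have "(2::nat) \<le> 2 ^ Suc (8 * l k)" by simp
          then have "(k + 30) * q k * (8 * l k * 2) \<le> q (Suc k)"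
            unfolding Q by (intro mult_le_mono le_refl)
          then show ?thesis by (simp add: mult_ac)
        qed
        have "real (2 * (8 * l k) * ((k + 30) * q k)) * measure ?N {x \<in> space ?N. P (Suc k) (T x) \<noteq> (P (Suc k) x + 1) mod q (Suc k)}
            \<le> real (q (Suc k)) * e (Suc k)"
          by (rule mult_mono[OF of_nat_mono[OF n_le] bad]) simp_all
        \<comment> \<open>The middle term is \<open>3 / (k + 31)\<close>, and
          \<open>3 / 31 \<le> 1 / 10\<close> settles the worst case \<open>k = 0\<close>.\<close>
        also have "\<dots> \<le> 1 / 10" unfolding qe by (simp add: field_simps)
        finally show "real (2 * (8 * l k) * ((k + 30) * q k)) * measure ?N {x \<in> space ?N. P (Suc k) (T x) \<noteq> (P (Suc k) x + 1) mod q (Suc k)} \<le> 1 / 10" .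
      qed (use \<epsilon> in simp_all)
      finally show "a (2 * (8 * l k) * ((k + 30) * q k)) (real (k + 1))
        \<le> real (covering_number ?N 2 Pt T (2 * (8 * l k) * ((k + 30) * q k)) \<epsilon>)" .
    qed
  qed
  ultimately show ?thesis using TN by (intro that)
qed

theorem theorem5p9:
  fixes a :: "nat \<Rightarrow> real \<Rightarrow> real" and X :: "(real \<times> real) set"
  assumes "scaling_function a"
    and "\<And>t. t > 0 \<Longrightarrow> (\<lambda>n. ln (a n t) / real n) \<longlonglongrightarrow> 0"
    and "X \<in> {torus, disc, annulus}"
  shows "\<exists>T. invertible_mpt (normalized_lebesgue X) T \<and>
             good_cyclic_approximation (normalized_lebesgue X) T \<and>
             upper_slow_entropy a (normalized_lebesgue X) T = \<infinity>"
proof -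
  \<comment> \<open>A square contained in all three phase spaces, in the disc because
    \<open>x + y \<le> 1\<close>; it witnesses positive measure.\<close>
  let ?B = "box (0, 0) (1 / 2, 1 / 2) :: (real \<times> real) set"
  have strip: "{0..<1::real} \<times> A \<in> sets borel" if "A \<in> sets borel" for A :: "real set"
    unfolding borel_prod[symmetric] using that by (intro pair_measureI) simp_all
  have "torus \<in> sets borel" "annulus \<in> sets borel" "disc \<in> sets borel"
    unfolding torus_def annulus_def disc_def by (simp_all add: strip)
  then have X: "X \<in> sets borel" using assms(3) by blast
  have sub: "?B \<subseteq> X"
  proof
    fix p assume "p \<in> ?B"
    then obtain x y where p: "p = (x, y)" "0 < x" "x < 1/2" "0 < y" "y < 1/2"
      by (cases p) (auto simp: box_def Basis_prod_def)
    have "norm p \<le> norm x + norm y" unfolding p(1) by (rule norm_Pair_le)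
    then have "norm p \<le> 1" using p by simp
    then show "p \<in> X" using assms(3) p by (auto simp: torus_def annulus_def disc_def dist_norm)
  qed
  have "bounded X"
    using assms(3) bounded_subset[of "{0..1::real} \<times> {0..1::real}" X]
    by (auto simp: torus_def annulus_def disc_def intro!: bounded_Times)
  then have "emeasure lborel X < \<infinity>" by (rule emeasure_bounded_finite)
  moreover have "emeasure lborel X \<noteq> 0"
  proof
    assume "emeasure lborel X = 0"
    then have "emeasure lborel ?B \<le> 0" using emeasure_mono[OF sub, of lborel] X by simp
    then have "emeasure lborel ?B = 0" by simp
    moreover have "emeasure lborel ?B = ennreal (\<Prod>b\<in>Basis. ((1/2, 1/2) - (0, 0) :: real \<times> real) \<bullet> b)"
      by (rule emeasure_lborel_box) (auto simp: Basis_prod_def)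
    moreover have "0 < (\<Prod>b\<in>Basis. ((1/2, 1/2) - (0, 0) :: real \<times> real) \<bullet> b)"
      by (rule prod_pos) (auto simp: Basis_prod_def)
    ultimately show False by (simp add: ennreal_eq_0_iff)
  qed
  moreover have "emeasure lborel X \<noteq> \<infinity>" using calculation(1) by auto
  ultimately obtain T where "invertible_mpt (normalized_lebesgue X) T"
    "good_cyclic_approximation (normalized_lebesgue X) T"
    "upper_slow_entropy a (normalized_lebesgue X) T = \<infinity>"
    using slow_entropy_realization[OF assms(1,2) X] by blast
  then show ?thesis by blast
qed

end
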